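(* Fix constants $0<\alpha<\frac12$, $0\le\gamma<\frac12$, $2\gamma<\gamma_q\le1$, $c_q>0$, $M_1>1$, $M_2>0$, $\bar c\ge 1$. There exist positive constants $c,c_1,C_1$, depending only on these fixed constants, such that for all sufficiently large $n,p$, every integer $k\ge1$ with $k\le c\min\{p^{\gamma},\frac{n}{\log p}\}$, and every $\xi\in\Xi(q,\bar c)$ with $q=c_q\,p^{\gamma_q}$ (the dense loading regime), the minimax expected length of $(1-\alpha)$-level confidence intervals for $\xi^{\intercal}\beta$ over $\Theta(k)$ satisfies $$c_1\,\|\xi\|_\infty\, k\sqrt{\frac{\log p}{n}}\;\le\; L^*_\alpha\big(\Theta(k),\xi^{\intercal}\beta\big)\;\le\; C_1\,\|\xi\|_\infty\, k\sqrt{\frac{\log p}{n}} .$$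
   Context: Model: one observes $Z=(Z_1,\dots,Z_n)$ with $Z_i=(y_i,X_{i\cdot})\in\mathbb{R}^{p+1}$, $y=X\beta+\epsilon$, where $X\in\mathbb{R}^{n\times p}$ has i.i.d. rows $X_{i\cdot}\sim N_p(0,\Sigma)$, independent of $\epsilon\sim N_n(0,\sigma^2 \mathrm{I})$. Let $\Omega=\Sigma^{-1}$ and $\theta=(\beta,\Omega,\sigma)$; $\mathbb{P}_\theta,\mathbb{E}_\theta$ are the corresponding probability and expectation. $\|x\|_0$ is the number of nonzero entries of $x$, $\mathrm{supp}(x)$ the set of their indices. Parameter space: $\Theta(k)=\{(\beta,\Omega,\sigma):\|\beta\|_0\le k,\ \frac1{M_1}\le\lambda_{\min}(\Omega)\le\lambda_{\max}(\Omega)\le M_1,\ 0<\sigma\le M_2\}$. Loadings: $\Xi(q,\bar c)=\{\xi\in\mathbb{R}^p:\ \|\xi\|_0=q,\ \xi\ne 0,\ \max_{j\in\mathrm{supp}(\xi)}|\xi_j|\le\bar c\min_{j\in\mathrm{supp}(\xi)}|\xi_j|\}$. Confidence intervals: for a parameter space $\Theta$ and functional $\mathrm{T}$ of $\beta$, $\mathcal{I}_\alpha(\Theta,\mathrm{T})$ is the set of all intervals $\mathrm{CI}=[l(Z),u(Z)]$ with $\inf_{\theta\in\Theta}\mathbb{P}_\theta(l(Z)\le \mathrm{T}(\beta)\le u(Z))\ge 1-\alpha$; the length is $L(\mathrm{CI})=u(Z)-l(Z)$. The minimax expected length is $L^*_\alpha(\Theta,\mathrm{T})=\inf_{\mathrm{CI}\in\mathcal{I}_\alpha(\Theta,\mathrm{T})}\sup_{\theta\in\Theta}\mathbb{E}_\theta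 L(\mathrm{CI})$. *)

theory Defs
  imports
    "HOL-Probability.Probability"
    "Jordan_Normal_Form.Spectral_Radius"
begin

text \<open>
  The dimensions \<open>n\<close> and \<open>p\<close> are quantified inside the theorem, so vectors and matrices that occur as
  parameters are \<open>real vec\<close> and \<open>real mat\<close>, whereas data points, which have to live in a measurable
  space, are extensional functions in a product measure \<open>Pi\<^sub>M {..<p}\<close>. Names shared by
  \<open>Jordan_Normal_Form\<close> and \<open>HOL-Analysis\<close> are written qualified.
\<close>

definition vsupp :: "real Matrix.vec \<Rightarrow> nat set" where
  "vsupp v = {j. j < dim_vec v \<and> vec_index v j \<noteq> 0}"

definition l0_norm :: "real Matrix.vec \<Rightarrow> nat" where
  "l0_norm v = card (vsupp v)"

definition linf_norm :: "real Matrix.vec \<Rightarrow> real" where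
  "linf_norm v = Max ((\<lambda>j. \<bar>vec_index v j\<bar>) ` {..<dim_vec v})"

text \<open>For the symmetric matrices used below the real spectrum is the whole spectrum.\<close>

definition lambda_min :: "real Matrix.mat \<Rightarrow> real" where
  "lambda_min A = Min (spectrum A)"

definition lambda_max :: "real Matrix.mat \<Rightarrow> real" where
  "lambda_max A = Max (spectrum A)"

text \<open>
  The law \<open>N\<^sub>p(0, \<Sigma>)\<close> in terms of the precision matrix \<open>\<Omega> = \<Sigma>\<^sup>-\<^sup>1\<close>: the normalising factor
  \<open>det (2 \<pi> \<Sigma>) powr (-1/2)\<close> of the usual density is \<open>sqrt (det \<Omega> / (2 \<pi>) ^ p)\<close>.
\<close>

definition mvnormal :: "nat \<Rightarrow> real Matrix.mat \<Rightarrow> (nat \<Rightarrow> real) measure" where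
  "mvnormal p \<Omega> = density (Pi\<^sub>M {..<p} (\<lambda>_. lborel))
     (\<lambda>x. ennreal (sqrt (Determinant.det \<Omega> / (2 * pi) ^ p) *
        exp (- scalar_prod (Matrix.vec p x) (mult_mat_vec \<Omega> (Matrix.vec p x)) / 2)))"

text \<open>An observation \<open>Z\<close> maps \<open>i < n\<close> to the pair of the response \<open>y\<^sub>i\<close> and the \<open>i\<close>-th row of \<open>X\<close>.\<close>

type_synonym obs = "nat \<Rightarrow> real \<times> (nat \<Rightarrow> real)"

definition obs_space :: "nat \<Rightarrow> nat \<Rightarrow> obs measure" where
  "obs_space n p = Pi\<^sub>M {..<n} (\<lambda>_. borel \<Otimes>\<^sub>M Pi\<^sub>M {..<p} (\<lambda>_. borel))"

type_synonym param = "real Matrix.vec \<times> real Matrix.mat \<times> real"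

text \<open>
  The law of \<open>Z\<close> under \<open>\<theta> = (\<beta>, \<Omega>, \<sigma>)\<close>: the image, under \<open>y = X \<beta> + \<epsilon>\<close>, of the product of the law
  of the design and the law of the noise. The last argument of \<open>normal_density\<close> before the point is
  the standard deviation.
\<close>

definition obs_law :: "nat \<Rightarrow> nat \<Rightarrow> param \<Rightarrow> obs measure" where
  "obs_law n p = (\<lambda>(\<beta>, \<Omega>, \<sigma>).
     distr (Pi\<^sub>M {..<n} (\<lambda>_. mvnormal p \<Omega>) \<Otimes>\<^sub>M
            Pi\<^sub>M {..<n} (\<lambda>_. density lborel (\<lambda>t. ennreal (normal_density 0 \<sigma> t))))
       (obs_space n p)
       (\<lambda>(X, \<epsilon>). \<lambda>i\<in>{..<n}. ((\<Sum>j<p. X i j * vec_index \<beta> j) + \<epsilon> i, X i)))"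

definition Theta :: "real \<Rightarrow> real \<Rightarrow> nat \<Rightarrow> nat \<Rightarrow> param set" where
  "Theta M1 M2 p k = {(\<beta>, \<Omega>, \<sigma>).
     \<beta> \<in> carrier_vec p \<and> l0_norm \<beta> \<le> k \<and>
     \<Omega> \<in> carrier_mat p p \<and> transpose_mat \<Omega> = \<Omega> \<and>
     1 / M1 \<le> lambda_min \<Omega> \<and> lambda_max \<Omega> \<le> M1 \<and>
     0 < \<sigma> \<and> \<sigma> \<le> M2}"

definition Xi :: "nat \<Rightarrow> nat \<Rightarrow> real \<Rightarrow> real Matrix.vec set" where
  "Xi p q cbar = {\<xi> \<in> carrier_vec p. l0_norm \<xi> = q \<and> \<xi> \<noteq> 0\<^sub>v p \<and>
     Max ((\<lambda>j. \<bar>vec_index \<xi> j\<bar>) ` vsupp \<xi>) \<le> cbar * Min ((\<lambda>j. \<bar>vec_index \<xi> j\<bar>) ` vsupp \<xi>)}"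

text \<open>
  An interval is given by its end points \<open>(l, u)\<close>. The condition \<open>l z \<le> u z\<close> excludes inverted
  intervals, whose negative lengths would make the minimax expected length meaningless.
\<close>

definition conf_intervals ::
    "nat \<Rightarrow> nat \<Rightarrow> real \<Rightarrow> param set \<Rightarrow> (real Matrix.vec \<Rightarrow> real) \<Rightarrow> ((obs \<Rightarrow> real) \<times> (obs \<Rightarrow> real)) set" where
  "conf_intervals n p \<alpha> \<Theta> T = {(l, u).
     l \<in> borel_measurable (obs_space n p) \<and> u \<in> borel_measurable (obs_space n p) \<and>
     (\<forall>z\<in>space (obs_space n p). l z \<le> u z) \<and>
     (INF (\<beta>, \<Omega>, \<sigma>)\<in>\<Theta>.
        emeasure (obs_law n p (\<beta>, \<Omega>, \<sigma>)) {z \<in> space (obs_space n p). l z \<le> T \<beta> \<and> T \<beta> \<le> u z})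
       \<ge> ennreal (1 - \<alpha>)}"

text \<open>
  Lengths are nonnegative, so expected lengths are taken in \<open>ennreal\<close>, where an infinite expected
  length is \<open>\<infinity>\<close> and not the default value \<open>0\<close> of the Bochner integral.
\<close>

definition minimax_length ::
    "nat \<Rightarrow> nat \<Rightarrow> real \<Rightarrow> param set \<Rightarrow> (real Matrix.vec \<Rightarrow> real) \<Rightarrow> ennreal" where
  "minimax_length n p \<alpha> \<Theta> T =
     (INF (l, u)\<in>conf_intervals n p \<alpha> \<Theta> T. SUP \<theta>\<in>\<Theta>. \<integral>\<^sup>+ z. ennreal (u z - l z) \<partial>obs_law n p \<theta>)"

end

theory Submission
  imports Defs
begin

text \<open>
  Both bounds compare \<open>\<xi> \<bullet> \<beta>\<close> with the \<open>\<ell>\<^sub>1\<close> error \<open>k * sqrt (ln p / n)\<close> of sparse regression.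

  \<^bold>\<open>Lower bound\<close> (\<open>minimax_length_ge\<close>). Take the identity as precision matrix. The null parameter is
  \<open>\<beta> = 0\<close> with noise level \<open>s\<close>, and the alternatives put an entry \<open>\<rho> * sgn (\<xi>\<^sub>j)\<close> with
  \<open>\<rho>\<^sup>2\<close> of order \<open>ln p / n\<close> on \<open>k\<close> coordinates of the support of \<open>\<xi>\<close>, with the noise level lowered to
  \<open>\<tau>\<^sup>2 = s\<^sup>2 - k \<rho>\<^sup>2\<close>, so that the variance of the response does not change. All signs agree with those of
  \<open>\<xi>\<close>, so each alternative moves \<open>\<xi> \<bullet> \<beta>\<close> from \<open>0\<close> to at least
  \<open>\<rho> k \<parallel>\<xi>\<parallel>\<^sub>\<infinity> / cbar\<close>, in the same direction. Because the variances match, the likelihood ratios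
  of two alternatives for one observation have correlation exactly \<open>s\<^sup>2 / (s\<^sup>2 - b \<bullet> b')\<close>
  (\<open>likelihood_ratio_correlation\<close>), which depends only on the overlap of the two supports. The
  support is cut into \<open>k\<close> blocks of \<open>r\<close> coordinates and one coordinate is chosen in each, so the
  overlap of two random supports is a sum of independent Bernoulli variables, and the second moment
  of the mixture is at most \<open>exp (k T / r)\<close> with \<open>T = exp (2 n \<rho>\<^sup>2 / s\<^sup>2)\<close>. The constant in
  \<open>\<rho>\<^sup>2\<close> is chosen such that \<open>T = p powr (\<gamma>\<^sub>q - 2 \<gamma>)\<close>, a growing power of \<open>p\<close> because
  \<open>2 \<gamma> < \<gamma>\<^sub>q\<close>. As \<open>r\<close> is of order \<open>p powr \<gamma>\<^sub>q / k\<close> and \<open>k \<le> c * p powr \<gamma>\<close>, the ratio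
  \<open>k T / r\<close> is at most \<open>4 c / c\<^sub>q\<close>. So the mixture is close to the null for small \<open>c\<close>
  (\<open>mixture_comparison\<close>), and under the null the interval has to contain \<open>0\<close> and to reach beyond
  the separation with probability bounded away from \<open>0\<close>.

  \<^bold>\<open>Upper bound\<close> (\<open>minimax_length_le\<close>). As \<open>k\<close> and the bounds \<open>M\<^sub>1\<close>, \<open>M\<^sub>2\<close> are known, it
  suffices to put an interval of fixed length around \<open>\<xi> \<bullet> b\<close>, where \<open>b\<close> is any \<open>k\<close>-sparse vector whose
  residual is nearly uncorrelated with every column of the design. Two such vectors are close in
  \<open>\<ell>\<^sub>1\<close> once the design is bounded below on \<open>2 k\<close>-sparse vectors (\<open>dantzig_l1_bound\<close>). For
  the latter it is enough to control the column norms and the images of integer vectors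
  (\<open>restricted_eigenvalue\<close>). For large \<open>p\<close> there are at most \<open>exp (6 k ln p)\<close> of these, and each of them is bad with
  probability at most \<open>exp (- n / 4)\<close>, so \<open>k ln p \<le> c n\<close> makes the union bound work.

  The precision matrix enters the upper bound only through the laws of linear forms. By
  \<open>mvnormal_linear_form\<close> such a form is a centred normal variable whose variance lies between
  \<open>\<parallel>v\<parallel>\<^sup>2 / M\<^sub>1\<close> and \<open>M\<^sub>1 \<parallel>v\<parallel>\<^sup>2\<close>.
\<close>

section \<open>Gaussian integrals on the line\<close>

abbreviation gauss :: "real \<Rightarrow> real measure" where
  "gauss \<sigma> \<equiv> density lborel (\<lambda>t. ennreal (normal_density 0 \<sigma> t))"

lemma nn_integral_normal_density:
  assumes "0 < \<sigma>"
  shows "(\<integral>\<^sup>+ t. ennreal (normal_density \<mu> \<sigma> t) \<partial>lborel) = 1"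
proof -
  interpret prob_space "density lborel (\<lambda>x. ennreal (normal_density \<mu> \<sigma> x))"
    by (rule prob_space_normal_density[OF assms])
  show ?thesis
    using emeasure_space_1 by (simp add: emeasure_density)
qed

text \<open>Completing the square; every Gaussian integral below is reduced to this one.\<close>

lemma nn_integral_exp_quadratic:
  fixes d \<kappa> :: real
  assumes d: "0 < d"
  shows "(\<integral>\<^sup>+ t. ennreal (exp (- (d * t\<^sup>2 + 2 * \<kappa> * t) / 2)) \<partial>lborel)
       = ennreal (sqrt (2 * pi / d) * exp (\<kappa>\<^sup>2 / (2 * d)))"
proof -
  have eq: "exp (- (d * t\<^sup>2 + 2 * \<kappa> * t) / 2)
      = (sqrt (2 * pi / d) * exp (\<kappa>\<^sup>2 / (2 * d))) * normal_density (- \<kappa> / d) (1 / sqrt d) t" for t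
  proof -
    have 1: "(1 / sqrt d)\<^sup>2 = 1 / d" using d by (simp add: power_divide)
    have 2: "- (t - - \<kappa> / d)\<^sup>2 / (2 * (1 / d)) = - (d * t\<^sup>2 + 2 * \<kappa> * t) / 2 - \<kappa>\<^sup>2 / (2 * d)"
      using d by (simp add: field_simps power2_eq_square)
    have 3: "sqrt (2 * pi / d) * (1 / sqrt (2 * pi * (1 / d))) = 1"
      using d by (simp add: real_sqrt_divide real_sqrt_mult)
    have "(sqrt (2 * pi / d) * exp (\<kappa>\<^sup>2 / (2 * d))) * normal_density (- \<kappa> / d) (1 / sqrt d) t
        = (sqrt (2 * pi / d) * (1 / sqrt (2 * pi * (1 / d)))) *
          (exp (\<kappa>\<^sup>2 / (2 * d)) * exp (- (d * t\<^sup>2 + 2 * \<kappa> * t) / 2 - \<kappa>\<^sup>2 / (2 * d)))"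
      unfolding normal_density_def 1 2 by (simp only: mult_ac)
    also have "\<dots> = exp (- (d * t\<^sup>2 + 2 * \<kappa> * t) / 2)"
      unfolding 3 by (simp add: exp_add[symmetric])
    finally show ?thesis by simp
  qed
  have "(\<integral>\<^sup>+ t. ennreal (exp (- (d * t\<^sup>2 + 2 * \<kappa> * t) / 2)) \<partial>lborel) =
      (\<integral>\<^sup>+ t. ennreal (sqrt (2 * pi / d) * exp (\<kappa>\<^sup>2 / (2 * d))) * ennreal (normal_density (- \<kappa> / d) (1 / sqrt d) t) \<partial>lborel)"
    unfolding eq using d by (intro nn_integral_cong) (simp add: ennreal_mult')
  also have "\<dots> = ennreal (sqrt (2 * pi / d) * exp (\<kappa>\<^sup>2 / (2 * d)))"
    using d by (subst nn_integral_cmult) (auto simp: nn_integral_normal_density)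
  finally show ?thesis .
qed

lemma nn_integral_gauss_exp_square:
  assumes a: "a > - 1 / 2"
  shows "(\<integral>\<^sup>+ g. ennreal (exp (- a * g\<^sup>2)) \<partial>gauss 1) = ennreal (1 / sqrt (1 + 2 * a))"
proof -
  have pos: "1 + 2 * a > 0" using a by simp
  have "(\<integral>\<^sup>+ g. ennreal (exp (- a * g\<^sup>2)) \<partial>gauss 1)
      = (\<integral>\<^sup>+ g. ennreal (1 / sqrt (2 * pi)) * ennreal (exp (- ((1 + 2 * a) * g\<^sup>2 + 2 * 0 * g) / 2)) \<partial>lborel)"
    by (subst nn_integral_density)
       (auto intro!: nn_integral_cong simp: normal_density_def ennreal_mult'[symmetric] exp_add[symmetric] field_simps)
  also have "\<dots> = ennreal (1 / sqrt (2 * pi)) * ennreal (sqrt (2 * pi / (1 + 2 * a)))"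
    by (subst nn_integral_cmult, simp, subst nn_integral_exp_quadratic[OF pos]) simp
  also have "\<dots> = ennreal (1 / sqrt (1 + 2 * a))"
    using pos by (subst ennreal_mult'[symmetric]) (auto simp: real_sqrt_divide real_sqrt_mult)
  finally show ?thesis .
qed

lemma nn_integral_gauss_exp:
  assumes "0 < \<sigma>"
  shows "(\<integral>\<^sup>+ e. ennreal (exp (s * e)) \<partial>gauss \<sigma>) = ennreal (exp (s\<^sup>2 * \<sigma>\<^sup>2 / 2))"
proof -
  have pos: "1 / \<sigma>\<^sup>2 > 0" using assms by simp
  have eq: "normal_density 0 \<sigma> e * exp (s * e)
      = (1 / sqrt (2 * pi * \<sigma>\<^sup>2)) * exp (- (1 / \<sigma>\<^sup>2 * e\<^sup>2 + 2 * (- s) * e) / 2)" for e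
    using assms by (simp add: normal_density_def exp_add[symmetric] field_simps)
  have "(\<integral>\<^sup>+ e. ennreal (exp (s * e)) \<partial>gauss \<sigma>)
      = (\<integral>\<^sup>+ e. ennreal (1 / sqrt (2 * pi * \<sigma>\<^sup>2)) * ennreal (exp (- (1 / \<sigma>\<^sup>2 * e\<^sup>2 + 2 * (- s) * e) / 2)) \<partial>lborel)"
    by (subst nn_integral_density)
       (auto intro!: nn_integral_cong simp: ennreal_mult'[symmetric] eq)
  also have "\<dots> = ennreal (1 / sqrt (2 * pi * \<sigma>\<^sup>2)) * ennreal (sqrt (2 * pi / (1 / \<sigma>\<^sup>2)) * exp ((- s)\<^sup>2 / (2 * (1 / \<sigma>\<^sup>2))))"
    by (subst nn_integral_cmult, simp, subst nn_integral_exp_quadratic[OF pos]) simp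
  also have "\<dots> = ennreal (exp (s\<^sup>2 * \<sigma>\<^sup>2 / 2))"
    using assms by (subst ennreal_mult'[symmetric]) (auto simp: real_sqrt_divide real_sqrt_mult)
  finally show ?thesis .
qed

lemma nn_integral_gauss_scale:
  assumes [measurable]: "f \<in> borel_measurable borel" and s: "0 < s"
  shows "(\<integral>\<^sup>+ g. f (s * g) \<partial>gauss 1) = (\<integral>\<^sup>+ u. f u \<partial>gauss s)"
proof -
  have "(\<integral>\<^sup>+ u. f u \<partial>gauss s) = (\<integral>\<^sup>+ u. ennreal (normal_density 0 s u) * f u \<partial>lborel)"
    by (subst nn_integral_density) auto
  also have "\<dots> = ennreal \<bar>s\<bar> * (\<integral>\<^sup>+ g. ennreal (normal_density 0 s (0 + s * g)) * f (0 + s * g) \<partial>lborel)"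
    by (rule nn_integral_real_affine) (use s in auto)
  also have "\<dots> = (\<integral>\<^sup>+ g. ennreal s * (ennreal (normal_density 0 s (s * g)) * f (s * g)) \<partial>lborel)"
    using s by (subst nn_integral_cmult) auto
  also have "\<dots> = (\<integral>\<^sup>+ g. ennreal (normal_density 0 1 g) * f (s * g) \<partial>lborel)"
  proof (rule nn_integral_cong)
    fix g :: real
    have "s * normal_density 0 s (s * g) = normal_density 0 1 g"
      using s by (simp add: normal_density_def real_sqrt_mult power_mult_distrib)
    then show "ennreal s * (ennreal (normal_density 0 s (s * g)) * f (s * g)) = ennreal (normal_density 0 1 g) * f (s * g)"
      using s by (metis ennreal_mult' less_imp_le mult.assoc)
  qed
  also have "\<dots> = (\<integral>\<^sup>+ g. f (s * g) \<partial>gauss 1)"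
    by (subst nn_integral_density) auto
  finally show ?thesis by simp
qed

lemma nn_integral_gauss_reflect:
  assumes [measurable]: "f \<in> borel_measurable borel"
  shows "(\<integral>\<^sup>+ g. f (- g) \<partial>gauss 1) = (\<integral>\<^sup>+ g. f g \<partial>gauss 1)"
proof -
  have "(\<integral>\<^sup>+ u. f u \<partial>gauss 1) = (\<integral>\<^sup>+ u. ennreal (normal_density 0 1 u) * f u \<partial>lborel)"
    by (subst nn_integral_density) auto
  also have "\<dots> = ennreal \<bar>-1\<bar> * (\<integral>\<^sup>+ g. ennreal (normal_density 0 1 (0 + (-1) * g)) * f (0 + (-1) * g) \<partial>lborel)"
    by (rule nn_integral_real_affine) auto
  also have "\<dots> = (\<integral>\<^sup>+ g. ennreal (normal_density 0 1 g) * f (- g) \<partial>lborel)"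
    by (auto intro!: nn_integral_cong simp: normal_density_def)
  also have "\<dots> = (\<integral>\<^sup>+ g. f (- g) \<partial>gauss 1)"
    by (subst nn_integral_density) auto
  finally show ?thesis by simp
qed

lemma nn_integral_gauss_abs:
  assumes [measurable]: "f \<in> borel_measurable borel"
  shows "(\<integral>\<^sup>+ g. f (\<bar>b\<bar> * g) \<partial>gauss 1) = (\<integral>\<^sup>+ g. f (b * g) \<partial>gauss 1)"
  using nn_integral_gauss_reflect[of "\<lambda>g. f (b * g)"] by (cases "b \<ge> 0") (auto simp: abs_if)

lemma sigma_finite_gauss: "0 < \<sigma> \<Longrightarrow> sigma_finite_measure (gauss \<sigma>)"
  using prob_space_normal_density prob_space_imp_sigma_finite by blast

text \<open>After scaling both variables this is the convolution of two normal densities. The general case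
  below reduces to it because the normal law is symmetric.\<close>

lemma gauss_convolution_pos:
  assumes f[measurable]: "f \<in> borel_measurable borel" and a: "0 < a" and b: "0 < b"
  shows "(\<integral>\<^sup>+ x. \<integral>\<^sup>+ y. f (a * x + b * y) \<partial>gauss 1 \<partial>gauss 1) = (\<integral>\<^sup>+ z. f (sqrt (a\<^sup>2 + b\<^sup>2) * z) \<partial>gauss 1)"
proof -
  interpret ga: sigma_finite_measure "gauss a" by (rule sigma_finite_gauss[OF a])
  interpret gb: sigma_finite_measure "gauss b" by (rule sigma_finite_gauss[OF b])
  have c: "sqrt (a\<^sup>2 + b\<^sup>2) > 0" using a by (simp add: add_pos_nonneg)
  have "(\<integral>\<^sup>+ x. \<integral>\<^sup>+ y. f (a * x + b * y) \<partial>gauss 1 \<partial>gauss 1) = (\<integral>\<^sup>+ x. \<integral>\<^sup>+ v. f (a * x + v) \<partial>gauss b \<partial>gauss 1)"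
    by (intro nn_integral_cong nn_integral_gauss_scale[OF _ b]) auto
  also have "\<dots> = (\<integral>\<^sup>+ u. \<integral>\<^sup>+ v. f (u + v) \<partial>gauss b \<partial>gauss a)"
    by (rule nn_integral_gauss_scale[OF _ a]) measurable
  also have "\<dots> = (\<integral>\<^sup>+ u. ennreal (normal_density 0 a u) * (\<integral>\<^sup>+ v. f (u + v) \<partial>gauss b) \<partial>lborel)"
    by (subst nn_integral_density) auto
  also have "\<dots> = (\<integral>\<^sup>+ u. \<integral>\<^sup>+ w. ennreal (normal_density 0 a u) * (ennreal (normal_density 0 b (w - u)) * f w) \<partial>lborel \<partial>lborel)"
  proof (rule nn_integral_cong)
    fix u :: real
    have "(\<integral>\<^sup>+ v. f (u + v) \<partial>gauss b) = (\<integral>\<^sup>+ v. ennreal (normal_density 0 b v) * f (u + v) \<partial>lborel)"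
      by (subst nn_integral_density) auto
    also have "\<dots> = ennreal \<bar>1\<bar> * (\<integral>\<^sup>+ w. ennreal (normal_density 0 b (- u + 1 * w)) * f (u + (- u + 1 * w)) \<partial>lborel)"
      by (rule nn_integral_real_affine) auto
    also have "\<dots> = (\<integral>\<^sup>+ w. ennreal (normal_density 0 b (w - u)) * f w \<partial>lborel)" by simp
    finally show "ennreal (normal_density 0 a u) * (\<integral>\<^sup>+ v. f (u + v) \<partial>gauss b) =
       (\<integral>\<^sup>+ w. ennreal (normal_density 0 a u) * (ennreal (normal_density 0 b (w - u)) * f w) \<partial>lborel)"
      by (simp add: nn_integral_cmult)
  qed
  also have "\<dots> = (\<integral>\<^sup>+ w. \<integral>\<^sup>+ u. ennreal (normal_density 0 a u) * (ennreal (normal_density 0 b (w - u)) * f w) \<partial>lborel \<partial>lborel)"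
    by (rule lborel_pair.Fubini') measurable
  also have "\<dots> = (\<integral>\<^sup>+ w. ennreal (normal_density 0 (sqrt (a\<^sup>2 + b\<^sup>2)) w) * f w \<partial>lborel)"
  proof (rule nn_integral_cong)
    fix w :: real
    have "(\<integral>\<^sup>+ u. ennreal (normal_density 0 a u) * (ennreal (normal_density 0 b (w - u)) * f w) \<partial>lborel)
       = (\<integral>\<^sup>+ u. ennreal (normal_density 0 b (w - u) * normal_density 0 a u) * f w \<partial>lborel)"
      by (intro nn_integral_cong) (simp add: ennreal_mult' mult_ac)
    also have "\<dots> = (\<integral>\<^sup>+ u. ennreal (normal_density 0 b (w - u) * normal_density 0 a u) \<partial>lborel) * f w"
      by (rule nn_integral_multc) measurable
    also have "\<dots> = ennreal (normal_density 0 (sqrt (a\<^sup>2 + b\<^sup>2)) w) * f w"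
      using fun_cong[OF conv_normal_density_zero_mean[OF b a], of w] by (simp add: add.commute)
    finally show "(\<integral>\<^sup>+ u. ennreal (normal_density 0 a u) * (ennreal (normal_density 0 b (w - u)) * f w) \<partial>lborel)
       = ennreal (normal_density 0 (sqrt (a\<^sup>2 + b\<^sup>2)) w) * f w" .
  qed
  also have "\<dots> = (\<integral>\<^sup>+ z. f z \<partial>gauss (sqrt (a\<^sup>2 + b\<^sup>2)))"
    by (subst nn_integral_density) auto
  also have "\<dots> = (\<integral>\<^sup>+ z. f (sqrt (a\<^sup>2 + b\<^sup>2) * z) \<partial>gauss 1)"
    by (rule nn_integral_gauss_scale[OF f c, symmetric])
  finally show ?thesis .
qed

lemma gauss_convolution:
  assumes f[measurable]: "f \<in> borel_measurable borel"
  shows "(\<integral>\<^sup>+ x. \<integral>\<^sup>+ y. f (a * x + b * y) \<partial>gauss 1 \<partial>gauss 1) = (\<integral>\<^sup>+ z. f (sqrt (a\<^sup>2 + b\<^sup>2) * z) \<partial>gauss 1)"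
proof -
  interpret prob_space "gauss 1" by (rule prob_space_normal_density) simp
  have sf: "sigma_finite_measure (gauss 1)" by (rule sigma_finite_gauss) simp
  have [measurable]: "(\<lambda>x. \<integral>\<^sup>+ y. f (x + \<bar>b\<bar> * y) \<partial>gauss 1) \<in> borel_measurable borel"
    by measurable
  have "(\<integral>\<^sup>+ x. \<integral>\<^sup>+ y. f (a * x + b * y) \<partial>gauss 1 \<partial>gauss 1) = (\<integral>\<^sup>+ x. \<integral>\<^sup>+ y. f (a * x + \<bar>b\<bar> * y) \<partial>gauss 1 \<partial>gauss 1)"
    by (intro nn_integral_cong nn_integral_gauss_abs[symmetric, where f = "\<lambda>y. f (_ + y)"]) measurable
  also have "\<dots> = (\<integral>\<^sup>+ x. \<integral>\<^sup>+ y. f (\<bar>a\<bar> * x + \<bar>b\<bar> * y) \<partial>gauss 1 \<partial>gauss 1)"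
    by (rule nn_integral_gauss_abs[symmetric, where f = "\<lambda>x. \<integral>\<^sup>+ y. f (x + \<bar>b\<bar> * y) \<partial>gauss 1"]) measurable
  also have "\<dots> = (\<integral>\<^sup>+ z. f (sqrt (a\<^sup>2 + b\<^sup>2) * z) \<partial>gauss 1)"
  proof (cases "a = 0 \<or> b = 0")
    case True
    then show ?thesis
      using emeasure_space_1 by auto
  next
    case False
    then show ?thesis using gauss_convolution_pos[OF f, of "\<bar>a\<bar>" "\<bar>b\<bar>"] by simp
  qed
  finally show ?thesis .
qed

section \<open>Linear forms of a centred Gaussian vector\<close>

definition quad :: "nat \<Rightarrow> (nat \<Rightarrow> nat \<Rightarrow> real) \<Rightarrow> (nat \<Rightarrow> real) \<Rightarrow> real" where
  "quad p A x = (\<Sum>i<p. \<Sum>j<p. A i j * x i * x j)"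

lemma quad_cong: "(\<And>i. i < p \<Longrightarrow> x i = y i) \<Longrightarrow> quad p A x = quad p A y"
  unfolding quad_def by (intro sum.cong) auto

lemma borel_measurable_quad [measurable]:
  "quad p A \<in> borel_measurable (Pi\<^sub>M {..<p} (\<lambda>_. lborel))"
  unfolding quad_def by measurable

lemma quad_Suc:
  assumes sym: "\<And>i j. i < Suc p \<Longrightarrow> j < Suc p \<Longrightarrow> A i j = A j i"
  shows "quad (Suc p) A x = quad p A x + 2 * (\<Sum>i<p. A i p * x i) * x p + A p p * (x p)\<^sup>2"
proof -
  have "(\<Sum>j<p. A p j * x p * x j) = (\<Sum>i<p. A i p * x i) * x p"
    unfolding sum_distrib_right by (intro sum.cong refl) (use sym[of p] in auto)
  moreover have "(\<Sum>i<p. A i p * x i * x p) = (\<Sum>i<p. A i p * x i) * x p"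
    unfolding sum_distrib_right by (intro sum.cong refl)
  ultimately show ?thesis
    unfolding quad_def by (simp add: sum.distrib power2_eq_square algebra_simps)
qed

text \<open>The precision matrix of the first \<open>p\<close> coordinates once coordinate \<open>p\<close> has been integrated out.\<close>

definition schur :: "nat \<Rightarrow> (nat \<Rightarrow> nat \<Rightarrow> real) \<Rightarrow> nat \<Rightarrow> nat \<Rightarrow> real" where
  "schur p A i j = A i j - A i p * A j p / A p p"

text \<open>The minimum of the form in \<open>quad_Suc\<close> over the last coordinate.\<close>

lemma quad_schur:
  "quad p (schur p A) x = quad p A x - (\<Sum>i<p. A i p * x i)\<^sup>2 / A p p"
proof -
  have "(\<Sum>i<p. A i p * x i)\<^sup>2 / A p p = (\<Sum>i<p. \<Sum>j<p. A i p * A j p / A p p * x i * x j)"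
    unfolding power2_eq_square sum_product sum_divide_distrib
    by (intro sum.cong refl) (simp add: field_simps)
  then show ?thesis
    unfolding quad_def schur_def by (simp add: sum_subtractf left_diff_distrib)
qed

text \<open>The block factorisation \<open>A = [1, b / d; 0, 1] * [S, 0; b\<^sup>T, d]\<close>, where \<open>d\<close> is the last diagonal
  entry, \<open>b\<close> the column above it and \<open>S\<close> the Schur complement.\<close>

lemma det_schur:
  assumes sym: "\<And>i j. i < Suc p \<Longrightarrow> j < Suc p \<Longrightarrow> A i j = A j i" and d: "A p p \<noteq> 0"
  shows "Determinant.det (Matrix.mat (Suc p) (Suc p) (\<lambda>(i, j). A i j))
       = A p p * Determinant.det (Matrix.mat p p (\<lambda>(i, j). schur p A i j))"
proof -
  let ?b = "Matrix.mat p 1 (\<lambda>(i, j). A i p / A p p)"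
  let ?bt = "Matrix.mat 1 p (\<lambda>(i, j). A j p)"
  let ?d = "Matrix.mat 1 1 (\<lambda>(i, j). A p p)"
  let ?S = "Matrix.mat p p (\<lambda>(i, j). schur p A i j)"
  let ?L = "four_block_mat (1\<^sub>m p) ?b (0\<^sub>m 1 p) (1\<^sub>m 1)"
  let ?R = "four_block_mat ?S (0\<^sub>m p 1) ?bt ?d"
  have "?L * ?R = four_block_mat (1\<^sub>m p * ?S + ?b * ?bt) (1\<^sub>m p * 0\<^sub>m p 1 + ?b * ?d)
      (0\<^sub>m 1 p * ?S + 1\<^sub>m 1 * ?bt) (0\<^sub>m 1 p * 0\<^sub>m p 1 + 1\<^sub>m 1 * ?d)"
    by (rule mult_four_block_mat[of _ p p _ 1 _ 1]) auto
  also have "\<dots> = Matrix.mat (Suc p) (Suc p) (\<lambda>(i, j). A i j)"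
  proof (rule eq_matI)
    fix i j
    assume "i < dim_row (Matrix.mat (Suc p) (Suc p) (\<lambda>(i, j). A i j))"
      "j < dim_col (Matrix.mat (Suc p) (Suc p) (\<lambda>(i, j). A i j))"
    then have ij: "i < Suc p" "j < Suc p" by simp_all
    have last: "A p j = A j p" using sym[of p j] ij by simp
    show "four_block_mat (1\<^sub>m p * ?S + ?b * ?bt) (1\<^sub>m p * 0\<^sub>m p 1 + ?b * ?d)
        (0\<^sub>m 1 p * ?S + 1\<^sub>m 1 * ?bt) (0\<^sub>m 1 p * 0\<^sub>m p 1 + 1\<^sub>m 1 * ?d) $$ (i, j)
      = Matrix.mat (Suc p) (Suc p) (\<lambda>(i, j). A i j) $$ (i, j)"
      using d ij last
      by (cases "i < p"; cases "j < p")
        (simp_all add: four_block_mat_def scalar_prod_def schur_def less_Suc_eq)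
  qed simp_all
  finally have eq: "Matrix.mat (Suc p) (Suc p) (\<lambda>(i, j). A i j) = ?L * ?R" ..
  have detL: "Determinant.det ?L = 1"
    by (subst det_four_block_mat_lower_left_zero[of _ p _ 1]) auto
  have detR: "Determinant.det ?R = Determinant.det ?S * Determinant.det ?d"
    by (rule det_four_block_mat_upper_right_zero[of _ p _ 1]) auto
  have detd: "Determinant.det ?d = A p p"
    by (simp add: det_single)
  have cL: "?L \<in> carrier_mat (Suc p) (Suc p)" and cR: "?R \<in> carrier_mat (Suc p) (Suc p)"
    by (rule carrier_matI; simp)+
  show ?thesis
    unfolding eq det_mult[OF cL cR] detL detR detd by simp
qed

text \<open>The integral over one coordinate with the others fixed: given these, the coordinate is normal
  with mean \<open>- \<kappa> / d\<close> and variance \<open>1 / d\<close>.\<close>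

lemma shifted_gauss_integral:
  fixes f :: "real \<Rightarrow> ennreal"
  assumes f[measurable]: "f \<in> borel_measurable borel" and d: "0 < d"
  shows "(\<integral>\<^sup>+ t. f (a + c * t) * ennreal (exp (- (q + 2 * \<kappa> * t + d * t\<^sup>2) / 2)) \<partial>lborel)
    = ennreal (sqrt (2 * pi / d)) * ennreal (exp (- (q - \<kappa>\<^sup>2 / d) / 2)) *
      (\<integral>\<^sup>+ g. f (a - c * \<kappa> / d + c / sqrt d * g) \<partial>gauss 1)"
proof -
  have sd: "sqrt d > 0" "1 / sqrt d \<noteq> 0" using d by auto
  have "(\<integral>\<^sup>+ t. f (a + c * t) * ennreal (exp (- (q + 2 * \<kappa> * t + d * t\<^sup>2) / 2)) \<partial>lborel)
    = ennreal \<bar>1 / sqrt d\<bar> * (\<integral>\<^sup>+ g. f (a + c * (- \<kappa> / d + 1 / sqrt d * g)) *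
       ennreal (exp (- (q + 2 * \<kappa> * (- \<kappa> / d + 1 / sqrt d * g) + d * (- \<kappa> / d + 1 / sqrt d * g)\<^sup>2) / 2)) \<partial>lborel)"
    by (rule nn_integral_real_affine[OF _ sd(2)]) measurable
  also have "\<dots> = ennreal (1 / sqrt d) * (\<integral>\<^sup>+ g. ennreal (sqrt (2 * pi)) * ennreal (exp (- (q - \<kappa>\<^sup>2 / d) / 2)) *
       (ennreal (normal_density 0 1 g) * f (a - c * \<kappa> / d + c / sqrt d * g)) \<partial>lborel)"
  proof -
    { fix g :: real
    have 1: "a + c * (- \<kappa> / d + 1 / sqrt d * g) = a - c * \<kappa> / d + c / sqrt d * g"
      by (simp add: algebra_simps)
    have ss: "sqrt d * sqrt d = d" using d by simp
    have 2: "q + 2 * \<kappa> * (- \<kappa> / d + 1 / sqrt d * g) + d * (- \<kappa> / d + 1 / sqrt d * g)\<^sup>2 = (q - \<kappa>\<^sup>2 / d) + g\<^sup>2"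
    proof -
      have "d * (- \<kappa> / d + 1 / sqrt d * g)\<^sup>2 = d * (\<kappa>\<^sup>2 / d\<^sup>2 - 2 * \<kappa> * g / (d * sqrt d) + g\<^sup>2 / (sqrt d * sqrt d))"
        by (simp add: power2_eq_square algebra_simps)
      also have "\<dots> = \<kappa>\<^sup>2 / d - 2 * \<kappa> * g / sqrt d + g\<^sup>2"
        unfolding ss using d by (simp add: algebra_simps power2_eq_square)
      finally show ?thesis by (simp add: algebra_simps power2_eq_square)
    qed
    have "exp (- ((q - \<kappa>\<^sup>2 / d) + g\<^sup>2) / 2) = sqrt (2 * pi) * exp (- (q - \<kappa>\<^sup>2 / d) / 2) * normal_density 0 1 g"
      by (simp add: normal_density_def exp_add[symmetric] field_simps)
    then have "ennreal (exp (- ((q - \<kappa>\<^sup>2 / d) + g\<^sup>2) / 2)) =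
        ennreal (sqrt (2 * pi)) * ennreal (exp (- (q - \<kappa>\<^sup>2 / d) / 2)) * ennreal (normal_density 0 1 g)"
      by (simp add: ennreal_mult')
    then have "f (a + c * (- \<kappa> / d + 1 / sqrt d * g)) *
       ennreal (exp (- (q + 2 * \<kappa> * (- \<kappa> / d + 1 / sqrt d * g) + d * (- \<kappa> / d + 1 / sqrt d * g)\<^sup>2) / 2)) =
       ennreal (sqrt (2 * pi)) * ennreal (exp (- (q - \<kappa>\<^sup>2 / d) / 2)) *
       (ennreal (normal_density 0 1 g) * f (a - c * \<kappa> / d + c / sqrt d * g))"
      unfolding 1 2 by (simp add: mult_ac)
    } note pt = this
    show ?thesis unfolding pt using sd by simp
  qed
  also have "\<dots> = ennreal (1 / sqrt d) * (ennreal (sqrt (2 * pi)) * ennreal (exp (- (q - \<kappa>\<^sup>2 / d) / 2)) *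
       (\<integral>\<^sup>+ g. ennreal (normal_density 0 1 g) * f (a - c * \<kappa> / d + c / sqrt d * g) \<partial>lborel))"
    by (subst nn_integral_cmult) auto
  also have "\<dots> = (ennreal (1 / sqrt d) * ennreal (sqrt (2 * pi))) * ennreal (exp (- (q - \<kappa>\<^sup>2 / d) / 2)) *
      (\<integral>\<^sup>+ g. f (a - c * \<kappa> / d + c / sqrt d * g) \<partial>gauss 1)"
    by (subst nn_integral_density) (auto simp: mult_ac)
  also have "ennreal (1 / sqrt d) * ennreal (sqrt (2 * pi)) = ennreal (sqrt (2 * pi / d))"
    using d by (subst ennreal_mult'[symmetric]) (auto simp: real_sqrt_divide)
  finally show ?thesis .
qed

text \<open>A linear form of a Gaussian vector is normal with variance \<open>v \<bullet> A\<^sup>-\<^sup>1 v\<close>. The induction integrates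
  out the last coordinate, which replaces \<open>A\<close> by its Schur complement and \<open>v\<close> by a corrected vector
  and adds an independent normal contribution \<open>(v p)\<^sup>2 / d\<close> to the variance. The inverse matrix is
  represented by a solution \<open>w\<close> of \<open>A w = v\<close>, which is carried through the induction. The factor in
  front of the right-hand side is the total mass, so the case \<open>f = 1\<close> also normalises the density.\<close>

lemma gaussian_linear_form:
  fixes A :: "nat \<Rightarrow> nat \<Rightarrow> real" and v :: "nat \<Rightarrow> real"
  assumes "\<forall>i<p. \<forall>j<p. A i j = A j i"
    and "\<forall>x. (\<exists>i<p. x i \<noteq> 0) \<longrightarrow> quad p A x > 0"
  shows "0 < Determinant.det (Matrix.mat p p (\<lambda>(i, j). A i j)) \<and>
    (\<exists>w V. 0 \<le> V \<and> (\<forall>i<p. (\<Sum>j<p. A i j * w j) = v i) \<and> V = (\<Sum>j<p. v j * w j) \<and>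
      (\<forall>f \<in> borel_measurable borel. (\<integral>\<^sup>+ x. f (\<Sum>j<p. v j * x j) * ennreal (exp (- quad p A x / 2)) \<partial>Pi\<^sub>M {..<p} (\<lambda>_. lborel))
        = ennreal (sqrt ((2 * pi) ^ p / Determinant.det (Matrix.mat p p (\<lambda>(i, j). A i j)))) *
          (\<integral>\<^sup>+ g. f (sqrt V * g) \<partial>gauss 1)))"
  using assms
proof (induction p arbitrary: A v)
  case 0
  interpret prob_space "gauss 1" by (rule prob_space_normal_density) simp
  have "Determinant.det (Matrix.mat 0 0 (\<lambda>(i, j). A i j)) = 1"
    by (rule det_dim_zero) auto
  then show ?case
    using emeasure_space_1 by (auto simp: PiM_empty quad_def nn_integral_count_space_finite)
next
  case (Suc p)
  note sym = Suc.prems(1)[rule_format] and pd = Suc.prems(2)[rule_format]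
  define d where "d = A p p"
  define b where "b = (\<lambda>i. A i p)"
  define S where "S = schur p A"
  have qS: "quad (Suc p) A x = quad p A x + 2 * (\<Sum>i<p. b i * x i) * x p + d * (x p)\<^sup>2" for x
    using quad_Suc[of p A x] sym by (simp add: b_def d_def)
  have d: "0 < d"
  proof -
    have "quad (Suc p) A (\<lambda>i. if i = p then 1 else 0) > 0"
      by (rule pd) (auto intro!: exI[of _ p])
    moreover have "quad p A (\<lambda>i. if i = p then 1 else 0) = quad p A (\<lambda>i. 0)"
      by (rule quad_cong) auto
    ultimately show ?thesis by (simp add: qS) (simp add: quad_def)
  qed
  have qSch: "quad p S x = quad p A x - (\<Sum>i<p. b i * x i)\<^sup>2 / d" for x
    unfolding S_def b_def d_def by (rule quad_schur)
  have symS: "\<forall>i<p. \<forall>j<p. S i j = S j i"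
    using sym by (simp add: S_def schur_def)
  have pdS: "\<forall>x. (\<exists>i<p. x i \<noteq> 0) \<longrightarrow> quad p S x > 0"
  proof (intro allI impI)
    fix x :: "nat \<Rightarrow> real" assume that: "\<exists>i<p. x i \<noteq> 0"
    \<comment> \<open>the last coordinate that minimises the form for the given first coordinates\<close>
    define y where "y = x(p := - (\<Sum>i<p. b i * x i) / d)"
    have "quad (Suc p) A y > 0"
      using that by (intro pd) (auto simp: y_def intro: less_SucI)
    moreover have "quad p A y = quad p A x" by (rule quad_cong) (auto simp: y_def)
    moreover have "(\<Sum>i<p. b i * y i) = (\<Sum>i<p. b i * x i)" by (intro sum.cong) (auto simp: y_def)
    moreover have "y p = - (\<Sum>i<p. b i * x i) / d" by (simp add: y_def)
    ultimately have "quad p A x + 2 * (\<Sum>i<p. b i * x i) * (- (\<Sum>i<p. b i * x i) / d) + d * (- (\<Sum>i<p. b i * x i) / d)\<^sup>2 > 0"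
      unfolding qS by simp
    also have "quad p A x + 2 * (\<Sum>i<p. b i * x i) * (- (\<Sum>i<p. b i * x i) / d) + d * (- (\<Sum>i<p. b i * x i) / d)\<^sup>2 = quad p S x"
      unfolding qSch using d by (simp add: field_simps power2_eq_square)
    finally show "quad p S x > 0" .
  qed
  \<comment> \<open>the conditional mean of the last coordinate is \<open>- (\<Sum>i<p. b i * x i) / d\<close>\<close>
  define v' where "v' = (\<lambda>i. v i - v p * b i / d)"
  let ?DS = "Determinant.det (Matrix.mat p p (\<lambda>(i, j). S i j))"
  obtain w V where DS: "0 < ?DS" and V: "0 \<le> V" and w_all: "\<forall>i<p. (\<Sum>j<p. S i j * w j) = v' i"
    and Vw: "V = (\<Sum>j<p. v' j * w j)"
    and IH_all: "\<forall>f \<in> borel_measurable borel. (\<integral>\<^sup>+ x. f (\<Sum>j<p. v' j * x j) * ennreal (exp (- quad p S x / 2)) \<partial>Pi\<^sub>M {..<p} (\<lambda>_. lborel))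
        = ennreal (sqrt ((2 * pi) ^ p / ?DS)) * (\<integral>\<^sup>+ g. f (sqrt V * g) \<partial>gauss 1)"
    using Suc.IH[OF symS pdS, of v'] by (elim conjE exE) (rule that)
  note w = w_all[rule_format] and IH = IH_all[rule_format]
  let ?D = "Determinant.det (Matrix.mat (Suc p) (Suc p) (\<lambda>(i, j). A i j))"
  have D: "?D = d * ?DS"
    unfolding S_def d_def by (rule det_schur) (use sym d in \<open>auto simp: d_def\<close>)
  define bw where "bw = (\<Sum>j<p. b j * w j)"
  define w' where "w' = w(p := (v p - bw) / d)"
  have w'p: "w' p = (v p - bw) / d" and w'l: "\<And>j. j < p \<Longrightarrow> w' j = w j" by (auto simp: w'_def)
  have solve: "(\<Sum>j<Suc p. A i j * w' j) = v i" if "i < Suc p" for i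
  proof (cases "i = p")
    case True
    have "(\<Sum>j<p. A p j * w' j) = bw"
      unfolding bw_def b_def using sym[of p] by (intro sum.cong) (auto simp: w'l)
    then show ?thesis using True d by (simp add: w'p d_def[symmetric])
  next
    case False
    then have i: "i < p" using that by simp
    have "(\<Sum>j<p. A i j * w' j) = (\<Sum>j<p. S i j * w j + b i / d * (b j * w j))"
      by (intro sum.cong) (auto simp: w'l S_def schur_def b_def d_def algebra_simps)
    also have "\<dots> = v' i + b i / d * bw"
      by (simp add: sum.distrib w[OF i] bw_def sum_distrib_left)
    finally show ?thesis using d by (simp add: w'p v'_def b_def[symmetric] field_simps)
      (simp add: b_def mult_ac)
  qed
  define V' where "V' = V + (v p)\<^sup>2 / d"
  have V': "V' = (\<Sum>j<Suc p. v j * w' j)"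
  proof -
    have "(\<Sum>j<p. v j * w' j) = (\<Sum>j<p. v' j * w j + v p / d * (b j * w j))"
      by (intro sum.cong) (auto simp: w'l v'_def algebra_simps)
    also have "\<dots> = V + v p / d * bw"
      by (simp add: sum.distrib Vw bw_def sum_distrib_left)
    finally show ?thesis using d by (simp add: V'_def w'p field_simps power2_eq_square)
  qed
  have main: "(\<integral>\<^sup>+ x. f (\<Sum>j<Suc p. v j * x j) * ennreal (exp (- quad (Suc p) A x / 2)) \<partial>Pi\<^sub>M {..<Suc p} (\<lambda>_. lborel))
        = ennreal (sqrt ((2 * pi) ^ Suc p / ?D)) * (\<integral>\<^sup>+ g. f (sqrt V' * g) \<partial>gauss 1)"
    if f[measurable]: "f \<in> borel_measurable borel" for f :: "real \<Rightarrow> ennreal"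
  proof -
    interpret P: product_sigma_finite "\<lambda>_::nat. lborel :: real measure" ..
    have [measurable]: "quad (Suc p) A \<in> borel_measurable (Pi\<^sub>M (insert p {..<p}) (\<lambda>_. lborel))"
      using borel_measurable_quad[of "Suc p" A] by (simp add: lessThan_Suc)
    interpret g1: sigma_finite_measure "gauss 1" by (rule sigma_finite_gauss) simp
    define F where "F u = (\<integral>\<^sup>+ g. f (u + v p / sqrt d * g) \<partial>gauss 1)" for u
    have [measurable]: "F \<in> borel_measurable borel" unfolding F_def by measurable
    have "(\<integral>\<^sup>+ x. f (\<Sum>j<Suc p. v j * x j) * ennreal (exp (- quad (Suc p) A x / 2)) \<partial>Pi\<^sub>M {..<Suc p} (\<lambda>_. lborel))
      = (\<integral>\<^sup>+ x. \<integral>\<^sup>+ t. f (\<Sum>j<Suc p. v j * (x(p := t)) j) * ennreal (exp (- quad (Suc p) A (x(p := t)) / 2)) \<partial>lborel \<partial>Pi\<^sub>M {..<p} (\<lambda>_. lborel))"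
      unfolding lessThan_Suc by (rule P.product_nn_integral_insert) (auto simp: simp del: fun_upd_apply)
    also have "\<dots> = (\<integral>\<^sup>+ x. ennreal (sqrt (2 * pi / d)) * (F (\<Sum>j<p. v' j * x j) * ennreal (exp (- quad p S x / 2))) \<partial>Pi\<^sub>M {..<p} (\<lambda>_. lborel))"
    proof (rule nn_integral_cong)
      fix x :: "nat \<Rightarrow> real"
      define \<kappa> where "\<kappa> = (\<Sum>i<p. b i * x i)"
      have a: "(\<Sum>j<Suc p. v j * (x(p := t)) j) = (\<Sum>j<p. v j * x j) + v p * t" for t
        by simp
      have q: "quad (Suc p) A (x(p := t)) = quad p A x + 2 * \<kappa> * t + d * t\<^sup>2" for t
      proof -
        have "quad p A (x(p := t)) = quad p A x" by (rule quad_cong) auto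
        then show ?thesis by (simp add: qS \<kappa>_def)
      qed
      have v'x: "(\<Sum>j<p. v j * x j) - v p * \<kappa> / d = (\<Sum>j<p. v' j * x j)"
      proof -
        have "(\<Sum>j<p. v' j * x j) = (\<Sum>j<p. v j * x j - v p / d * (b j * x j))"
          by (intro sum.cong) (auto simp: v'_def algebra_simps)
        then show ?thesis by (simp only: sum_subtractf sum_distrib_left[symmetric] \<kappa>_def) simp
      qed
      show "(\<integral>\<^sup>+ t. f (\<Sum>j<Suc p. v j * (x(p := t)) j) * ennreal (exp (- quad (Suc p) A (x(p := t)) / 2)) \<partial>lborel)
         = ennreal (sqrt (2 * pi / d)) * (F (\<Sum>j<p. v' j * x j) * ennreal (exp (- quad p S x / 2)))"
        unfolding a q shifted_gauss_integral[OF f d] v'x F_def qSch \<kappa>_def[symmetric] by (simp add: mult_ac)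
    qed
    also have "\<dots> = ennreal (sqrt (2 * pi / d)) * (\<integral>\<^sup>+ x. F (\<Sum>j<p. v' j * x j) * ennreal (exp (- quad p S x / 2)) \<partial>Pi\<^sub>M {..<p} (\<lambda>_. lborel))"
      by (rule nn_integral_cmult) measurable
    also have "\<dots> = ennreal (sqrt (2 * pi / d)) * (ennreal (sqrt ((2 * pi) ^ p / ?DS)) * (\<integral>\<^sup>+ g. F (sqrt V * g) \<partial>gauss 1))"
      by (subst IH) auto
    also have "(\<integral>\<^sup>+ g. F (sqrt V * g) \<partial>gauss 1) = (\<integral>\<^sup>+ g. f (sqrt V' * g) \<partial>gauss 1)"
    proof -
      have "(sqrt V)\<^sup>2 + (v p / sqrt d)\<^sup>2 = V'" using V d by (simp add: V'_def power_divide)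
      then show ?thesis unfolding F_def gauss_convolution[OF f] by simp
    qed
    also have "ennreal (sqrt (2 * pi / d)) * (ennreal (sqrt ((2 * pi) ^ p / ?DS)) * (\<integral>\<^sup>+ g. f (sqrt V' * g) \<partial>gauss 1))
      = ennreal (sqrt (2 * pi / d) * sqrt ((2 * pi) ^ p / ?DS)) * (\<integral>\<^sup>+ g. f (sqrt V' * g) \<partial>gauss 1)"
      using d DS by (subst ennreal_mult') (auto simp: mult.assoc)
    also have "sqrt (2 * pi / d) * sqrt ((2 * pi) ^ p / ?DS) = sqrt ((2 * pi) ^ Suc p / ?D)"
      unfolding D by (simp add: real_sqrt_mult[symmetric])
    finally show ?thesis .
  qed
  have "0 < ?D" unfolding D using d DS by (rule mult_pos_pos)
  moreover have "0 \<le> V'" unfolding V'_def using V d by simp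
  ultimately show ?case
    by (intro conjI exI[of _ w'] exI[of _ V'] allI impI ballI) (assumption | erule solve | rule V' | erule main)+
qed

section \<open>Eigenvalues of the precision matrix and variances of linear forms\<close>

lemma quad_add:
  assumes sym: "\<forall>i<p. \<forall>j<p. A i j = A j i"
  shows "quad p A (\<lambda>i. x i + t * y i) = quad p A x + 2 * t * (\<Sum>i<p. y i * (\<Sum>j<p. A i j * x j)) + t\<^sup>2 * quad p A y"
proof -
  have 1: "(\<Sum>i<p. y i * (\<Sum>j<p. A i j * x j)) = (\<Sum>i<p. \<Sum>j<p. A i j * y i * x j)"
    by (simp add: sum_distrib_left mult_ac)
  have 2: "(\<Sum>i<p. \<Sum>j<p. A i j * y i * x j) = (\<Sum>i<p. \<Sum>j<p. A i j * x i * y j)"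
    by (subst sum.swap) (intro sum.cong refl, use sym in auto)
  have "quad p A (\<lambda>i. x i + t * y i) = (\<Sum>i<p. \<Sum>j<p. A i j * x i * x j + t * (A i j * y i * x j)
      + t * (A i j * x i * y j) + t\<^sup>2 * (A i j * y i * y j))"
    unfolding quad_def by (intro sum.cong refl) (simp add: algebra_simps power2_eq_square)
  also have "\<dots> = quad p A x + t * (\<Sum>i<p. \<Sum>j<p. A i j * y i * x j) + t * (\<Sum>i<p. \<Sum>j<p. A i j * x i * y j) + t\<^sup>2 * quad p A y"
    unfolding quad_def by (simp only: sum.distrib sum_distrib_left)
  finally show ?thesis unfolding 1 2 by simp
qed

lemma quad_scale: "quad p A (\<lambda>i. c * x i) = c\<^sup>2 * quad p A x"
  unfolding quad_def sum_distrib_left by (intro sum.cong refl) (simp add: power2_eq_square)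

text \<open>The first-order condition at a minimum, for one direction.\<close>

lemma linear_term_zero_if_nonneg:
  fixes b c :: real
  assumes "\<And>t. 0 \<le> 2 * t * b + t\<^sup>2 * c"
  shows "b = 0"
proof (rule ccontr)
  assume b: "b \<noteq> 0"
  define e where "e = \<bar>c\<bar> + 1"
  have e: "e > 0" "c < e" unfolding e_def by auto
  have "0 \<le> 2 * (- b / e) * b + (- b / e)\<^sup>2 * c" by (rule assms)
  also have "\<dots> = b\<^sup>2 / e\<^sup>2 * (c - 2 * e)"
    using e by (simp add: field_simps power2_eq_square)
  also have "\<dots> < 0"
    using b e by (intro mult_pos_neg) auto
  finally show False by simp
qed

text \<open>Vectors are functions on \<open>nat\<close> here, so the unit sphere of \<open>\<real>\<^sup>n\<close> is a closed part of a product of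
  compact intervals.\<close>

lemma compact_unit_sphere:
  "compact {x :: nat \<Rightarrow> real. (\<forall>i\<ge>n. x i = 0) \<and> (\<Sum>i<n. (x i)\<^sup>2) = 1}"
proof -
  let ?C = "Pi\<^sub>E UNIV (\<lambda>i. if i < n then {-1..1} else {0 :: real})"
  have "compactin (product_topology (\<lambda>i::nat. euclidean) UNIV) ?C"
    by (subst compactin_PiE) auto
  then have C: "compact ?C" by (simp add: euclidean_product_topology)
  have "continuous_on UNIV (\<lambda>x :: nat \<Rightarrow> real. \<Sum>i<n. (x i)\<^sup>2)"
    by (intro continuous_intros continuous_on_product_coordinates)
  then have cl: "closed {x :: nat \<Rightarrow> real. (\<Sum>i<n. (x i)\<^sup>2) = 1}"
    by (intro closed_Collect_eq) auto
  have "{x :: nat \<Rightarrow> real. (\<forall>i\<ge>n. x i = 0) \<and> (\<Sum>i<n. (x i)\<^sup>2) = 1} = ?C \<inter> {x. (\<Sum>i<n. (x i)\<^sup>2) = 1}"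
  proof (intro Set.set_eqI iffI)
    fix x :: "nat \<Rightarrow> real"
    assume x: "x \<in> {x. (\<forall>i\<ge>n. x i = 0) \<and> (\<Sum>i<n. (x i)\<^sup>2) = 1}"
    have "\<bar>x i\<bar> \<le> 1" if "i < n" for i
    proof -
      have "(x i)\<^sup>2 \<le> (\<Sum>i<n. (x i)\<^sup>2)" by (rule member_le_sum) (use that in auto)
      then have "(x i)\<^sup>2 \<le> 1" using x by simp
      then show ?thesis by (simp add: abs_square_le_1)
    qed
    then show "x \<in> ?C \<inter> {x. (\<Sum>i<n. (x i)\<^sup>2) = 1}" using x by (auto simp: abs_le_iff)
  next
    fix x :: "nat \<Rightarrow> real"
    assume x: "x \<in> ?C \<inter> {x. (\<Sum>i<n. (x i)\<^sup>2) = 1}"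
    have "x i = 0" if "i \<ge> n" for i
    proof -
      have "x i \<in> (if i < n then {-1..1} else {0})" using x by blast
      then show ?thesis using that by simp
    qed
    then show "x \<in> {x. (\<forall>i\<ge>n. x i = 0) \<and> (\<Sum>i<n. (x i)\<^sup>2) = 1}" using x by simp
  qed
  then show ?thesis using compact_Int_closed[OF C cl] by simp
qed

text \<open>A minimiser of the quadratic form on the unit sphere is an eigenvector, because every directional
  derivative of \<open>quad n A y - m * (\<Sum>i<n. (y i)\<^sup>2)\<close> vanishes there. Applied to \<open>A\<close> and \<open>- A\<close> it
  shows that both extreme values of the form are eigenvalues.\<close>

lemma rayleigh_minimum:
  fixes A :: "nat \<Rightarrow> nat \<Rightarrow> real"
  assumes sym: "\<forall>i<n. \<forall>j<n. A i j = A j i" and n: "0 < n"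
  shows "\<exists>m x. (\<exists>i<n. x i \<noteq> 0) \<and> (\<forall>i<n. (\<Sum>j<n. A i j * x j) = m * x i) \<and>
    (\<forall>y. m * (\<Sum>i<n. (y i)\<^sup>2) \<le> quad n A y)"
proof -
  let ?S = "{x :: nat \<Rightarrow> real. (\<forall>i\<ge>n. x i = 0) \<and> (\<Sum>i<n. (x i)\<^sup>2) = 1}"
  have "(\<lambda>i. if i = 0 then 1 else 0) \<in> ?S"
  proof -
    have "(\<Sum>i<n. (if i = 0 then 1 else 0 :: real)\<^sup>2) = (\<Sum>i<n. if i = 0 then 1 else 0)"
      by (intro sum.cong) auto
    then show ?thesis using n by simp
  qed
  then have ne: "?S \<noteq> {}" by (rule ex_in_conv[THEN iffD1, OF exI])
  have "continuous_on UNIV (quad n A)"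
    unfolding quad_def[abs_def] by (intro continuous_intros continuous_on_product_coordinates)
  then have cont: "continuous_on ?S (quad n A)"
    by (rule continuous_on_subset) simp
  obtain x where x: "x \<in> ?S" and min: "\<And>y. y \<in> ?S \<Longrightarrow> quad n A x \<le> quad n A y"
    using continuous_attains_inf[OF compact_unit_sphere ne cont] by (elim bexE) (rule that, assumption, drule bspec)
  define m where "m = quad n A x"
  have low: "m * (\<Sum>i<n. (y i)\<^sup>2) \<le> quad n A y" for y
  proof (cases "(\<Sum>i<n. (y i)\<^sup>2) = 0")
    case True
    then have "\<forall>i<n. y i = 0" by (subst (asm) sum_nonneg_eq_0_iff) auto
    then have "quad n A y = 0" unfolding quad_def by (intro sum.neutral ballI) auto
    then show ?thesis using True by simp
  next
    case False
    define s where "s = (\<Sum>i<n. (y i)\<^sup>2)"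
    have s: "s > 0" using False sum_nonneg[of "{..<n}" "\<lambda>i. (y i)\<^sup>2"] unfolding s_def by auto
    define z where "z = (\<lambda>i. if i < n then y i / sqrt s else 0)"
    have "(\<Sum>i<n. (z i)\<^sup>2) = (\<Sum>i<n. (y i)\<^sup>2 / s)"
      by (intro sum.cong) (use s in \<open>auto simp: z_def power_divide\<close>)
    also have "\<dots> = 1" using s by (simp add: sum_divide_distrib[symmetric] s_def[symmetric])
    finally have "z \<in> ?S" by (auto simp: z_def)
    then have "m \<le> quad n A z" unfolding m_def by (rule min)
    also have "quad n A z = quad n A (\<lambda>i. (1 / sqrt s) * y i)" by (rule quad_cong) (auto simp: z_def)
    also have "\<dots> = quad n A y / s" using s by (simp only: quad_scale) (simp add: power_divide)
    finally show ?thesis using s by (simp add: s_def[symmetric] field_simps)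
  qed
  have "(\<Sum>j<n. A i j * x j) = m * x i" if i: "i < n" for i
  proof -
    define e where "e = (\<lambda>j. if j = i then 1 else 0 :: real)"
    have e: "(\<Sum>k<n. e k * g k) = g i" for g
    proof -
      have "(\<Sum>k<n. e k * g k) = (\<Sum>k<n. if k = i then g k else 0)"
        by (intro sum.cong) (auto simp: e_def)
      then show ?thesis using i by simp
    qed
    have "0 \<le> 2 * t * ((\<Sum>j<n. A i j * x j) - m * x i) + t\<^sup>2 * (quad n A e - m)" for t
    proof -
      have "(\<Sum>k<n. (x k + t * e k)\<^sup>2) = (\<Sum>k<n. (x k)\<^sup>2 + 2 * t * (e k * x k) + t\<^sup>2 * (e k * e k))"
        by (intro sum.cong) (auto simp: power2_eq_square algebra_simps)
      also have "\<dots> = 1 + 2 * t * x i + t\<^sup>2"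
        using x by (simp only: sum.distrib sum_distrib_left[symmetric] e) (simp add: e_def)
      finally have nrm: "(\<Sum>k<n. (x k + t * e k)\<^sup>2) = 1 + 2 * t * x i + t\<^sup>2" .
      have "m * (\<Sum>k<n. (x k + t * e k)\<^sup>2) \<le> quad n A (\<lambda>k. x k + t * e k)" by (rule low)
      then show ?thesis
        unfolding nrm quad_add[OF sym] e m_def[symmetric] by (simp add: algebra_simps)
    qed
    from linear_term_zero_if_nonneg[OF this] show ?thesis by simp
  qed
  then have eig: "\<forall>i<n. (\<Sum>j<n. A i j * x j) = m * x i" by simp
  have nz: "\<exists>i<n. x i \<noteq> 0"
  proof (rule ccontr)
    assume "\<not> (\<exists>i<n. x i \<noteq> 0)"
    then have "(\<Sum>i<n. (x i)\<^sup>2) = 0" by simp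
    then show False using x by simp
  qed
  show ?thesis
    by (rule exI[of _ m], rule exI[of _ x], intro conjI nz eig allI low)
qed

lemma eigenvalue_intro:
  assumes A: "\<Omega> \<in> carrier_mat n n" and x: "\<exists>i<n. x i \<noteq> 0"
    and ev: "\<And>i. i < n \<Longrightarrow> (\<Sum>j<n. \<Omega> $$ (i, j) * x j) = m * x i"
  shows "m \<in> spectrum \<Omega>"
proof -
  have "eigenvector \<Omega> (Matrix.vec n x) m"
    unfolding eigenvector_def
  proof (intro conjI)
    show "Matrix.vec n x \<in> carrier_vec (dim_row \<Omega>)" using A by auto
    show "Matrix.vec n x \<noteq> 0\<^sub>v (dim_row \<Omega>)"
    proof
      assume "Matrix.vec n x = 0\<^sub>v (dim_row \<Omega>)"
      then have "vec_index (Matrix.vec n x) i = 0" if "i < n" for i using A that by simp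
      then show False using x by auto
    qed
    show "\<Omega> *\<^sub>v Matrix.vec n x = m \<cdot>\<^sub>v Matrix.vec n x"
      by (rule eq_vecI) (use A ev in \<open>auto simp: scalar_prod_def lessThan_atLeast0 row_def\<close>)
  qed
  then show ?thesis unfolding spectrum_def eigenvalue_def by auto
qed

lemma quad_eigenvalue_bounds:
  assumes A: "\<Omega> \<in> carrier_mat n n" and sym: "transpose_mat \<Omega> = \<Omega>" and n: "0 < n"
  shows "lambda_min \<Omega> * (\<Sum>i<n. (y i)\<^sup>2) \<le> quad n (\<lambda>i j. \<Omega> $$ (i, j)) y"
    and "quad n (\<lambda>i j. \<Omega> $$ (i, j)) y \<le> lambda_max \<Omega> * (\<Sum>i<n. (y i)\<^sup>2)"
proof -
  have fin: "finite (spectrum \<Omega>)" by (rule card_finite_spectrum[OF A])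
  have s: "\<forall>i<n. \<forall>j<n. \<Omega> $$ (i, j) = \<Omega> $$ (j, i)"
  proof (intro allI impI)
    fix i j assume "i < n" "j < n"
    then have "transpose_mat \<Omega> $$ (i, j) = \<Omega> $$ (j, i)" using A by auto
    then show "\<Omega> $$ (i, j) = \<Omega> $$ (j, i)" using sym by simp
  qed
  have nn: "0 \<le> (\<Sum>i<n. (y i)\<^sup>2)" by (rule sum_nonneg) simp
  obtain m x where mx0: "\<exists>i<n. x i \<noteq> 0" "\<forall>i<n. (\<Sum>j<n. \<Omega> $$ (i, j) * x j) = m * x i"
    "\<forall>y. m * (\<Sum>i<n. (y i)\<^sup>2) \<le> quad n (\<lambda>i j. \<Omega> $$ (i, j)) y"
    using rayleigh_minimum[OF s n] by (elim exE conjE) (rule that[rotated], assumption, assumption, blast)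
  note mx = mx0(1) mx0(2,3)[rule_format]
  have "lambda_min \<Omega> \<le> m"
    unfolding lambda_min_def by (rule Min_le[OF fin eigenvalue_intro[OF A mx(1,2)]])
  then show "lambda_min \<Omega> * (\<Sum>i<n. (y i)\<^sup>2) \<le> quad n (\<lambda>i j. \<Omega> $$ (i, j)) y"
    using mx(3)[of y] mult_right_mono[OF _ nn] by fastforce
  have s': "\<forall>i<n. \<forall>j<n. - \<Omega> $$ (i, j) = - \<Omega> $$ (j, i)" using s by simp
  obtain m' x' where mx'0: "\<exists>i<n. x' i \<noteq> 0" "\<forall>i<n. (\<Sum>j<n. - \<Omega> $$ (i, j) * x' j) = m' * x' i"
    "\<forall>y. m' * (\<Sum>i<n. (y i)\<^sup>2) \<le> quad n (\<lambda>i j. - \<Omega> $$ (i, j)) y"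
    using rayleigh_minimum[OF s' n] by (elim exE conjE) (rule that[rotated], assumption, assumption, blast)
  note mx' = mx'0(1) mx'0(2,3)[rule_format]
  have ev: "(\<Sum>j<n. \<Omega> $$ (i, j) * x' j) = (- m') * x' i" if "i < n" for i
    using mx'(2)[OF that] by (simp add: sum_negf)
  have "- m' \<le> lambda_max \<Omega>"
    unfolding lambda_max_def by (rule Max_ge[OF fin eigenvalue_intro[OF A mx'(1) ev]])
  moreover have "quad n (\<lambda>i j. - \<Omega> $$ (i, j)) y = - quad n (\<lambda>i j. \<Omega> $$ (i, j)) y"
    unfolding quad_def by (simp add: sum_negf)
  ultimately show "quad n (\<lambda>i j. \<Omega> $$ (i, j)) y \<le> lambda_max \<Omega> * (\<Sum>i<n. (y i)\<^sup>2)"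
    using mx'(3)[of y] mult_right_mono[OF _ nn, of "- m'" "lambda_max \<Omega>"] by simp
qed

definition well_conditioned :: "real \<Rightarrow> nat \<Rightarrow> real Matrix.mat \<Rightarrow> bool" where
  "well_conditioned M p \<Omega> \<longleftrightarrow> \<Omega> \<in> carrier_mat p p \<and> transpose_mat \<Omega> = \<Omega> \<and>
     1 / M \<le> lambda_min \<Omega> \<and> lambda_max \<Omega> \<le> M"

lemma quadratic_form_eq_quad:
  assumes "\<Omega> \<in> carrier_mat p p"
  shows "scalar_prod (Matrix.vec p x) (mult_mat_vec \<Omega> (Matrix.vec p x)) = quad p (\<lambda>i j. \<Omega> $$ (i, j)) x"
proof -
  have "vec_index (mult_mat_vec \<Omega> (Matrix.vec p x)) i = (\<Sum>j<p. \<Omega> $$ (i, j) * x j)" if "i < p" for i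
    using assms that by (simp add: scalar_prod_def lessThan_atLeast0)
  then have "scalar_prod (Matrix.vec p x) (mult_mat_vec \<Omega> (Matrix.vec p x)) = (\<Sum>i<p. x i * (\<Sum>j<p. \<Omega> $$ (i, j) * x j))"
    using assms unfolding scalar_prod_def by (simp add: lessThan_atLeast0)
  also have "\<dots> = quad p (\<lambda>i j. \<Omega> $$ (i, j)) x"
    unfolding quad_def by (simp add: sum_distrib_left mult_ac)
  finally show ?thesis .
qed

lemma nn_integral_mvnormal:
  assumes A: "\<Omega> \<in> carrier_mat p p" and [measurable]: "f \<in> borel_measurable (Pi\<^sub>M {..<p} (\<lambda>_. borel))"
    and d: "0 < Determinant.det \<Omega>"
  shows "(\<integral>\<^sup>+ x. f x \<partial>mvnormal p \<Omega>) = ennreal (sqrt (Determinant.det \<Omega> / (2 * pi) ^ p)) *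
     (\<integral>\<^sup>+ x. f x * ennreal (exp (- quad p (\<lambda>i j. \<Omega> $$ (i, j)) x / 2)) \<partial>Pi\<^sub>M {..<p} (\<lambda>_. lborel))"
proof -
  have [measurable_cong]: "sets (Pi\<^sub>M {..<p} (\<lambda>_. lborel :: real measure)) = sets (Pi\<^sub>M {..<p} (\<lambda>_. borel))"
    by (intro sets_PiM_cong) auto
  have [measurable]: "quad p (\<lambda>i j. \<Omega> $$ (i, j)) \<in> borel_measurable (Pi\<^sub>M {..<p} (\<lambda>_. borel))"
    unfolding quad_def by measurable
  show ?thesis
    unfolding mvnormal_def quadratic_form_eq_quad[OF A]
    apply (subst nn_integral_density)
    subgoal by measurable
    subgoal by measurable
    apply (subst nn_integral_cmult[symmetric])
    subgoal by measurable
    apply (rule nn_integral_cong)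
    using d apply (simp add: ennreal_mult mult_ac)
    done
qed

text \<open>With \<open>\<Omega> w = v\<close> the variance is \<open>V = v \<bullet> w = w \<bullet> \<Omega> w\<close>. The lower bound expresses that
  the form is nonnegative at \<open>w - v / M\<close>, the upper bound is the Cauchy-Schwarz inequality for
  \<open>v \<bullet> w\<close> together with \<open>w \<bullet> \<Omega> w \<ge> \<parallel>w\<parallel>\<^sup>2 / M\<close>.\<close>

lemma mvnormal_linear_form:
  assumes wc: "well_conditioned M p \<Omega>" and M: "0 < M" and p: "0 < p"
  shows "\<exists>V. (\<Sum>j<p. (v j)\<^sup>2) / M \<le> V \<and> V \<le> M * (\<Sum>j<p. (v j)\<^sup>2) \<and>
    (\<forall>f :: real \<Rightarrow> ennreal. f \<in> borel_measurable borel \<longrightarrow>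
      (\<integral>\<^sup>+ x. f (\<Sum>j<p. v j * x j) \<partial>mvnormal p \<Omega>) = (\<integral>\<^sup>+ g. f (sqrt V * g) \<partial>gauss 1))"
proof -
  let ?A = "\<lambda>i j. \<Omega> $$ (i, j)"
  have A: "\<Omega> \<in> carrier_mat p p" and tr: "transpose_mat \<Omega> = \<Omega>"
    and lo: "1 / M \<le> lambda_min \<Omega>" and hi: "lambda_max \<Omega> \<le> M"
    using wc by (auto simp: well_conditioned_def)
  have sym: "\<forall>i<p. \<forall>j<p. ?A i j = ?A j i"
    using A tr by (metis carrier_matD index_transpose_mat(1))
  have nn: "0 \<le> (\<Sum>i<p. (y i :: real)\<^sup>2)" for y by (rule sum_nonneg) simp
  have lower: "(\<Sum>i<p. (y i)\<^sup>2) / M \<le> quad p ?A y" for y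
    using quad_eigenvalue_bounds(1)[OF A tr p, of y] mult_right_mono[OF lo nn, of y] by simp
  have upper: "quad p ?A y \<le> M * (\<Sum>i<p. (y i)\<^sup>2)" for y
    using quad_eigenvalue_bounds(2)[OF A tr p, of y] mult_right_mono[OF hi nn, of y] by simp
  have pd: "\<forall>x. (\<exists>i<p. x i \<noteq> 0) \<longrightarrow> quad p ?A x > 0"
  proof (intro allI impI)
    fix x :: "nat \<Rightarrow> real" assume "\<exists>i<p. x i \<noteq> 0"
    then obtain i where i: "i < p" "x i \<noteq> 0" by blast
    then have "0 < (x i)\<^sup>2" by simp
    also have "\<dots> \<le> (\<Sum>i<p. (x i)\<^sup>2)" by (rule member_le_sum) (use i in auto)
    finally have "0 < (\<Sum>i<p. (x i)\<^sup>2) / M" using M by simp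
    then show "quad p ?A x > 0" using lower[of x] by linarith
  qed
  have mat: "Matrix.mat p p (\<lambda>(i, j). ?A i j) = \<Omega>" using A by (intro eq_matI) auto
  obtain w V where det: "0 < Determinant.det \<Omega>" and V0: "0 \<le> V"
    and w: "\<forall>i<p. (\<Sum>j<p. ?A i j * w j) = v i" and V: "V = (\<Sum>j<p. v j * w j)"
    and int: "\<forall>f \<in> borel_measurable borel. (\<integral>\<^sup>+ x. f (\<Sum>j<p. v j * x j) * ennreal (exp (- quad p ?A x / 2)) \<partial>Pi\<^sub>M {..<p} (\<lambda>_. lborel))
        = ennreal (sqrt ((2 * pi) ^ p / Determinant.det \<Omega>)) * (\<integral>\<^sup>+ g. f (sqrt V * g) \<partial>gauss 1)"
    using gaussian_linear_form[OF sym pd, of v] unfolding mat by (elim conjE exE) (rule that)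
  have Vq: "V = quad p ?A w"
  proof -
    have "quad p ?A w = (\<Sum>i<p. w i * (\<Sum>j<p. ?A i j * w j))"
      unfolding quad_def by (simp add: sum_distrib_left mult_ac)
    also have "\<dots> = V" unfolding V using w by (intro sum.cong) auto
    finally show ?thesis by simp
  qed
  show ?thesis
  proof (intro exI[of _ V] conjI allI impI)
    have "0 \<le> quad p ?A (\<lambda>i. w i + (- 1 / M) * v i)"
      using lower[of "\<lambda>i. w i + (- 1 / M) * v i"] nn[of "\<lambda>i. w i + (- 1 / M) * v i"] M
      by (meson divide_nonneg_pos order_trans)
    also have "\<dots> = V + 2 * (- 1 / M) * (\<Sum>i<p. (v i)\<^sup>2) + (- 1 / M)\<^sup>2 * quad p ?A v"
    proof -
      have "(\<Sum>i<p. v i * (\<Sum>j<p. ?A i j * w j)) = (\<Sum>i<p. (v i)\<^sup>2)"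
        using w by (intro sum.cong) (auto simp: power2_eq_square)
      then show ?thesis unfolding quad_add[OF sym] Vq by simp
    qed
    also have "\<dots> \<le> V + 2 * (- 1 / M) * (\<Sum>i<p. (v i)\<^sup>2) + (- 1 / M)\<^sup>2 * (M * (\<Sum>i<p. (v i)\<^sup>2))"
      by (intro add_left_mono mult_left_mono upper) simp
    also have "\<dots> = V - (\<Sum>i<p. (v i)\<^sup>2) / M"
      using M by (simp add: field_simps power2_eq_square)
    finally show "(\<Sum>j<p. (v j)\<^sup>2) / M \<le> V" by simp
  next
    show "V \<le> M * (\<Sum>j<p. (v j)\<^sup>2)"
    proof (cases "V = 0")
      case True then show ?thesis using nn[of v] M by simp
    next
      case False
      then have Vp: "V > 0" using V0 by simp
      have "V\<^sup>2 \<le> (\<Sum>j<p. (v j)\<^sup>2) * (\<Sum>j<p. (w j)\<^sup>2)"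
        unfolding V by (rule Cauchy_Schwarz_ineq_sum)
      also have "\<dots> \<le> (\<Sum>j<p. (v j)\<^sup>2) * (M * V)"
        using lower[of w] M unfolding Vq[symmetric] by (intro mult_left_mono nn) (simp add: field_simps)
      finally have "V * V \<le> (M * (\<Sum>j<p. (v j)\<^sup>2)) * V" by (simp add: power2_eq_square mult_ac)
      then show ?thesis using Vp by simp
    qed
  next
    fix f :: "real \<Rightarrow> ennreal" assume f[measurable]: "f \<in> borel_measurable borel"
    have "(\<integral>\<^sup>+ x. f (\<Sum>j<p. v j * x j) \<partial>mvnormal p \<Omega>) = ennreal (sqrt (Determinant.det \<Omega> / (2 * pi) ^ p)) *
      (ennreal (sqrt ((2 * pi) ^ p / Determinant.det \<Omega>)) * (\<integral>\<^sup>+ g. f (sqrt V * g) \<partial>gauss 1))"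
      by (subst nn_integral_mvnormal[OF A _ det], measurable) (simp only: int[rule_format, OF f])
    also have "\<dots> = ennreal (sqrt (Determinant.det \<Omega> / (2 * pi) ^ p) * sqrt ((2 * pi) ^ p / Determinant.det \<Omega>)) * (\<integral>\<^sup>+ g. f (sqrt V * g) \<partial>gauss 1)"
      using det by (subst ennreal_mult') (auto simp: mult.assoc)
    also have "sqrt (Determinant.det \<Omega> / (2 * pi) ^ p) * sqrt ((2 * pi) ^ p / Determinant.det \<Omega>) = 1"
      using det by (simp add: real_sqrt_mult[symmetric])
    finally show "(\<integral>\<^sup>+ x. f (\<Sum>j<p. v j * x j) \<partial>mvnormal p \<Omega>) = (\<integral>\<^sup>+ g. f (sqrt V * g) \<partial>gauss 1)" by simp
  qed
qed

lemma prob_space_mvnormal: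
  assumes wc: "well_conditioned M p \<Omega>" and M: "0 < M" and p: "0 < p"
  shows "prob_space (mvnormal p \<Omega>)"
proof
  interpret g: prob_space "gauss 1" by (rule prob_space_normal_density) simp
  obtain V where "\<forall>f :: real \<Rightarrow> ennreal. f \<in> borel_measurable borel \<longrightarrow>
      (\<integral>\<^sup>+ x. f (\<Sum>j<p. 0 * x j) \<partial>mvnormal p \<Omega>) = (\<integral>\<^sup>+ g. f (sqrt V * g) \<partial>gauss 1)"
    using mvnormal_linear_form[OF assms, of "\<lambda>_. 0"] by (elim exE conjE) (rule that)
  from this[rule_format, of "\<lambda>_. 1"] show "emeasure (mvnormal p \<Omega>) (space (mvnormal p \<Omega>)) = 1"
    using g.emeasure_space_1 by simp
qed

lemma sets_mvnormal [measurable_cong]: "sets (mvnormal p \<Omega>) = sets (Pi\<^sub>M {..<p} (\<lambda>_. borel))"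
  unfolding mvnormal_def by (simp cong: sets_PiM_cong)

section \<open>Independence of the observations\<close>

abbreviation single_space :: "nat \<Rightarrow> (real \<times> (nat \<Rightarrow> real)) measure" where
  "single_space p \<equiv> borel \<Otimes>\<^sub>M Pi\<^sub>M {..<p} (\<lambda>_. borel)"

definition single_law :: "nat \<Rightarrow> real Matrix.vec \<Rightarrow> real Matrix.mat \<Rightarrow> real \<Rightarrow> (real \<times> (nat \<Rightarrow> real)) measure" where
  "single_law p \<beta> \<Omega> \<sigma> = distr (mvnormal p \<Omega> \<Otimes>\<^sub>M gauss \<sigma>) (single_space p)
     (\<lambda>(x, e). ((\<Sum>j<p. x j * vec_index \<beta> j) + e, x))"

lemma sets_single_law [measurable_cong, simp]: "sets (single_law p \<beta> \<Omega> \<sigma>) = sets (single_space p)"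
  by (simp add: single_law_def)

lemma space_single_law [simp]: "space (single_law p \<beta> \<Omega> \<sigma>) = space (single_space p)"
  by (simp add: single_law_def)

lemma measurable_component_nat:
  "j < p \<Longrightarrow> (\<lambda>x. x j) \<in> measurable (Pi\<^sub>M {..<p} (\<lambda>_. M)) M"
  by (rule measurable_component_singleton) simp

lemma measurable_linear_form:
  "(\<lambda>x :: nat \<Rightarrow> real. \<Sum>j<p. x j * b j) \<in> borel_measurable (Pi\<^sub>M {..<p} (\<lambda>_. borel))"
  by measurable

lemma measurable_single_map:
  "(\<lambda>(x, e). ((\<Sum>j<p. x j * vec_index \<beta> j) + e, x)) \<in> measurable (mvnormal p \<Omega> \<Otimes>\<^sub>M gauss \<sigma>) (single_space p)"
  by measurable

lemma prob_space_single_law: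
  assumes "prob_space (mvnormal p \<Omega>)" "0 < \<sigma>"
  shows "prob_space (single_law p \<beta> \<Omega> \<sigma>)"
proof -
  interpret A: prob_space "mvnormal p \<Omega>" by fact
  interpret B: prob_space "gauss \<sigma>" by (rule prob_space_normal_density[OF assms(2)])
  interpret pair_prob_space "mvnormal p \<Omega>" "gauss \<sigma>" ..
  show ?thesis unfolding single_law_def by (rule prob_space_distr) measurable
qed

lemma nn_integral_single_law:
  assumes "0 < \<sigma>" and [measurable]: "f \<in> borel_measurable (single_space p)"
  shows "(\<integral>\<^sup>+ z. f z \<partial>single_law p \<beta> \<Omega> \<sigma>)
       = (\<integral>\<^sup>+ x. \<integral>\<^sup>+ e. f ((\<Sum>j<p. x j * vec_index \<beta> j) + e, x) \<partial>gauss \<sigma> \<partial>mvnormal p \<Omega>)"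
proof -
  interpret B: prob_space "gauss \<sigma>" by (rule prob_space_normal_density[OF assms(1)])
  have "(\<integral>\<^sup>+ z. f z \<partial>single_law p \<beta> \<Omega> \<sigma>)
      = (\<integral>\<^sup>+ w. (case w of (x, e) \<Rightarrow> f ((\<Sum>j<p. x j * vec_index \<beta> j) + e, x)) \<partial>(mvnormal p \<Omega> \<Otimes>\<^sub>M gauss \<sigma>))"
    unfolding single_law_def by (subst nn_integral_distr) (auto simp: case_prod_unfold intro!: nn_integral_cong)
  also have "\<dots> = (\<integral>\<^sup>+ x. \<integral>\<^sup>+ e. f ((\<Sum>j<p. x j * vec_index \<beta> j) + e, x) \<partial>gauss \<sigma> \<partial>mvnormal p \<Omega>)"
    by (subst B.nn_integral_fst[symmetric]) auto
  finally show ?thesis .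
qed

text \<open>Drawing all rows and all errors first is the same as drawing \<open>n\<close> independent pairs of a row and an
  error. Both measures agree on boxes, since the integral over the errors factorises for fixed rows and the
  result factorises over the rows.\<close>

lemma obs_law_eq_PiM:
  assumes mv: "prob_space (mvnormal p \<Omega>)" and s: "0 < \<sigma>"
  shows "obs_law n p (\<beta>, \<Omega>, \<sigma>) = Pi\<^sub>M {..<n} (\<lambda>_. single_law p \<beta> \<Omega> \<sigma>)"
proof -
  interpret A: prob_space "mvnormal p \<Omega>" by fact
  interpret B: prob_space "gauss \<sigma>" by (rule prob_space_normal_density[OF s])
  interpret K: prob_space "single_law p \<beta> \<Omega> \<sigma>" by (rule prob_space_single_law[OF mv s])
  interpret PA: product_sigma_finite "\<lambda>_::nat. mvnormal p \<Omega>" ..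
  interpret PB: product_prob_space "\<lambda>_::nat. gauss \<sigma>" "{..<n}" ..
  interpret PK: product_sigma_finite "\<lambda>_::nat. single_law p \<beta> \<Omega> \<sigma>" ..
  let ?X = "Pi\<^sub>M {..<n} (\<lambda>_. mvnormal p \<Omega>)" and ?E = "Pi\<^sub>M {..<n} (\<lambda>_. gauss \<sigma>)"
  let ?g = "\<lambda>(X, \<epsilon>). \<lambda>i\<in>{..<n}. ((\<Sum>j<p. X i j * vec_index \<beta> j) + \<epsilon> i, X i)"
  have row: "(\<lambda>X. X i) \<in> measurable ?X (Pi\<^sub>M {..<p} (\<lambda>_. borel))" if "i < n" for i
    using measurable_component_nat[OF that, of "mvnormal p \<Omega>"]
    by (subst (asm) measurable_cong_sets[OF refl sets_mvnormal])
  have err: "(\<lambda>e. e i) \<in> measurable ?E borel" if "i < n" for i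
    using measurable_component_nat[OF that, of "gauss \<sigma>"]
    by (subst (asm) measurable_cong_sets[OF refl, of _ borel]) simp
  have pt: "(\<lambda>w. ((\<Sum>j<p. fst w i j * vec_index \<beta> j) + snd w i, fst w i)) \<in> measurable (?X \<Otimes>\<^sub>M ?E) (single_space p)"
    if "i < n" for i
  proof (rule measurable_Pair)
    have f: "(\<lambda>w. fst w i) \<in> measurable (?X \<Otimes>\<^sub>M ?E) (Pi\<^sub>M {..<p} (\<lambda>_. borel))"
      by (rule measurable_compose[OF measurable_fst row[OF that]])
    have s: "(\<lambda>w. snd w i) \<in> borel_measurable (?X \<Otimes>\<^sub>M ?E)"
      by (rule measurable_compose[OF measurable_snd err[OF that]])
    show "(\<lambda>w. (\<Sum>j<p. fst w i j * vec_index \<beta> j) + snd w i) \<in> borel_measurable (?X \<Otimes>\<^sub>M ?E)"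
      by (rule borel_measurable_add[OF measurable_compose[OF f measurable_linear_form] s])
    show "(\<lambda>w. fst w i) \<in> measurable (?X \<Otimes>\<^sub>M ?E) (Pi\<^sub>M {..<p} (\<lambda>_. borel))" by (rule f)
  qed
  have g: "?g \<in> measurable (?X \<Otimes>\<^sub>M ?E) (obs_space n p)"
    unfolding obs_space_def case_prod_unfold
    by (rule measurable_restrict, rule pt) (simp only: lessThan_iff)
  show ?thesis
  proof (rule PK.PiM_eqI)
    show "finite {..<n}" by simp
    show "sets (obs_law n p (\<beta>, \<Omega>, \<sigma>)) = sets (Pi\<^sub>M {..<n} (\<lambda>_. single_law p \<beta> \<Omega> \<sigma>))"
      by (simp add: obs_law_def obs_space_def cong: sets_PiM_cong)
    fix A :: "nat \<Rightarrow> (real \<times> (nat \<Rightarrow> real)) set"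
    assume "\<And>i. i \<in> {..<n} \<Longrightarrow> A i \<in> sets (single_law p \<beta> \<Omega> \<sigma>)"
    then have A: "\<And>i. i < n \<Longrightarrow> A i \<in> sets (single_space p)" by simp
    have box: "Pi\<^sub>E {..<n} A \<in> sets (obs_space n p)"
      unfolding obs_space_def by (rule sets_PiM_I_finite) (use A in auto)
    have m1: "(\<lambda>w. indicator (A i) ((\<Sum>j<p. fst w j * vec_index \<beta> j) + snd w, fst w) :: ennreal)
        \<in> borel_measurable (mvnormal p \<Omega> \<Otimes>\<^sub>M gauss \<sigma>)" if "i < n" for i
      using measurable_compose[OF measurable_single_map borel_measurable_indicator[OF A[OF that]]]
      by (simp only: case_prod_unfold)
    have "emeasure (obs_law n p (\<beta>, \<Omega>, \<sigma>)) (Pi\<^sub>E {..<n} A)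
        = (\<integral>\<^sup>+ w. indicator (Pi\<^sub>E {..<n} A) (?g w) \<partial>(?X \<Otimes>\<^sub>M ?E))"
    proof -
      have "emeasure (obs_law n p (\<beta>, \<Omega>, \<sigma>)) (Pi\<^sub>E {..<n} A)
        = (\<integral>\<^sup>+ z. indicator (Pi\<^sub>E {..<n} A) z \<partial>obs_law n p (\<beta>, \<Omega>, \<sigma>))"
        by (rule nn_integral_indicator[symmetric]) (simp add: obs_law_def box)
      also have "\<dots> = (\<integral>\<^sup>+ w. indicator (Pi\<^sub>E {..<n} A) (?g w) \<partial>(?X \<Otimes>\<^sub>M ?E))"
        unfolding obs_law_def prod.case by (rule nn_integral_distr[OF g]) (simp only: measurable_distr_eq1, rule borel_measurable_indicator[OF box])
      finally show ?thesis .
    qed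
    also have "\<dots> = (\<integral>\<^sup>+ w. (\<Prod>i<n. indicator (A i) ((\<Sum>j<p. fst w i j * vec_index \<beta> j) + snd w i, fst w i)) \<partial>(?X \<Otimes>\<^sub>M ?E))"
    proof (rule nn_integral_cong)
      fix w
      have "(\<Prod>i<n. indicator (A i) (h i)) = (if \<forall>i<n. h i \<in> A i then 1 else 0 :: ennreal)"
        for h :: "nat \<Rightarrow> real \<times> (nat \<Rightarrow> real)"
        by (auto intro!: prod_zero simp: indicator_def)
      then show "indicator (Pi\<^sub>E {..<n} A) (?g w) = (\<Prod>i<n. indicator (A i) ((\<Sum>j<p. fst w i j * vec_index \<beta> j) + snd w i, fst w i) :: ennreal)"
        by (auto simp: indicator_def case_prod_unfold PiE_iff)
    qed
    also have "\<dots> = (\<integral>\<^sup>+ X. \<integral>\<^sup>+ e. (\<Prod>i<n. indicator (A i) ((\<Sum>j<p. X i j * vec_index \<beta> j) + e i, X i)) \<partial>?E \<partial>?X)"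
    proof (subst PB.nn_integral_fst[symmetric])
      have "(\<lambda>w. indicator (A i) ((\<Sum>j<p. fst w i j * vec_index \<beta> j) + snd w i, fst w i) :: ennreal) \<in> borel_measurable (?X \<Otimes>\<^sub>M ?E)"
        if "i < n" for i
        by (rule measurable_compose[OF pt[OF that] borel_measurable_indicator[OF A[OF that]]])
      then show "(\<lambda>w. \<Prod>i<n. indicator (A i) ((\<Sum>j<p. fst w i j * vec_index \<beta> j) + snd w i, fst w i) :: ennreal) \<in> borel_measurable (?X \<Otimes>\<^sub>M ?E)"
        by (intro borel_measurable_prod_ennreal) auto
    qed simp
    also have "\<dots> = (\<integral>\<^sup>+ X. (\<Prod>i<n. \<integral>\<^sup>+ e. indicator (A i) ((\<Sum>j<p. X i j * vec_index \<beta> j) + e, X i) \<partial>gauss \<sigma>) \<partial>?X)"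
    proof (rule nn_integral_cong)
      fix X assume X: "X \<in> space ?X"
      have "(\<lambda>e. indicator (A i) ((\<Sum>j<p. X i j * vec_index \<beta> j) + e, X i) :: ennreal) \<in> borel_measurable (gauss \<sigma>)" if "i < n" for i
      proof -
        have "X i \<in> space (mvnormal p \<Omega>)" using X that by (auto simp: space_PiM)
        from measurable_compose[OF measurable_Pair1'[OF this] m1[OF that]] show ?thesis by (simp only: fst_conv snd_conv)
      qed
      then show "(\<integral>\<^sup>+ e. (\<Prod>i<n. indicator (A i) ((\<Sum>j<p. X i j * vec_index \<beta> j) + e i, X i)) \<partial>?E)
        = (\<Prod>i<n. \<integral>\<^sup>+ e. indicator (A i) ((\<Sum>j<p. X i j * vec_index \<beta> j) + e, X i) \<partial>gauss \<sigma>)"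
        by (intro PB.product_nn_integral_prod finite_lessThan) (simp only: lessThan_iff)
    qed
    also have "\<dots> = (\<Prod>i<n. \<integral>\<^sup>+ x. \<integral>\<^sup>+ e. indicator (A i) ((\<Sum>j<p. x j * vec_index \<beta> j) + e, x) \<partial>gauss \<sigma> \<partial>mvnormal p \<Omega>)"
    proof (rule PA.product_nn_integral_prod)
      fix i assume "i \<in> {..<n}"
      then have "i < n" by simp
      from B.borel_measurable_nn_integral_fst[OF m1[OF this]]
      show "(\<lambda>x. \<integral>\<^sup>+ e. indicator (A i) ((\<Sum>j<p. x j * vec_index \<beta> j) + e, x) \<partial>gauss \<sigma>) \<in> borel_measurable (mvnormal p \<Omega>)"
        by (simp only: fst_conv snd_conv)
    qed simp
    also have "\<dots> = (\<Prod>i<n. emeasure (single_law p \<beta> \<Omega> \<sigma>) (A i))"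
    proof (rule prod.cong)
      fix i assume "i \<in> {..<n}"
      then have i: "A i \<in> sets (single_space p)" using A by simp
      have "emeasure (single_law p \<beta> \<Omega> \<sigma>) (A i) = (\<integral>\<^sup>+ z. indicator (A i) z \<partial>single_law p \<beta> \<Omega> \<sigma>)"
        using i by simp
      also have "\<dots> = (\<integral>\<^sup>+ x. \<integral>\<^sup>+ e. indicator (A i) ((\<Sum>j<p. x j * vec_index \<beta> j) + e, x) \<partial>gauss \<sigma> \<partial>mvnormal p \<Omega>)"
        by (rule nn_integral_single_law[OF s]) (use i in simp)
      finally show "(\<integral>\<^sup>+ x. \<integral>\<^sup>+ e. indicator (A i) ((\<Sum>j<p. x j * vec_index \<beta> j) + e, x) \<partial>gauss \<sigma> \<partial>mvnormal p \<Omega>)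
        = emeasure (single_law p \<beta> \<Omega> \<sigma>) (A i)" by simp
    qed simp
    finally show "emeasure (obs_law n p (\<beta>, \<Omega>, \<sigma>)) (Pi\<^sub>E {..<n} A) = (\<Prod>i<n. emeasure (single_law p \<beta> \<Omega> \<sigma>) (A i))" .
  qed
qed

text \<open>Exponential Markov inequality for a sum over independent observations.\<close>

lemma PiM_chernoff:
  assumes K: "prob_space K" and g[measurable]: "g \<in> borel_measurable K"
  shows "emeasure (Pi\<^sub>M {..<n::nat} (\<lambda>_. K)) {z \<in> space (Pi\<^sub>M {..<n} (\<lambda>_. K)). a \<le> (\<Sum>i<n. g (z i))}
     \<le> ennreal (exp (- a)) * (\<integral>\<^sup>+ x. ennreal (exp (g x)) \<partial>K) ^ n"
proof -
  have P: "product_sigma_finite (\<lambda>_::nat. K)"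
    by (simp add: product_sigma_finite_def prob_space_imp_sigma_finite[OF K])
  let ?M = "Pi\<^sub>M {..<n} (\<lambda>_. K)"
  have "(\<lambda>z. g (z i)) \<in> borel_measurable ?M" if "i \<in> {..<n}" for i
    by (rule measurable_compose[OF measurable_component_nat g]) (use that in simp)
  then have [measurable]: "(\<lambda>z. \<Sum>i<n. g (z i)) \<in> borel_measurable ?M"
    by (rule borel_measurable_sum)
  have "emeasure ?M {z \<in> space ?M. a \<le> (\<Sum>i<n. g (z i))}
     = emeasure ?M {z \<in> space ?M. 1 \<le> ennreal (exp (- a)) * ennreal (exp (\<Sum>i<n. g (z i)))}"
  proof -
    have "a \<le> s \<longleftrightarrow> 1 \<le> ennreal (exp (- a)) * ennreal (exp s)" for s :: real
      by (simp add: ennreal_mult'[symmetric] exp_add[symmetric] ennreal_1[symmetric] ennreal_le_iff del: ennreal_1)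
    then show ?thesis by simp
  qed
  also have "\<dots> \<le> ennreal (exp (- a)) * (\<integral>\<^sup>+ z. ennreal (exp (\<Sum>i<n. g (z i))) * indicator (space ?M) z \<partial>?M)"
    by (rule nn_integral_Markov_inequality) measurable
  also have "(\<integral>\<^sup>+ z. ennreal (exp (\<Sum>i<n. g (z i))) * indicator (space ?M) z \<partial>?M)
      = (\<integral>\<^sup>+ z. (\<Prod>i<n. ennreal (exp (g (z i)))) \<partial>?M)"
    by (intro nn_integral_cong) (simp add: exp_sum prod_ennreal)
  also have "\<dots> = (\<Prod>i<n. \<integral>\<^sup>+ x. ennreal (exp (g x)) \<partial>K)"
    by (rule product_sigma_finite.product_nn_integral_prod[OF P]) auto
  finally show ?thesis by simp
qed

section \<open>Gaussian densities and the correlation of likelihood ratios\<close>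

lemma spectrum_one_mat:
  assumes "0 < p"
  shows "spectrum (1\<^sub>m p :: real mat) = {1}"
proof
  show "spectrum (1\<^sub>m p :: real mat) \<subseteq> {1}"
  proof
    fix k assume "k \<in> spectrum (1\<^sub>m p :: real mat)"
    then obtain v where v: "v \<in> carrier_vec p" "v \<noteq> 0\<^sub>v p" "(1\<^sub>m p :: real mat) *\<^sub>v v = k \<cdot>\<^sub>v v"
      by (auto simp: spectrum_def eigenvalue_def eigenvector_def)
    obtain i where i: "i < p" "vec_index v i \<noteq> 0"
    proof (rule ccontr)
      assume "\<not> thesis"
      then have "v = 0\<^sub>v p" using v(1) that by (intro eq_vecI) auto
      then show False using v(2) by simp
    qed
    have "vec_index v i = vec_index (k \<cdot>\<^sub>v v) i" using v(1,3) by simp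
    then show "k \<in> {1}" using i v(1) by simp
  qed
  have "(1 :: real) \<in> spectrum (1\<^sub>m p)"
  proof (rule eigenvalue_intro[where n = p and x = "\<lambda>_. 1"])
    show "\<exists>i<p. (1 :: real) \<noteq> 0" using assms by auto
    fix i assume i: "i < p"
    have "(\<Sum>j<p. (1\<^sub>m p :: real mat) $$ (i, j) * 1) = (\<Sum>j<p. if j = i then 1 else 0)"
      by (rule sum.cong) (use i in auto)
    then show "(\<Sum>j<p. (1\<^sub>m p :: real mat) $$ (i, j) * 1) = 1 * 1" using i by simp
  qed simp
  then show "{1} \<subseteq> spectrum (1\<^sub>m p :: real mat)" by simp
qed

lemma well_conditioned_one_mat:
  assumes "0 < p" "1 \<le> M"
  shows "well_conditioned M p (1\<^sub>m p)"
  using assms by (simp add: well_conditioned_def lambda_min_def lambda_max_def spectrum_one_mat)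

text \<open>For the identity matrix the density is a product of standard normal densities.\<close>

lemma mvnormal_one_mat: "mvnormal p (1\<^sub>m p) = Pi\<^sub>M {..<p} (\<lambda>_. gauss 1)"
proof -
  have G: "product_sigma_finite (\<lambda>_::nat. gauss 1)"
    by (simp add: product_sigma_finite_def sigma_finite_gauss)
  interpret L: product_sigma_finite "\<lambda>_::nat. lborel :: real measure" ..
  have dens: "sqrt (Determinant.det (1\<^sub>m p :: real mat) / (2 * pi) ^ p) *
        exp (- scalar_prod (Matrix.vec p x) (mult_mat_vec (1\<^sub>m p) (Matrix.vec p x)) / 2)
     = (\<Prod>i<p. normal_density 0 1 (x i))" for x :: "nat \<Rightarrow> real"
  proof -
    have q: "scalar_prod (Matrix.vec p x) (mult_mat_vec (1\<^sub>m p) (Matrix.vec p x)) = (\<Sum>i<p. (x i)\<^sup>2)"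
      by (simp add: scalar_prod_def lessThan_atLeast0 power2_eq_square)
    have "(\<Prod>i<p. normal_density 0 1 (x i)) = (1 / sqrt (2 * pi)) ^ p * exp (\<Sum>i<p. - (x i)\<^sup>2 / 2)"
      by (simp add: std_normal_density_def prod.distrib exp_sum prod_dividef power_divide)
    also have "(1 / sqrt (2 * pi)) ^ p = sqrt (1 / (2 * pi) ^ p)"
      by (simp only: real_sqrt_divide real_sqrt_power real_sqrt_one power_divide power_one)
    also have "(\<Sum>i<p. - (x i)\<^sup>2 / 2) = - (\<Sum>i<p. (x i)\<^sup>2) / 2"
      by (simp add: sum_negf sum_divide_distrib)
    finally show ?thesis unfolding q by simp
  qed
  show ?thesis
  proof (rule product_sigma_finite.PiM_eqI[OF G])
    show "sets (mvnormal p (1\<^sub>m p)) = sets (Pi\<^sub>M {..<p} (\<lambda>_. gauss 1))"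
      unfolding sets_mvnormal by (rule sets_PiM_cong) auto
    fix A :: "nat \<Rightarrow> real set" assume "\<And>i. i \<in> {..<p} \<Longrightarrow> A i \<in> sets (gauss 1)"
    then have A: "\<And>i. i \<in> {..<p} \<Longrightarrow> A i \<in> sets lborel" by simp
    have A': "\<And>i. i \<in> {..<p} \<Longrightarrow> A i \<in> sets borel" using A by simp
    have "emeasure (mvnormal p (1\<^sub>m p)) (Pi\<^sub>E {..<p} A)
        = (\<integral>\<^sup>+ x. ennreal (\<Prod>i<p. normal_density 0 1 (x i)) * indicator (Pi\<^sub>E {..<p} A) x \<partial>Pi\<^sub>M {..<p} (\<lambda>_. lborel))"
      unfolding mvnormal_def dens
    proof (rule emeasure_density)
      show "(\<lambda>x. ennreal (\<Prod>i<p. normal_density 0 1 (x i))) \<in> borel_measurable (Pi\<^sub>M {..<p} (\<lambda>_. lborel))"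
        by measurable
      show "Pi\<^sub>E {..<p} A \<in> sets (Pi\<^sub>M {..<p} (\<lambda>_. lborel))"
        by (rule sets_PiM_I_finite) (use A in auto)
    qed
    also have "\<dots> = (\<integral>\<^sup>+ x. (\<Prod>i<p. ennreal (normal_density 0 1 (x i)) * indicator (A i) (x i)) \<partial>Pi\<^sub>M {..<p} (\<lambda>_. lborel))"
    proof (rule nn_integral_cong)
      fix x :: "nat \<Rightarrow> real" assume x: "x \<in> space (Pi\<^sub>M {..<p} (\<lambda>_. lborel))"
      have "indicator (Pi\<^sub>E {..<p} A) x = (\<Prod>i<p. indicator (A i) (x i) :: ennreal)"
        using x by (auto simp: indicator_def PiE_iff space_PiM intro!: prod_zero)
      then show "ennreal (\<Prod>i<p. normal_density 0 1 (x i)) * indicator (Pi\<^sub>E {..<p} A) x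
        = (\<Prod>i<p. ennreal (normal_density 0 1 (x i)) * indicator (A i) (x i))"
        by (simp add: prod.distrib prod_ennreal)
    qed
    also have "\<dots> = (\<Prod>i<p. \<integral>\<^sup>+ t. ennreal (normal_density 0 1 t) * indicator (A i) t \<partial>lborel)"
      by (rule L.product_nn_integral_prod) (use A' in auto)
    also have "\<dots> = (\<Prod>i<p. emeasure (gauss 1) (A i))"
      by (rule prod.cong[OF refl], rule emeasure_density[symmetric]) (use A' in auto)
    finally show "emeasure (mvnormal p (1\<^sub>m p)) (Pi\<^sub>E {..<p} A) = (\<Prod>i<p. emeasure (gauss 1) (A i))" .
  qed simp
qed

text \<open>The density of the centred normal law on the plane with covariance matrix \<open>[V, C; C, V']\<close>.\<close>

definition bivariate_normal_density :: "real \<Rightarrow> real \<Rightarrow> real \<Rightarrow> real \<Rightarrow> real \<Rightarrow> real" where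
  "bivariate_normal_density V V' C y y' = 1 / (2 * pi * sqrt (V * V' - C\<^sup>2)) *
     exp (- (V' * y\<^sup>2 - 2 * C * y * y' + V * y'\<^sup>2) / (2 * (V * V' - C\<^sup>2)))"

lemma borel_measurable_bivariate [measurable]:
  assumes [measurable]: "f \<in> borel_measurable M" "g \<in> borel_measurable M"
  shows "(\<lambda>x. bivariate_normal_density V V' C (f x) (g x)) \<in> borel_measurable M"
  unfolding bivariate_normal_density_def by measurable

lemma covariance_det_add:
  fixes V V' C b b' :: real
  assumes V: "0 < V" and D: "0 < V * V' - C\<^sup>2"
  shows "0 < (V + b\<^sup>2) * (V' + b'\<^sup>2) - (C + b * b')\<^sup>2"
proof -
  have "V * (V' * b\<^sup>2 - 2 * C * b * b' + V * b'\<^sup>2) = (V * b' - C * b)\<^sup>2 + (V * V' - C\<^sup>2) * b\<^sup>2"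
    by (simp add: power2_eq_square algebra_simps)
  also have "\<dots> \<ge> 0" using D by simp
  finally have "0 \<le> V' * b\<^sup>2 - 2 * C * b * b' + V * b'\<^sup>2" using V by (simp add: zero_le_mult_iff)
  moreover have "(V + b\<^sup>2) * (V' + b'\<^sup>2) - (C + b * b')\<^sup>2 = (V * V' - C\<^sup>2) + (V' * b\<^sup>2 - 2 * C * b * b' + V * b'\<^sup>2)"
    by (simp add: power2_eq_square algebra_simps)
  ultimately show ?thesis using D by linarith
qed

text \<open>Adding the multiple \<open>(b, b')\<close> of an independent standard normal variable to a bivariate normal
  vector adds the rank one matrix \<open>(b, b') (b, b')\<^sup>T\<close> to its covariance matrix.\<close>

lemma bivariate_normal_convolution:
  assumes V: "0 < V" and D: "0 < V * V' - C\<^sup>2"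
  shows "(\<integral>\<^sup>+ t. ennreal (bivariate_normal_density V V' C (y - b * t) (y' - b' * t)) \<partial>gauss 1)
       = ennreal (bivariate_normal_density (V + b\<^sup>2) (V' + b'\<^sup>2) (C + b * b') y y')"
proof -
  define d where "d = V * V' - C\<^sup>2"
  define d' where "d' = (V + b\<^sup>2) * (V' + b'\<^sup>2) - (C + b * b')\<^sup>2"
  define q where "q = V' * y\<^sup>2 - 2 * C * y * y' + V * y'\<^sup>2"
  define m where "m = V' * y * b - C * (y * b' + y' * b) + V * y' * b'"
  define q' where "q' = (V' + b'\<^sup>2) * y\<^sup>2 - 2 * (C + b * b') * y * y' + (V + b\<^sup>2) * y'\<^sup>2"
  have d: "0 < d" using D by (simp add: d_def)
  have d': "0 < d'" unfolding d'_def by (rule covariance_det_add[OF V D])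
  have key: "d' * q - m\<^sup>2 = d * q'"
    unfolding d'_def d_def q_def m_def q'_def by (simp add: power2_eq_square algebra_simps)
  have expand: "V' * (y - b * t)\<^sup>2 - 2 * C * (y - b * t) * (y' - b' * t) + V * (y' - b' * t)\<^sup>2
      = q - 2 * m * t + (d' - d) * t\<^sup>2" for t
    unfolding q_def m_def d'_def d_def by (simp add: power2_eq_square algebra_simps)
  have "(\<integral>\<^sup>+ t. ennreal (bivariate_normal_density V V' C (y - b * t) (y' - b' * t)) \<partial>gauss 1)
     = (\<integral>\<^sup>+ t. ennreal (1 / (2 * pi * sqrt d) * (1 / sqrt (2 * pi)) * exp (- q / (2 * d))) *
         ennreal (exp (- (d' / d * t\<^sup>2 + 2 * (- m / d) * t) / 2)) \<partial>lborel)"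
  proof (subst nn_integral_density, measurable, rule nn_integral_cong)
    fix t :: real
    have "- t\<^sup>2 / 2 + - (q - 2 * m * t + (d' - d) * t\<^sup>2) / (2 * d) = - q / (2 * d) + - (d' / d * t\<^sup>2 + 2 * (- m / d) * t) / 2"
      using d by (simp add: field_simps)
    then have "exp (- t\<^sup>2 / 2) * exp (- (q - 2 * m * t + (d' - d) * t\<^sup>2) / (2 * d))
        = exp (- q / (2 * d)) * exp (- (d' / d * t\<^sup>2 + 2 * (- m / d) * t) / 2)"
      by (simp only: exp_add[symmetric])
    then have "normal_density 0 1 t * bivariate_normal_density V V' C (y - b * t) (y' - b' * t)
      = (1 / (2 * pi * sqrt d) * (1 / sqrt (2 * pi)) * exp (- q / (2 * d))) * exp (- (d' / d * t\<^sup>2 + 2 * (- m / d) * t) / 2)"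
      unfolding bivariate_normal_density_def expand d_def[symmetric] std_normal_density_def
      by (simp only: mult_ac)
    then show "ennreal (std_normal_density t) * ennreal (bivariate_normal_density V V' C (y - b * t) (y' - b' * t))
      = ennreal (1 / (2 * pi * sqrt d) * (1 / sqrt (2 * pi)) * exp (- q / (2 * d))) *
         ennreal (exp (- (d' / d * t\<^sup>2 + 2 * (- m / d) * t) / 2))"
      by (simp only: ennreal_mult''[symmetric] exp_ge_zero) (subst ennreal_mult'[symmetric], simp_all)
  qed
  also have "\<dots> = ennreal (1 / (2 * pi * sqrt d) * (1 / sqrt (2 * pi)) * exp (- q / (2 * d))) *
      ennreal (sqrt (2 * pi / (d' / d)) * exp ((- m / d)\<^sup>2 / (2 * (d' / d))))"
    by (subst nn_integral_cmult, measurable, subst nn_integral_exp_quadratic) (use d d' in auto)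
  also have "\<dots> = ennreal (1 / (2 * pi * sqrt d) * (1 / sqrt (2 * pi)) * exp (- q / (2 * d)) *
      (sqrt (2 * pi / (d' / d)) * exp ((- m / d)\<^sup>2 / (2 * (d' / d)))))"
    using d d' by (subst ennreal_mult'[symmetric]) auto
  also have "1 / (2 * pi * sqrt d) * (1 / sqrt (2 * pi)) * exp (- q / (2 * d)) *
      (sqrt (2 * pi / (d' / d)) * exp ((- m / d)\<^sup>2 / (2 * (d' / d))))
     = (1 / (2 * pi * sqrt d) * (1 / sqrt (2 * pi)) * sqrt (2 * pi / (d' / d))) *
      exp (- q / (2 * d) + (- m / d)\<^sup>2 / (2 * (d' / d)))"
    by (simp only: exp_add mult_ac)
  also have "1 / (2 * pi * sqrt d) * (1 / sqrt (2 * pi)) * sqrt (2 * pi / (d' / d)) = 1 / (2 * pi * sqrt d')"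
    using d d' by (simp add: real_sqrt_divide real_sqrt_mult)
  also have "- q / (2 * d) + (- m / d)\<^sup>2 / (2 * (d' / d)) = - (d' * q - m\<^sup>2) / (2 * d * d')"
    using d d' by (simp add: field_simps power2_eq_square)
  also have "\<dots> = - q' / (2 * d')"
    unfolding key using d by simp
  finally show ?thesis unfolding bivariate_normal_density_def q'_def d'_def .
qed

lemma bivariate_normal_linear_forms:
  fixes b b' :: "nat \<Rightarrow> real" and p :: nat
  assumes "0 < V" "0 < V * V' - C\<^sup>2"
  shows "(\<integral>\<^sup>+ x. ennreal (bivariate_normal_density V V' C (y - (\<Sum>j<p. x j * b j)) (y' - (\<Sum>j<p. x j * b' j))) \<partial>Pi\<^sub>M {..<p} (\<lambda>_. gauss 1))
       = ennreal (bivariate_normal_density (V + (\<Sum>j<p. (b j)\<^sup>2)) (V' + (\<Sum>j<p. (b' j)\<^sup>2)) (C + (\<Sum>j<p. b j * b' j)) y y')"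
  using assms
proof (induction p arbitrary: V V' C)
  case 0
  then show ?case by (simp add: PiM_empty nn_integral_count_space_finite)
next
  case (Suc p)
  have G: "product_sigma_finite (\<lambda>_::nat. gauss 1)"
    by (simp add: product_sigma_finite_def sigma_finite_gauss)
  have "(\<integral>\<^sup>+ x. ennreal (bivariate_normal_density V V' C (y - (\<Sum>j<Suc p. x j * b j)) (y' - (\<Sum>j<Suc p. x j * b' j))) \<partial>Pi\<^sub>M {..<Suc p} (\<lambda>_. gauss 1))
     = (\<integral>\<^sup>+ x. \<integral>\<^sup>+ t. ennreal (bivariate_normal_density V V' C (y - (\<Sum>j<Suc p. (x(p := t)) j * b j)) (y' - (\<Sum>j<Suc p. (x(p := t)) j * b' j))) \<partial>gauss 1 \<partial>Pi\<^sub>M {..<p} (\<lambda>_. gauss 1))"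
    unfolding lessThan_Suc by (rule product_sigma_finite.product_nn_integral_insert[OF G]) (simp, simp, measurable)
  also have "\<dots> = (\<integral>\<^sup>+ x. ennreal (bivariate_normal_density (V + (b p)\<^sup>2) (V' + (b' p)\<^sup>2) (C + b p * b' p)
        (y - (\<Sum>j<p. x j * b j)) (y' - (\<Sum>j<p. x j * b' j))) \<partial>Pi\<^sub>M {..<p} (\<lambda>_. gauss 1))"
  proof (rule nn_integral_cong)
    fix x :: "nat \<Rightarrow> real"
    have "(\<Sum>j<Suc p. (x(p := t)) j * c j) = (\<Sum>j<p. x j * c j) + c p * t" for t and c :: "nat \<Rightarrow> real"
      by simp
    then have "y - (\<Sum>j<Suc p. (x(p := t)) j * b j) = (y - (\<Sum>j<p. x j * b j)) - b p * t"
      and "y' - (\<Sum>j<Suc p. (x(p := t)) j * b' j) = (y' - (\<Sum>j<p. x j * b' j)) - b' p * t" for t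
      by simp_all
    then show "(\<integral>\<^sup>+ t. ennreal (bivariate_normal_density V V' C (y - (\<Sum>j<Suc p. (x(p := t)) j * b j)) (y' - (\<Sum>j<Suc p. (x(p := t)) j * b' j))) \<partial>gauss 1)
      = ennreal (bivariate_normal_density (V + (b p)\<^sup>2) (V' + (b' p)\<^sup>2) (C + b p * b' p)
        (y - (\<Sum>j<p. x j * b j)) (y' - (\<Sum>j<p. x j * b' j)))"
      by (simp only: bivariate_normal_convolution[OF Suc.prems])
  qed
  also have "\<dots> = ennreal (bivariate_normal_density (V + (b p)\<^sup>2 + (\<Sum>j<p. (b j)\<^sup>2)) (V' + (b' p)\<^sup>2 + (\<Sum>j<p. (b' j)\<^sup>2)) (C + b p * b' p + (\<Sum>j<p. b j * b' j)) y y')"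
    using Suc.prems by (intro Suc.IH covariance_det_add) (auto intro: add_pos_nonneg)
  finally show ?case by (simp add: add_ac)
qed

text \<open>The last integral in the correlation of two likelihood ratios, once the design has been integrated
  out: the two numerators give the bivariate density with both arguments equal to the response, and of
  the null density, which is twice in the denominator and once in the measure, one factor is left.\<close>

lemma bivariate_normal_diagonal_integral:
  assumes s: "0 < s" and C: "\<bar>C\<bar> < s\<^sup>2"
  shows "(\<integral>\<^sup>+ y. ennreal (bivariate_normal_density (s\<^sup>2) (s\<^sup>2) C y y / normal_density 0 s y) \<partial>lborel) = ennreal (s\<^sup>2 / (s\<^sup>2 - C))"
proof -
  define V where "V = s\<^sup>2"
  have V: "0 < V" "0 < V - C" "0 < V + C" using s C by (auto simp: V_def abs_less_iff)
  have det: "V * V - C\<^sup>2 = (V - C) * (V + C)" by (simp add: power2_eq_square algebra_simps)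
  define \<kappa> where "\<kappa> = (V - C) / (V * (V + C))"
  have \<kappa>: "0 < \<kappa>" using V by (simp add: \<kappa>_def)
  define k where "k = sqrt (2 * pi * V) / (2 * pi * sqrt ((V - C) * (V + C)))"
  have k: "0 \<le> k" using V by (simp add: k_def)
  have "bivariate_normal_density V V C y y / normal_density 0 s y = k * exp (- (\<kappa> * y\<^sup>2 + 2 * 0 * y) / 2)" for y
  proof -
    have e: "- (V * y\<^sup>2 - 2 * C * y * y + V * y\<^sup>2) / (2 * ((V - C) * (V + C))) - (- y\<^sup>2 / (2 * V)) = - (\<kappa> * y\<^sup>2) / 2"
    proof -
      have N: "V * y\<^sup>2 - 2 * C * y * y + V * y\<^sup>2 = (2 * (V - C)) * y\<^sup>2" by (simp add: power2_eq_square algebra_simps)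
      have D: "2 * ((V - C) * (V + C)) = (2 * (V - C)) * (V + C)" by simp
      have 1: "(V * y\<^sup>2 - 2 * C * y * y + V * y\<^sup>2) / (2 * ((V - C) * (V + C))) = y\<^sup>2 / (V + C)"
        unfolding N D by (rule mult_divide_mult_cancel_left) (use V in simp)
      have 2: "y\<^sup>2 / (V + C) - y\<^sup>2 / (2 * V) = \<kappa> * y\<^sup>2 / 2"
        using V unfolding \<kappa>_def by (simp add: divide_simps) (simp add: algebra_simps)
      show ?thesis using 1 2 by (simp only: minus_divide_left[symmetric])
    qed
    have "bivariate_normal_density V V C y y / normal_density 0 s y
       = k * (exp (- (V * y\<^sup>2 - 2 * C * y * y + V * y\<^sup>2) / (2 * ((V - C) * (V + C)))) / exp (- y\<^sup>2 / (2 * V)))"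
      unfolding bivariate_normal_density_def normal_density_def det k_def V_def[symmetric] by simp
    also have "\<dots> = k * exp (- (\<kappa> * y\<^sup>2) / 2)"
      unfolding exp_diff[symmetric] e ..
    finally show ?thesis by simp
  qed
  then have "(\<integral>\<^sup>+ y. ennreal (bivariate_normal_density V V C y y / normal_density 0 s y) \<partial>lborel)
     = (\<integral>\<^sup>+ y. ennreal k * ennreal (exp (- (\<kappa> * y\<^sup>2 + 2 * 0 * y) / 2)) \<partial>lborel)"
    using k by (simp add: ennreal_mult')
  also have "\<dots> = ennreal k * ennreal (sqrt (2 * pi / \<kappa>) * exp (0\<^sup>2 / (2 * \<kappa>)))"
    by (subst nn_integral_cmult, measurable, subst nn_integral_exp_quadratic[OF \<kappa>]) simp
  also have "\<dots> = ennreal (k * sqrt (2 * pi / \<kappa>))"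
    using k by (simp add: ennreal_mult')
  also have "k * sqrt (2 * pi / \<kappa>) = V / (V - C)"
  proof (rule power2_eq_imp_eq)
    have "(k * sqrt (2 * pi / \<kappa>))\<^sup>2 = (2 * pi * V) / ((2 * pi)\<^sup>2 * ((V - C) * (V + C))) * (2 * pi / \<kappa>)"
      using V \<kappa> by (simp add: k_def power_mult_distrib power_divide)
    also have "\<dots> = (V / (V - C))\<^sup>2"
      using V unfolding \<kappa>_def by (simp add: divide_simps power2_eq_square)
    finally show "(k * sqrt (2 * pi / \<kappa>))\<^sup>2 = (V / (V - C))\<^sup>2" .
  qed (use k \<kappa> V in auto)
  finally show ?thesis unfolding V_def .
qed

text \<open>The ratio of the laws of \<open>(y, X)\<close> for coefficients \<open>b\<close> and noise level \<open>\<tau>\<close> and for coefficients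
  \<open>0\<close> and noise level \<open>s\<close>; the law of \<open>X\<close> is the same for both and cancels.\<close>

definition likelihood_ratio :: "nat \<Rightarrow> real \<Rightarrow> real \<Rightarrow> (nat \<Rightarrow> real) \<Rightarrow> real \<times> (nat \<Rightarrow> real) \<Rightarrow> real" where
  "likelihood_ratio p s \<tau> b z = normal_density (\<Sum>j<p. snd z j * b j) \<tau> (fst z) / normal_density 0 s (fst z)"

lemma normal_density_shift: "normal_density m \<tau> y = normal_density 0 \<tau> (y - m)"
  by (simp add: normal_density_def)

lemma borel_measurable_likelihood_ratio:
  "likelihood_ratio p s \<tau> b \<in> borel_measurable (single_space p)"
proof -
  have [measurable]: "(\<lambda>z :: real \<times> (nat \<Rightarrow> real). \<Sum>j<p. snd z j * b j) \<in> borel_measurable (single_space p)"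
    by (rule measurable_compose[OF measurable_snd measurable_linear_form])
  show ?thesis
    unfolding likelihood_ratio_def[abs_def] normal_density_shift[of "\<Sum>j<p. snd _ j * b j"] by measurable
qed

lemma likelihood_ratio_nonneg: "0 \<le> likelihood_ratio p s \<tau> b z"
  by (simp add: likelihood_ratio_def)

lemma nn_integral_single_law_density:
  assumes s: "0 < s" and f: "f \<in> borel_measurable (single_space p)"
  shows "(\<integral>\<^sup>+ z. f z \<partial>single_law p \<beta> \<Omega> s)
       = (\<integral>\<^sup>+ x. \<integral>\<^sup>+ y. ennreal (normal_density (\<Sum>j<p. x j * vec_index \<beta> j) s y) * f (y, x) \<partial>lborel \<partial>mvnormal p \<Omega>)"
  unfolding nn_integral_single_law[OF s f]
proof (rule nn_integral_cong)
  fix x assume x: "x \<in> space (mvnormal p \<Omega>)"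
  then have x': "x \<in> space (Pi\<^sub>M {..<p} (\<lambda>_. borel :: real measure))"
    using sets_eq_imp_space_eq[OF sets_mvnormal] by simp
  have fm: "(\<lambda>y. f (y, x)) \<in> borel_measurable borel"
    by (rule measurable_compose[OF measurable_Pair2'[OF x'] f])
  let ?m = "\<Sum>j<p. x j * vec_index \<beta> j"
  note [measurable] = fm
  have "(\<integral>\<^sup>+ e. f (?m + e, x) \<partial>gauss s) = (\<integral>\<^sup>+ e. ennreal (normal_density 0 s e) * f (?m + e, x) \<partial>lborel)"
  proof (rule nn_integral_density)
    show "(\<lambda>e. ennreal (normal_density 0 s e)) \<in> borel_measurable lborel" by measurable
    show "(\<lambda>e. f (?m + e, x)) \<in> borel_measurable lborel"
      by (rule measurable_compose[OF _ fm]) measurable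
  qed
  also have "\<dots> = ennreal \<bar>1\<bar> * (\<integral>\<^sup>+ y. ennreal (normal_density 0 s (- ?m + 1 * y)) * f (?m + (- ?m + 1 * y), x) \<partial>lborel)"
    by (rule nn_integral_real_affine)
      (auto intro!: borel_measurable_times_ennreal measurable_compose[OF _ fm])
  also have "\<dots> = (\<integral>\<^sup>+ y. ennreal (normal_density ?m s y) * f (y, x) \<partial>lborel)"
    by (simp add: normal_density_shift[of ?m])
  finally show "(\<integral>\<^sup>+ e. f (?m + e, x) \<partial>gauss s) = (\<integral>\<^sup>+ y. ennreal (normal_density ?m s y) * f (y, x) \<partial>lborel)" .
qed

lemma single_law_density:
  assumes s: "0 < s" and \<tau>: "0 < \<tau>"
  shows "single_law p \<beta> \<Omega> \<tau> = density (single_law p (0\<^sub>v p) \<Omega> s) (\<lambda>z. ennreal (likelihood_ratio p s \<tau> (vec_index \<beta>) z))"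
proof (rule measure_eqI)
  fix A assume "A \<in> sets (single_law p \<beta> \<Omega> \<tau>)"
  then have A: "A \<in> sets (single_space p)" by simp
  note [measurable] = borel_measurable_likelihood_ratio
  have mi: "indicator A \<in> borel_measurable (single_space p)"
    using A by (rule borel_measurable_indicator)
  have ml: "(\<lambda>z. ennreal (likelihood_ratio p s \<tau> (vec_index \<beta>) z)) \<in> borel_measurable (single_space p)"
    by measurable
  have "emeasure (density (single_law p (0\<^sub>v p) \<Omega> s) (\<lambda>z. ennreal (likelihood_ratio p s \<tau> (vec_index \<beta>) z))) A
     = (\<integral>\<^sup>+ z. ennreal (likelihood_ratio p s \<tau> (vec_index \<beta>) z) * indicator A z \<partial>single_law p (0\<^sub>v p) \<Omega> s)"
    by (rule emeasure_density) (use A ml in \<open>simp_all cong: measurable_cong_sets\<close>)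
  also have "\<dots> = (\<integral>\<^sup>+ x. \<integral>\<^sup>+ y. ennreal (normal_density (\<Sum>j<p. x j * vec_index (0\<^sub>v p) j) s y) *
      (ennreal (likelihood_ratio p s \<tau> (vec_index \<beta>) (y, x)) * indicator A (y, x)) \<partial>lborel \<partial>mvnormal p \<Omega>)"
    by (rule nn_integral_single_law_density[OF s]) (rule borel_measurable_times_ennreal[OF ml mi])
  also have "\<dots> = (\<integral>\<^sup>+ x. \<integral>\<^sup>+ y. ennreal (normal_density (\<Sum>j<p. x j * vec_index \<beta> j) \<tau> y) * indicator A (y, x) \<partial>lborel \<partial>mvnormal p \<Omega>)"
  proof (intro nn_integral_cong)
    fix x :: "nat \<Rightarrow> real" and y :: real
    have pos: "0 < normal_density 0 s y" by (rule normal_density_pos[OF s])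
    have "ennreal (normal_density 0 s y) * ennreal (likelihood_ratio p s \<tau> (vec_index \<beta>) (y, x))
       = ennreal (normal_density (\<Sum>j<p. x j * vec_index \<beta> j) \<tau> y)"
      using pos by (subst ennreal_mult'[symmetric]) (auto simp: likelihood_ratio_def)
    then show "ennreal (normal_density (\<Sum>j<p. x j * vec_index (0\<^sub>v p) j) s y) *
      (ennreal (likelihood_ratio p s \<tau> (vec_index \<beta>) (y, x)) * indicator A (y, x))
      = ennreal (normal_density (\<Sum>j<p. x j * vec_index \<beta> j) \<tau> y) * indicator A (y, x)"
      by (simp add: mult.assoc[symmetric])
  qed
  also have "\<dots> = (\<integral>\<^sup>+ z. indicator A z \<partial>single_law p \<beta> \<Omega> \<tau>)"
    by (rule nn_integral_single_law_density[OF \<tau> mi, symmetric])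
  also have "\<dots> = emeasure (single_law p \<beta> \<Omega> \<tau>) A"
    using A by simp
  finally show "emeasure (single_law p \<beta> \<Omega> \<tau>) A
    = emeasure (density (single_law p (0\<^sub>v p) \<Omega> s) (\<lambda>z. ennreal (likelihood_ratio p s \<tau> (vec_index \<beta>) z))) A" by simp
qed simp

lemma bivariate_normal_density_independent:
  assumes "0 < \<tau>" "0 < \<tau>'"
  shows "normal_density 0 \<tau> y * normal_density 0 \<tau>' y' = bivariate_normal_density (\<tau>\<^sup>2) (\<tau>'\<^sup>2) 0 y y'"
proof -
  have 1: "sqrt (2 * pi * \<tau>\<^sup>2) * sqrt (2 * pi * \<tau>'\<^sup>2) = 2 * pi * sqrt (\<tau>\<^sup>2 * \<tau>'\<^sup>2 - 0\<^sup>2)"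
  proof -
    have "sqrt (2 * pi * \<tau>\<^sup>2) = sqrt (2 * pi) * \<tau>" "sqrt (2 * pi * \<tau>'\<^sup>2) = sqrt (2 * pi) * \<tau>'"
      "sqrt (\<tau>\<^sup>2 * \<tau>'\<^sup>2 - 0\<^sup>2) = \<tau> * \<tau>'"
      using assms by (simp_all add: real_sqrt_mult)
    moreover have "sqrt (2 * pi) * \<tau> * (sqrt (2 * pi) * \<tau>') = (sqrt (2 * pi) * sqrt (2 * pi)) * (\<tau> * \<tau>')"
      by (simp only: mult_ac)
    moreover have "sqrt (2 * pi) * sqrt (2 * pi) = 2 * pi" by (rule real_sqrt_mult_self[THEN trans]) simp
    ultimately show ?thesis by (simp only:)
  qed
  have 2: "- (y - 0)\<^sup>2 / (2 * \<tau>\<^sup>2) + - (y' - 0)\<^sup>2 / (2 * \<tau>'\<^sup>2)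
      = - (\<tau>'\<^sup>2 * y\<^sup>2 - 2 * 0 * y * y' + \<tau>\<^sup>2 * y'\<^sup>2) / (2 * (\<tau>\<^sup>2 * \<tau>'\<^sup>2 - 0\<^sup>2))"
    using assms by (simp add: field_simps)
  have "normal_density 0 \<tau> y * normal_density 0 \<tau>' y' = 1 / (sqrt (2 * pi * \<tau>\<^sup>2) * sqrt (2 * pi * \<tau>'\<^sup>2)) *
     exp (- (y - 0)\<^sup>2 / (2 * \<tau>\<^sup>2) + - (y' - 0)\<^sup>2 / (2 * \<tau>'\<^sup>2))"
    unfolding normal_density_def exp_add by simp
  then show ?thesis unfolding 1 2 bivariate_normal_density_def .
qed

text \<open>For fixed \<open>y\<close> the product of the two conditional densities of the response is a bivariate normal
  density at \<open>(y - X \<bullet> b, y - X \<bullet> b')\<close>. Integrating over the design turns the covariance matrix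
  into \<open>[s\<^sup>2, C; C, s\<^sup>2]\<close> with \<open>C = b \<bullet> b'\<close>. It is here that \<open>\<tau>\<^sup>2 + \<parallel>b\<parallel>\<^sup>2 = s\<^sup>2\<close> matters: the
  marginal variances agree with the null, and the correlation depends on \<open>b \<bullet> b'\<close> alone.\<close>

lemma likelihood_ratio_correlation:
  fixes b b' :: "nat \<Rightarrow> real"
  assumes s: "0 < s" and \<tau>: "0 < \<tau>" "\<tau>\<^sup>2 + (\<Sum>j<p. (b j)\<^sup>2) = s\<^sup>2" and \<tau>': "0 < \<tau>'" "\<tau>'\<^sup>2 + (\<Sum>j<p. (b' j)\<^sup>2) = s\<^sup>2"
  shows "(\<integral>\<^sup>+ z. ennreal (likelihood_ratio p s \<tau> b z * likelihood_ratio p s \<tau>' b' z) \<partial>single_law p (0\<^sub>v p) (1\<^sub>m p) s)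
       = ennreal (s\<^sup>2 / (s\<^sup>2 - (\<Sum>j<p. b j * b' j)))"
proof -
  let ?C = "\<Sum>j<p. b j * b' j"
  have C: "\<bar>?C\<bar> < s\<^sup>2"
  proof -
    have "?C\<^sup>2 \<le> (\<Sum>j<p. (b j)\<^sup>2) * (\<Sum>j<p. (b' j)\<^sup>2)" by (rule Cauchy_Schwarz_ineq_sum)
    also have "\<dots> < s\<^sup>2 * s\<^sup>2"
    proof (rule mult_strict_mono)
      show "(\<Sum>j<p. (b j)\<^sup>2) < s\<^sup>2" using \<tau>(2) zero_less_power[OF \<tau>(1), of 2] by linarith
      show "(\<Sum>j<p. (b' j)\<^sup>2) < s\<^sup>2" using \<tau>'(2) zero_less_power[OF \<tau>'(1), of 2] by linarith
    qed (use s in \<open>auto intro: sum_nonneg\<close>)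
    finally have "\<bar>?C\<bar>\<^sup>2 < (s\<^sup>2)\<^sup>2" by (simp add: power2_eq_square)
    then show ?thesis by (rule power2_less_imp_less) simp
  qed
  note [measurable] = borel_measurable_likelihood_ratio
  have gG: "sigma_finite_measure (Pi\<^sub>M {..<p} (\<lambda>_. gauss 1))"
    by (intro prob_space_imp_sigma_finite prob_space_PiM prob_space_normal_density) simp
  interpret PS: pair_sigma_finite "lborel :: real measure" "Pi\<^sub>M {..<p} (\<lambda>_. gauss 1)"
    using gG by (simp add: pair_sigma_finite_def lborel.sigma_finite_measure_axioms)
  define h where "h = (\<lambda>y x. ennreal (normal_density 0 \<tau> (y - (\<Sum>j<p. x j * b j)) * normal_density 0 \<tau>' (y - (\<Sum>j<p. x j * b' j)) / normal_density 0 s y))"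
  have hm: "(\<lambda>(y, x). h y x) \<in> borel_measurable (lborel \<Otimes>\<^sub>M Pi\<^sub>M {..<p} (\<lambda>_. gauss 1))"
    unfolding h_def by measurable
  have lm: "(\<lambda>z. ennreal (likelihood_ratio p s \<tau> b z * likelihood_ratio p s \<tau>' b' z)) \<in> borel_measurable (single_space p)"
    by measurable
  have "(\<integral>\<^sup>+ z. ennreal (likelihood_ratio p s \<tau> b z * likelihood_ratio p s \<tau>' b' z) \<partial>single_law p (0\<^sub>v p) (1\<^sub>m p) s)
     = (\<integral>\<^sup>+ x. \<integral>\<^sup>+ y. h y x \<partial>lborel \<partial>Pi\<^sub>M {..<p} (\<lambda>_. gauss 1))"
    unfolding nn_integral_single_law_density[OF s lm] mvnormal_one_mat
  proof (intro nn_integral_cong)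
    fix x :: "nat \<Rightarrow> real" and y :: real
    have pos: "0 < normal_density 0 s y" by (rule normal_density_pos[OF s])
    have z: "(\<Sum>j<p. x j * vec_index (0\<^sub>v p) j) = (0 :: real)" by simp
    show "ennreal (normal_density (\<Sum>j<p. x j * vec_index (0\<^sub>v p) j) s y) *
      ennreal (likelihood_ratio p s \<tau> b (y, x) * likelihood_ratio p s \<tau>' b' (y, x)) = h y x"
      unfolding z h_def likelihood_ratio_def fst_conv snd_conv normal_density_shift[of "\<Sum>j<p. x j * b j"] normal_density_shift[of "\<Sum>j<p. x j * b' j"]
      using pos by (subst ennreal_mult'[symmetric]) auto
  qed
  also have "\<dots> = (\<integral>\<^sup>+ y. \<integral>\<^sup>+ x. h y x \<partial>Pi\<^sub>M {..<p} (\<lambda>_. gauss 1) \<partial>lborel)"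
    by (rule PS.Fubini'[OF hm])
  also have "\<dots> = (\<integral>\<^sup>+ y. ennreal (bivariate_normal_density (s\<^sup>2) (s\<^sup>2) ?C y y / normal_density 0 s y) \<partial>lborel)"
  proof (rule nn_integral_cong)
    fix y :: real
    have pos: "0 < normal_density 0 s y" by (rule normal_density_pos[OF s])
    have "(\<integral>\<^sup>+ x. h y x \<partial>Pi\<^sub>M {..<p} (\<lambda>_. gauss 1))
      = (\<integral>\<^sup>+ x. ennreal (bivariate_normal_density (\<tau>\<^sup>2) (\<tau>'\<^sup>2) 0 (y - (\<Sum>j<p. x j * b j)) (y - (\<Sum>j<p. x j * b' j))) *
          ennreal (1 / normal_density 0 s y) \<partial>Pi\<^sub>M {..<p} (\<lambda>_. gauss 1))"
      unfolding h_def bivariate_normal_density_independent[OF \<tau>(1) \<tau>'(1)]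
      using pos by (intro nn_integral_cong) (subst ennreal_mult''[symmetric], auto)
    also have "\<dots> = (\<integral>\<^sup>+ x. ennreal (bivariate_normal_density (\<tau>\<^sup>2) (\<tau>'\<^sup>2) 0 (y - (\<Sum>j<p. x j * b j)) (y - (\<Sum>j<p. x j * b' j))) \<partial>Pi\<^sub>M {..<p} (\<lambda>_. gauss 1)) *
          ennreal (1 / normal_density 0 s y)"
      by (rule nn_integral_multc) measurable
    also have "\<dots> = ennreal (bivariate_normal_density (s\<^sup>2) (s\<^sup>2) ?C y y) * ennreal (1 / normal_density 0 s y)"
      using \<tau> \<tau>' by (subst bivariate_normal_linear_forms) simp_all
    also have "\<dots> = ennreal (bivariate_normal_density (s\<^sup>2) (s\<^sup>2) ?C y y / normal_density 0 s y)"
      using pos by (subst ennreal_mult''[symmetric]) auto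
    finally show "(\<integral>\<^sup>+ x. h y x \<partial>Pi\<^sub>M {..<p} (\<lambda>_. gauss 1)) = ennreal (bivariate_normal_density (s\<^sup>2) (s\<^sup>2) ?C y y / normal_density 0 s y)" .
  qed
  also have "\<dots> = ennreal (s\<^sup>2 / (s\<^sup>2 - ?C))"
    by (rule bivariate_normal_diagonal_integral[OF s C])
  finally show ?thesis .
qed

lemma PiM_density:
  fixes n :: nat
  assumes K: "prob_space K" and K': "prob_space (density K (\<lambda>x. ennreal (f x)))"
    and f: "f \<in> borel_measurable K" and nn: "\<And>x. 0 \<le> f x"
  shows "Pi\<^sub>M {..<n} (\<lambda>_. density K (\<lambda>x. ennreal (f x))) = density (Pi\<^sub>M {..<n} (\<lambda>_. K)) (\<lambda>z. ennreal (\<Prod>i<n. f (z i)))"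
proof (rule sym, rule product_sigma_finite.PiM_eqI)
  show "product_sigma_finite (\<lambda>_::nat. density K (\<lambda>x. ennreal (f x)))"
    by (simp add: product_sigma_finite_def prob_space_imp_sigma_finite[OF K'])
  have P: "product_sigma_finite (\<lambda>_::nat. K)"
    by (simp add: product_sigma_finite_def prob_space_imp_sigma_finite[OF K])
  show "sets (density (Pi\<^sub>M {..<n} (\<lambda>_. K)) (\<lambda>z. ennreal (\<Prod>i<n. f (z i)))) = sets (Pi\<^sub>M {..<n} (\<lambda>_. density K (\<lambda>x. ennreal (f x))))"
    unfolding sets_density by (rule sets_PiM_cong) auto
  fix A :: "nat \<Rightarrow> 'a set" assume "\<And>i. i \<in> {..<n} \<Longrightarrow> A i \<in> sets (density K (\<lambda>x. ennreal (f x)))"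
  then have A: "\<And>i. i \<in> {..<n} \<Longrightarrow> A i \<in> sets K" by simp
  have c: "(\<lambda>z. f (z i)) \<in> borel_measurable (Pi\<^sub>M {..<n} (\<lambda>_. K))" if "i \<in> {..<n}" for i
    by (rule measurable_compose[OF measurable_component_nat f]) (use that in simp)
  have c': "(\<lambda>z. ennreal (\<Prod>i<n. f (z i))) \<in> borel_measurable (Pi\<^sub>M {..<n} (\<lambda>_. K))"
    by (rule measurable_compose[OF borel_measurable_prod[OF c] measurable_ennreal])
  have "emeasure (density (Pi\<^sub>M {..<n} (\<lambda>_. K)) (\<lambda>z. ennreal (\<Prod>i<n. f (z i)))) (Pi\<^sub>E {..<n} A)
     = (\<integral>\<^sup>+ z. ennreal (\<Prod>i<n. f (z i)) * indicator (Pi\<^sub>E {..<n} A) z \<partial>Pi\<^sub>M {..<n} (\<lambda>_. K))"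
    by (rule emeasure_density[OF c']) (rule sets_PiM_I_finite, use A in auto)
  also have "\<dots> = (\<integral>\<^sup>+ z. (\<Prod>i<n. ennreal (f (z i)) * indicator (A i) (z i)) \<partial>Pi\<^sub>M {..<n} (\<lambda>_. K))"
  proof (rule nn_integral_cong)
    fix z assume z: "z \<in> space (Pi\<^sub>M {..<n} (\<lambda>_. K))"
    have "indicator (Pi\<^sub>E {..<n} A) z = (\<Prod>i<n. indicator (A i) (z i) :: ennreal)"
      using z by (auto simp: indicator_def PiE_iff space_PiM intro!: prod_zero)
    then show "ennreal (\<Prod>i<n. f (z i)) * indicator (Pi\<^sub>E {..<n} A) z = (\<Prod>i<n. ennreal (f (z i)) * indicator (A i) (z i))"
      by (simp add: prod.distrib prod_ennreal nn)
  qed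
  also have "\<dots> = (\<Prod>i<n. \<integral>\<^sup>+ x. ennreal (f x) * indicator (A i) x \<partial>K)"
    by (rule product_sigma_finite.product_nn_integral_prod[OF P]) (use A f in \<open>auto intro!: borel_measurable_times_ennreal\<close>)
  also have "\<dots> = (\<Prod>i<n. emeasure (density K (\<lambda>x. ennreal (f x))) (A i))"
    by (rule prod.cong[OF refl], rule emeasure_density[symmetric]) (use A f in auto)
  finally show "emeasure (density (Pi\<^sub>M {..<n} (\<lambda>_. K)) (\<lambda>z. ennreal (\<Prod>i<n. f (z i)))) (Pi\<^sub>E {..<n} A)
    = (\<Prod>i<n. emeasure (density K (\<lambda>x. ennreal (f x))) (A i))" .
qed simp

text \<open>A bound on the second moment of the mixture \<open>M\<close> of the likelihood ratios bounds its distance from the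
  null law. Instead of the Cauchy-Schwarz inequality the proof integrates
  \<open>M - 1 \<le> (M - 1)\<^sup>2 / (2 \<eta>) + \<eta> / 2\<close> over \<open>A\<close>, rearranged so that all terms are nonnegative.\<close>

lemma mixture_comparison:
  fixes L :: "'i \<Rightarrow> 'a \<Rightarrow> real"
  assumes P: "prob_space P" and F: "finite F" "F \<noteq> {}"
    and L: "\<And>i. i \<in> F \<Longrightarrow> L i \<in> borel_measurable P" and nn: "\<And>i z. 0 \<le> L i z"
    and one: "\<And>i. i \<in> F \<Longrightarrow> (\<integral>\<^sup>+ z. ennreal (L i z) \<partial>P) = 1"
    and two: "(\<Sum>i\<in>F. \<Sum>j\<in>F. \<integral>\<^sup>+ z. ennreal (L i z * L j z) \<partial>P) \<le> ennreal ((real (card F))\<^sup>2 * (1 + \<eta>\<^sup>2))"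
    and \<eta>: "0 < \<eta>" and A: "A \<in> sets P"
    and cov: "\<And>i. i \<in> F \<Longrightarrow> ennreal a \<le> emeasure (density P (\<lambda>z. ennreal (L i z))) A"
  shows "ennreal (a - \<eta>) \<le> emeasure P A"
proof -
  interpret prob_space P by fact
  define m where "m = real (card F)"
  have m: "0 < m" using F by (simp add: m_def card_gt_0_iff)
  define M where "M = (\<lambda>z. (\<Sum>i\<in>F. L i z) / m)"
  have [measurable]: "M \<in> borel_measurable P"
    unfolding M_def by (intro borel_measurable_divide borel_measurable_sum L) auto
  have Mnn: "0 \<le> M z" for z unfolding M_def using m by (intro divide_nonneg_pos sum_nonneg nn)
  have eM: "ennreal (M z) = ennreal (1 / m) * (\<Sum>i\<in>F. ennreal (L i z))" for z
  proof -
    have "M z = (1 / m) * (\<Sum>i\<in>F. L i z)" by (simp add: M_def)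
    also have "ennreal \<dots> = ennreal (1 / m) * ennreal (\<Sum>i\<in>F. L i z)"
      by (rule ennreal_mult') (use m in simp)
    also have "ennreal (\<Sum>i\<in>F. L i z) = (\<Sum>i\<in>F. ennreal (L i z))"
      by (rule sum_ennreal[symmetric]) (rule nn)
    finally show ?thesis .
  qed
  have mm: "ennreal (1 / m) * ennreal m = 1"
    using m by (subst ennreal_mult'[symmetric]) auto
  have cF: "(\<Sum>i\<in>F. c) = ennreal m * c" for c :: ennreal
    by (simp add: m_def ennreal_of_nat_eq_real_of_nat)
  have int1: "(\<integral>\<^sup>+ z. ennreal (M z) \<partial>P) = 1"
  proof -
    have "(\<integral>\<^sup>+ z. ennreal (M z) \<partial>P) = ennreal (1 / m) * (\<Sum>i\<in>F. \<integral>\<^sup>+ z. ennreal (L i z) \<partial>P)"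
      unfolding eM by (subst nn_integral_cmult, (intro borel_measurable_sum measurable_compose[OF L measurable_ennreal]; assumption))
        (subst nn_integral_sum, auto intro: measurable_compose[OF L measurable_ennreal])
    also have "\<dots> = ennreal (1 / m) * ennreal m" using one cF[of 1] by simp
    finally show ?thesis using mm by simp
  qed
  have int2: "(\<integral>\<^sup>+ z. ennreal ((M z)\<^sup>2) \<partial>P) \<le> ennreal (1 + \<eta>\<^sup>2)"
  proof -
    have sq: "ennreal ((M z)\<^sup>2) = ennreal (1 / m\<^sup>2) * (\<Sum>i\<in>F. \<Sum>j\<in>F. ennreal (L i z * L j z))" for z
    proof -
      have "(M z)\<^sup>2 = (1 / m\<^sup>2) * (\<Sum>i\<in>F. \<Sum>j\<in>F. L i z * L j z)"
        by (simp add: M_def power_divide) (simp add: power2_eq_square sum_product)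
      also have "ennreal \<dots> = ennreal (1 / m\<^sup>2) * ennreal (\<Sum>i\<in>F. \<Sum>j\<in>F. L i z * L j z)"
        by (rule ennreal_mult') (use m in simp)
      also have "ennreal (\<Sum>i\<in>F. \<Sum>j\<in>F. L i z * L j z) = (\<Sum>i\<in>F. ennreal (\<Sum>j\<in>F. L i z * L j z))"
        by (rule sum_ennreal[symmetric]) (intro sum_nonneg mult_nonneg_nonneg nn)
      also have "\<dots> = (\<Sum>i\<in>F. \<Sum>j\<in>F. ennreal (L i z * L j z))"
        by (intro sum.cong refl sum_ennreal[symmetric] mult_nonneg_nonneg nn)
      finally show ?thesis .
    qed
    have ms: "(\<lambda>z. ennreal (L i z * L j z)) \<in> borel_measurable P" if "i \<in> F" "j \<in> F" for i j
      by (intro measurable_compose[OF _ measurable_ennreal] borel_measurable_times L that)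
    have "(\<integral>\<^sup>+ z. ennreal ((M z)\<^sup>2) \<partial>P) = ennreal (1 / m\<^sup>2) * (\<integral>\<^sup>+ z. (\<Sum>i\<in>F. \<Sum>j\<in>F. ennreal (L i z * L j z)) \<partial>P)"
      unfolding sq by (rule nn_integral_cmult) (intro borel_measurable_sum ms; assumption)
    also have "(\<integral>\<^sup>+ z. (\<Sum>i\<in>F. \<Sum>j\<in>F. ennreal (L i z * L j z)) \<partial>P) = (\<Sum>i\<in>F. \<Sum>j\<in>F. \<integral>\<^sup>+ z. ennreal (L i z * L j z) \<partial>P)"
      by (subst nn_integral_sum, (intro borel_measurable_sum ms; assumption)) (intro sum.cong refl nn_integral_sum ms; assumption)
    also have "ennreal (1 / m\<^sup>2) * \<dots> \<le> ennreal (1 / m\<^sup>2) * ennreal (m\<^sup>2 * (1 + \<eta>\<^sup>2))"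
      using two by (intro mult_left_mono) (auto simp: m_def)
    also have "\<dots> = ennreal (1 + \<eta>\<^sup>2)"
      using m by (subst ennreal_mult'[symmetric]) auto
    finally show ?thesis .
  qed
  have covM: "ennreal a \<le> (\<integral>\<^sup>+ z. ennreal (M z) * indicator A z \<partial>P)"
  proof -
    have mi: "(\<lambda>z. ennreal (L i z) * indicator A z) \<in> borel_measurable P" if "i \<in> F" for i
      by (intro borel_measurable_times_ennreal measurable_compose[OF L measurable_ennreal] borel_measurable_indicator that A)
    have "ennreal a = ennreal (1 / m) * (\<Sum>i\<in>F. ennreal a)"
      unfolding cF mult.assoc[symmetric] mm by simp
    also have "\<dots> \<le> ennreal (1 / m) * (\<Sum>i\<in>F. \<integral>\<^sup>+ z. ennreal (L i z) * indicator A z \<partial>P)"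
    proof (intro mult_left_mono sum_mono)
      fix i assume i: "i \<in> F"
      have "emeasure (density P (\<lambda>z. ennreal (L i z))) A = (\<integral>\<^sup>+ z. ennreal (L i z) * indicator A z \<partial>P)"
        by (rule emeasure_density[OF measurable_compose[OF L[OF i] measurable_ennreal] A])
      then show "ennreal a \<le> (\<integral>\<^sup>+ z. ennreal (L i z) * indicator A z \<partial>P)" using cov[OF i] by simp
    qed simp
    also have "\<dots> = (\<integral>\<^sup>+ z. ennreal (1 / m) * (\<Sum>i\<in>F. ennreal (L i z) * indicator A z) \<partial>P)"
      by (subst nn_integral_cmult, (intro borel_measurable_sum mi; assumption), subst nn_integral_sum, erule mi, rule refl)
    also have "\<dots> = (\<integral>\<^sup>+ z. ennreal (M z) * indicator A z \<partial>P)"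
      unfolding eM by (simp add: sum_distrib_right mult.assoc)
    finally show ?thesis .
  qed
  have pt: "ennreal (M z) * indicator A z + ennreal (1 / \<eta>) * ennreal (M z)
      \<le> indicator A z + (ennreal (1 / (2 * \<eta>)) * ennreal ((M z)\<^sup>2) + ennreal (1 / (2 * \<eta>) + \<eta> / 2))" for z
  proof -
    define I :: real where "I = indicator A z"
    have I: "I = 0 \<or> I = 1" by (simp add: I_def indicator_def)
    have sq: "0 \<le> (M z - 1 - \<eta>)\<^sup>2" "0 \<le> (M z - 1)\<^sup>2" by simp_all
    \<comment> \<open>the arithmetic-geometric mean inequality, as \<open>(M z - 1 - \<eta>)\<^sup>2 \<ge> 0\<close>\<close>
    have "M z - 1 \<le> (M z - 1)\<^sup>2 / (2 * \<eta>) + \<eta> / 2"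
      using sq(1) \<eta> by (simp add: field_simps power2_eq_square)
    moreover have "0 \<le> (M z - 1)\<^sup>2 / (2 * \<eta>) + \<eta> / 2" using \<eta> by simp
    ultimately have "M z * I - I \<le> (M z - 1)\<^sup>2 / (2 * \<eta>) + \<eta> / 2" using I by auto
    moreover have "(M z - 1)\<^sup>2 / (2 * \<eta>) = 1 / (2 * \<eta>) * (M z)\<^sup>2 - 1 / \<eta> * M z + 1 / (2 * \<eta>)"
      using \<eta> by (simp add: field_simps power2_eq_square)
    ultimately have r: "M z * I + 1 / \<eta> * M z \<le> I + (1 / (2 * \<eta>) * (M z)\<^sup>2 + (1 / (2 * \<eta>) + \<eta> / 2))" by linarith
    have eI: "indicator A z = ennreal I" by (simp add: I_def indicator_def)
    have Inn: "0 \<le> I" using I by auto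
    have "ennreal (M z) * indicator A z + ennreal (1 / \<eta>) * ennreal (M z) = ennreal (M z * I + 1 / \<eta> * M z)"
    proof -
      have "ennreal (M z * I + 1 / \<eta> * M z) = ennreal (M z * I) + ennreal (1 / \<eta> * M z)"
        using Mnn[of z] Inn \<eta> by (intro ennreal_plus) auto
      also have "ennreal (M z * I) = ennreal (M z) * ennreal I"
        by (rule ennreal_mult'[OF Mnn])
      also have "ennreal (1 / \<eta> * M z) = ennreal (1 / \<eta>) * ennreal (M z)"
        by (rule ennreal_mult') (use \<eta> in simp)
      finally show ?thesis unfolding eI by simp
    qed
    also have "\<dots> \<le> ennreal (I + (1 / (2 * \<eta>) * (M z)\<^sup>2 + (1 / (2 * \<eta>) + \<eta> / 2)))"
      by (rule ennreal_leI[OF r])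
    also have "\<dots> = indicator A z + (ennreal (1 / (2 * \<eta>)) * ennreal ((M z)\<^sup>2) + ennreal (1 / (2 * \<eta>) + \<eta> / 2))"
      unfolding eI using Inn \<eta> by (subst ennreal_mult[symmetric], simp, simp, subst ennreal_plus[symmetric], simp, simp, subst ennreal_plus[symmetric]) auto
    finally show ?thesis .
  qed
  have iA: "(\<lambda>z. indicator A z :: ennreal) \<in> borel_measurable P" using A by simp
  have "ennreal a + ennreal (1 / \<eta>) \<le> (\<integral>\<^sup>+ z. ennreal (M z) * indicator A z \<partial>P) + ennreal (1 / \<eta>) * (\<integral>\<^sup>+ z. ennreal (M z) \<partial>P)"
    unfolding int1 using covM by (simp add: add_right_mono)
  also have "\<dots> = (\<integral>\<^sup>+ z. (ennreal (M z) * indicator A z + ennreal (1 / \<eta>) * ennreal (M z)) \<partial>P)"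
    using iA by (subst nn_integral_add) (auto simp: nn_integral_cmult)
  also have "\<dots> \<le> (\<integral>\<^sup>+ z. indicator A z + (ennreal (1 / (2 * \<eta>)) * ennreal ((M z)\<^sup>2) + ennreal (1 / (2 * \<eta>) + \<eta> / 2)) \<partial>P)"
    by (rule nn_integral_mono) (rule pt)
  also have "\<dots> = emeasure P A + (ennreal (1 / (2 * \<eta>)) * (\<integral>\<^sup>+ z. ennreal ((M z)\<^sup>2) \<partial>P) + ennreal (1 / (2 * \<eta>) + \<eta> / 2))"
    using iA A by (subst nn_integral_add, simp, simp, subst nn_integral_add, simp, simp) (simp add: nn_integral_cmult emeasure_space_1)
  also have "\<dots> \<le> emeasure P A + (ennreal (1 / (2 * \<eta>)) * ennreal (1 + \<eta>\<^sup>2) + ennreal (1 / (2 * \<eta>) + \<eta> / 2))"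
    by (intro add_left_mono add_right_mono mult_left_mono int2) simp
  also have "ennreal (1 / (2 * \<eta>)) * ennreal (1 + \<eta>\<^sup>2) + ennreal (1 / (2 * \<eta>) + \<eta> / 2) = ennreal (1 / (2 * \<eta>) * (1 + \<eta>\<^sup>2) + (1 / (2 * \<eta>) + \<eta> / 2))"
    using \<eta> by (subst ennreal_mult[symmetric], simp, simp, subst ennreal_plus[symmetric]) auto
  also have "1 / (2 * \<eta>) * (1 + \<eta>\<^sup>2) + (1 / (2 * \<eta>) + \<eta> / 2) = 1 / \<eta> + \<eta>"
    using \<eta> by (simp add: field_simps power2_eq_square)
  finally have fin: "ennreal a + ennreal (1 / \<eta>) \<le> emeasure P A + ennreal (1 / \<eta> + \<eta>)" .
  show ?thesis
  proof (cases "a \<le> \<eta>")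
    case True then show ?thesis by (simp add: ennreal_neg)
  next
    case False
    have "ennreal (a + 1 / \<eta>) \<le> ennreal (prob A + (1 / \<eta> + \<eta>))"
      using fin False \<eta> by (simp add: emeasure_eq_measure ennreal_plus measure_nonneg)
    then have "a + 1 / \<eta> \<le> prob A + (1 / \<eta> + \<eta>)"
      using \<eta> by (subst (asm) ennreal_le_iff) (simp_all add: add_nonneg_nonneg)
    then show ?thesis by (simp add: emeasure_eq_measure ennreal_leI)
  qed
qed

section \<open>Lower bound: a mixture of sparse alternatives\<close>

lemma Theta_iff:
  "(\<beta>, \<Omega>, \<sigma>) \<in> Theta M1 M2 p k \<longleftrightarrow>
     \<beta> \<in> carrier_vec p \<and> l0_norm \<beta> \<le> k \<and> well_conditioned M1 p \<Omega> \<and> 0 < \<sigma> \<and> \<sigma> \<le> M2"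
  by (auto simp: Theta_def well_conditioned_def)

lemma conf_intervals_coverage:
  assumes "(l, u) \<in> conf_intervals n p \<alpha> \<Theta> T" "(\<beta>, \<Omega>, \<sigma>) \<in> \<Theta>"
  shows "ennreal (1 - \<alpha>) \<le> emeasure (obs_law n p (\<beta>, \<Omega>, \<sigma>)) {z \<in> space (obs_space n p). l z \<le> T \<beta> \<and> T \<beta> \<le> u z}"
proof -
  have "ennreal (1 - \<alpha>) \<le> (INF (\<beta>, \<Omega>, \<sigma>)\<in>\<Theta>.
        emeasure (obs_law n p (\<beta>, \<Omega>, \<sigma>)) {z \<in> space (obs_space n p). l z \<le> T \<beta> \<and> T \<beta> \<le> u z})"
    using assms(1) by (simp add: conf_intervals_def)
  also have "\<dots> \<le> emeasure (obs_law n p (\<beta>, \<Omega>, \<sigma>)) {z \<in> space (obs_space n p). l z \<le> T \<beta> \<and> T \<beta> \<le> u z}"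
    by (rule INF_lower2[OF assms(2)]) simp
  finally show ?thesis .
qed

lemma sets_obs_law [simp]: "sets (obs_law n p \<theta>) = sets (obs_space n p)"
  by (simp add: obs_law_def split: prod.split)

lemma space_obs_law [simp]: "space (obs_law n p \<theta>) = space (obs_space n p)"
  by (rule sets_eq_imp_space_eq) simp

lemma inverse_one_minus_le_exp:
  fixes x s :: real
  assumes s: "0 < s" and x: "0 \<le> x" "x \<le> s\<^sup>2 / 2"
  shows "s\<^sup>2 / (s\<^sup>2 - x) \<le> exp (2 * x / s\<^sup>2)"
proof -
  define t where "t = x / s\<^sup>2"
  have s2: "0 < s\<^sup>2" using s by simp
  have t: "0 \<le> t" "t \<le> 1 / 2" using x s2 by (auto simp: t_def field_simps)
  have "s\<^sup>2 / (s\<^sup>2 - x) = 1 / (1 - t)"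
  proof -
    have "s\<^sup>2 - x = s\<^sup>2 * (1 - t)" using s2 by (simp add: t_def field_simps)
    then show ?thesis using s2 by simp
  qed
  also have "\<dots> \<le> 1 + 2 * t"
  proof -
    have "0 \<le> t * (1 - 2 * t)" using t by (intro mult_nonneg_nonneg) auto
    then have "1 \<le> (1 + 2 * t) * (1 - t)" by (simp add: algebra_simps)
    then show ?thesis using t by (simp add: divide_le_eq)
  qed
  also have "\<dots> \<le> exp (2 * t)" by (rule exp_ge_add_one_self)
  finally show ?thesis by (simp add: t_def)
qed

text \<open>The generating function of the number of agreements of two random choice functions. It factorises
  because the choices in different blocks are independent.\<close>

lemma sum_PiE_overlap:
  fixes T :: real
  assumes r: "0 < r"
  shows "(\<Sum>f\<in>Pi\<^sub>E {..<k} (\<lambda>_. {..<r}). \<Sum>g\<in>Pi\<^sub>E {..<k} (\<lambda>_. {..<r}). \<Prod>i<k::nat. if f i = g i then T else 1)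
       = (real r * (real r - 1 + T)) ^ k"
proof -
  have inner: "(\<Sum>g\<in>Pi\<^sub>E {..<k} (\<lambda>_. {..<r}). \<Prod>i<k. if f i = g i then T else 1) = (real r - 1 + T) ^ k"
    if f: "f \<in> Pi\<^sub>E {..<k} (\<lambda>_. {..<r})" for f :: "nat \<Rightarrow> nat"
  proof -
    have "(\<Sum>g\<in>Pi\<^sub>E {..<k} (\<lambda>_. {..<r}). \<Prod>i<k. if f i = g i then T else 1)
        = (\<Prod>i<k. \<Sum>b<r. if f i = b then T else 1)"
      by (rule prod_sum_PiE[symmetric]) auto
    also have "\<dots> = (\<Prod>i<k. real r - 1 + T)"
    proof (rule prod.cong[OF refl])
      fix i assume "i \<in> {..<k}"
      then have "f i < r" using f by auto
      have "(\<Sum>b<r. if f i = b then T else 1) = (\<Sum>b<r. 1 + (if b = f i then T - 1 else 0))"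
        by (rule sum.cong) auto
      also have "\<dots> = real r - 1 + T" using \<open>f i < r\<close> by (simp add: sum.distrib)
      finally show "(\<Sum>b<r. if f i = b then T else 1) = real r - 1 + T" .
    qed
    finally show ?thesis by simp
  qed
  have "(\<Sum>f\<in>Pi\<^sub>E {..<k} (\<lambda>_. {..<r}). \<Sum>g\<in>Pi\<^sub>E {..<k} (\<lambda>_. {..<r}). \<Prod>i<k::nat. if f i = g i then T else 1)
     = (\<Sum>f\<in>Pi\<^sub>E {..<k} (\<lambda>_. {..<r}). (real r - 1 + T) ^ k)"
    by (rule sum.cong[OF refl]) (rule inner)
  also have "\<dots> = real (r ^ k) * (real r - 1 + T) ^ k"
    by (simp add: card_PiE)
  finally show ?thesis by (simp add: power_mult_distrib)
qed

text \<open>The signs follow \<open>\<xi>\<close>, so that all entries push \<open>\<xi> \<bullet> \<beta>\<close> in the same direction.\<close>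

definition spike :: "nat \<Rightarrow> real Matrix.vec \<Rightarrow> real \<Rightarrow> nat set \<Rightarrow> real Matrix.vec" where
  "spike p \<xi> \<rho> S = Matrix.vec p (\<lambda>j. if j \<in> S then \<rho> * sgn (vec_index \<xi> j) else 0)"

lemma sum_spike_mult:
  assumes \<xi>: "dim_vec \<xi> = p" and S: "S \<subseteq> vsupp \<xi>" and S': "S' \<subseteq> vsupp \<xi>"
  shows "(\<Sum>j<p. vec_index (spike p \<xi> \<rho> S) j * vec_index (spike p \<xi> \<rho> S') j) = \<rho>\<^sup>2 * real (card (S \<inter> S'))"
proof -
  have fin: "finite (S \<inter> S')" "S \<inter> S' \<subseteq> {..<p}"
    using S \<xi> by (auto simp: vsupp_def intro: finite_subset[of _ "{..<p}"])
  have "(\<Sum>j<p. vec_index (spike p \<xi> \<rho> S) j * vec_index (spike p \<xi> \<rho> S') j) = (\<Sum>j<p. if j \<in> S \<inter> S' then \<rho>\<^sup>2 else 0)"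
  proof (rule sum.cong[OF refl])
    fix j assume j: "j \<in> {..<p}"
    have "sgn (vec_index \<xi> j) * sgn (vec_index \<xi> j) = 1" if "j \<in> S"
      using S that by (auto simp: vsupp_def sgn_if)
    then show "vec_index (spike p \<xi> \<rho> S) j * vec_index (spike p \<xi> \<rho> S') j = (if j \<in> S \<inter> S' then \<rho>\<^sup>2 else 0)"
      using j by (auto simp: spike_def power2_eq_square mult_ac)
  qed
  also have "\<dots> = (\<Sum>j\<in>S \<inter> S'. \<rho>\<^sup>2)"
    using fin(2) by (subst sum.inter_restrict[symmetric]) (auto simp: Int_absorb1)
  finally show ?thesis by simp
qed

lemma scalar_prod_spike_ge:
  assumes \<xi>: "dim_vec \<xi> = p" and S: "S \<subseteq> vsupp \<xi>" and \<rho>: "0 \<le> \<rho>" and \<mu>: "\<And>j. j \<in> vsupp \<xi> \<Longrightarrow> \<mu> \<le> \<bar>vec_index \<xi> j\<bar>"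
  shows "\<rho> * real (card S) * \<mu> \<le> scalar_prod \<xi> (spike p \<xi> \<rho> S)"
proof -
  have Sp: "S \<subseteq> {..<p}" using S \<xi> by (auto simp: vsupp_def)
  have "scalar_prod \<xi> (spike p \<xi> \<rho> S) = (\<Sum>j<p. if j \<in> S then \<rho> * \<bar>vec_index \<xi> j\<bar> else 0)"
    unfolding scalar_prod_def
    by (simp add: spike_def lessThan_atLeast0) (rule sum.cong, auto simp: abs_sgn mult_ac)
  also have "\<dots> = (\<Sum>j\<in>S. \<rho> * \<bar>vec_index \<xi> j\<bar>)"
    using Sp by (subst sum.inter_restrict[symmetric]) (auto simp: Int_absorb1)
  also have "\<dots> \<ge> (\<Sum>j\<in>S. \<rho> * \<mu>)"
    using S \<mu> \<rho> by (intro sum_mono mult_left_mono) auto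
  finally show ?thesis by (simp add: mult_ac)
qed

lemma spike_in_Theta:
  assumes \<xi>: "dim_vec \<xi> = p" and S: "S \<subseteq> vsupp \<xi>" "card S \<le> k" and "0 < p" "1 \<le> M1" "0 < \<tau>" "\<tau> \<le> M2"
  shows "(spike p \<xi> \<rho> S, 1\<^sub>m p, \<tau>) \<in> Theta M1 M2 p k"
proof -
  have "finite S" using S \<xi> by (auto simp: vsupp_def intro: finite_subset[of _ "{..<p}"])
  moreover have "vsupp (spike p \<xi> \<rho> S) \<subseteq> S" by (auto simp: vsupp_def spike_def split: if_splits)
  ultimately have "l0_norm (spike p \<xi> \<rho> S) \<le> k"
    unfolding l0_norm_def using S(2) by (meson card_mono le_trans)
  then show ?thesis using assms well_conditioned_one_mat by (auto simp: Theta_iff spike_def)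
qed

text \<open>The supports of the alternatives are indexed by choice functions \<open>f\<close> that select one of \<open>r\<close>
  coordinates in each of \<open>k\<close> disjoint blocks of the support of \<open>\<xi>\<close>. An interval with the required
  coverage reaches \<open>\<Delta> = \<rho> k \<mu>\<close> with probability at least \<open>1 - \<alpha>\<close> under each alternative, hence
  with probability at least \<open>1 - \<alpha> - \<eta>\<close> under the null, where its lower end point is at most
  \<open>0\<close> with probability at least \<open>1 - \<alpha>\<close>.\<close>

lemma minimax_length_ge:
  fixes \<alpha> \<eta> \<rho> \<mu> s M1 :: real
  assumes s: "0 < s" and M1: "1 \<le> M1" and r: "0 < r" and p: "0 < p"
    and \<xi>: "dim_vec \<xi> = p" and kr: "k * r \<le> card (vsupp \<xi>)"
    and \<rho>: "0 \<le> \<rho>" "real k * \<rho>\<^sup>2 \<le> s\<^sup>2 / 2"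
    and \<eta>: "0 < \<eta>" "2 * \<alpha> + \<eta> < 1" and \<alpha>: "0 < \<alpha>"
    and chi: "exp (real k * exp (2 * real n * \<rho>\<^sup>2 / s\<^sup>2) / real r) \<le> 1 + \<eta>\<^sup>2"
    and \<mu>: "0 \<le> \<mu>" "\<And>j. j \<in> vsupp \<xi> \<Longrightarrow> \<mu> \<le> \<bar>vec_index \<xi> j\<bar>"
  shows "ennreal ((1 - 2 * \<alpha> - \<eta>) * (\<rho> * real k * \<mu>)) \<le> minimax_length n p \<alpha> (Theta M1 s p k) (\<lambda>\<beta>. scalar_prod \<xi> \<beta>)"
proof -
  define \<Delta> where "\<Delta> = \<rho> * real k * \<mu>"
  have \<Delta>: "0 \<le> \<Delta>" using \<rho> \<mu> by (simp add: \<Delta>_def)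
  define F where "F = Pi\<^sub>E {..<k} (\<lambda>_. {..<r})"
  have F: "finite F" "F \<noteq> {}" "card F = r ^ k"
    using r by (auto simp: F_def card_PiE PiE_eq_empty_iff intro!: finite_PiE)
  define T where "T = exp (2 * real n * \<rho>\<^sup>2 / s\<^sup>2)"
  have fin: "finite (vsupp \<xi>)" by (simp add: vsupp_def)
  obtain e where e: "bij_betw e {..<card (vsupp \<xi>)} (vsupp \<xi>)"
    using ex_bij_betw_nat_finite[OF fin] by (auto simp: lessThan_atLeast0)
  \<comment> \<open>\<open>e\<close> enumerates the support of \<open>\<xi>\<close>; block \<open>i\<close> consists of the indices \<open>i * r, ..., i * r + r - 1\<close>\<close>
  define S where "S = (\<lambda>f :: nat \<Rightarrow> nat. (\<lambda>i. e (i * r + f i)) ` {..<k})"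
  have idx: "i * r + a < card (vsupp \<xi>)" if "i < k" "a < r" for i a
  proof -
    have "i * r + a < Suc i * r" using that by simp
    also have "\<dots> \<le> k * r" using that by (intro mult_right_mono) auto
    finally show ?thesis using kr by simp
  qed
  have inj: "i = i' \<and> a = a'" if "i < k" "a < r" "i' < k" "a' < r" "e (i * r + a) = e (i' * r + a')" for i a i' a'
  proof -
    have eq: "i * r + a = i' * r + a'"
      using bij_betw_imp_inj_on[OF e] idx that by (auto dest: inj_onD)
    have "(i * r + a) div r = i" "(i' * r + a') div r = i'" using that by auto
    then have "i = i'" using eq by simp
    then show ?thesis using eq by simp
  qed
  have Sv: "S f \<subseteq> vsupp \<xi>" if "f \<in> F" for f
    using that idx bij_betwE[OF e] by (auto simp: S_def F_def PiE_iff)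
  have cardS: "card (S f) = k" if "f \<in> F" for f
  proof -
    have "inj_on (\<lambda>i. e (i * r + f i)) {..<k}"
    proof (rule inj_onI)
      fix x y assume "x \<in> {..<k}" "y \<in> {..<k}" "e (x * r + f x) = e (y * r + f y)"
      then show "x = y" using inj[of x "f x" y "f y"] that by (auto simp: F_def PiE_iff)
    qed
    then show ?thesis unfolding S_def by (simp add: card_image)
  qed
  have cardSS: "card (S f \<inter> S g) = card {i. i < k \<and> f i = g i}" if "f \<in> F" "g \<in> F" for f g
  proof -
    have fr: "f i < r" "g i < r" if "i < k" for i using \<open>f \<in> F\<close> \<open>g \<in> F\<close> that by (auto simp: F_def PiE_iff)
    have "S f \<inter> S g = (\<lambda>i. e (i * r + f i)) ` {i. i < k \<and> f i = g i}"
    proof (intro equalityI subsetI)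
      fix j assume "j \<in> S f \<inter> S g"
      then obtain i i' where i: "i < k" "i' < k" "j = e (i * r + f i)" "j = e (i' * r + g i')"
        by (auto simp: S_def)
      then have "i = i' \<and> f i = g i'" using fr by (intro inj) auto
      then show "j \<in> (\<lambda>i. e (i * r + f i)) ` {i. i < k \<and> f i = g i}" using i by auto
    next
      fix j assume "j \<in> (\<lambda>i. e (i * r + f i)) ` {i. i < k \<and> f i = g i}"
      then obtain i where i: "i < k" "f i = g i" "j = e (i * r + f i)" by auto
      have "j \<in> S f" unfolding S_def i(3) using i(1) by (intro imageI) simp
      moreover have "j \<in> S g" unfolding S_def i(3) i(2) using i(1) by (intro imageI) simp
      ultimately show "j \<in> S f \<inter> S g" by simp
    qed
    moreover have "inj_on (\<lambda>i. e (i * r + f i)) {i. i < k \<and> f i = g i}"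
    proof (rule inj_onI)
      fix x y assume xy: "x \<in> {i. i < k \<and> f i = g i}" "y \<in> {i. i < k \<and> f i = g i}" "e (x * r + f x) = e (y * r + f y)"
      then show "x = y" using inj[of x "f x" y "f y"] fr(1)[of x] fr(1)[of y] by auto
    qed
    ultimately show ?thesis by (simp only: card_image)
  qed
  define \<beta> where "\<beta> = (\<lambda>f. spike p \<xi> \<rho> (S f))"
  \<comment> \<open>this noise level keeps the variance of the response at \<open>s\<^sup>2\<close>\<close>
  define \<tau> where "\<tau> = sqrt (s\<^sup>2 - real k * \<rho>\<^sup>2)"
  have \<tau>2: "\<tau>\<^sup>2 = s\<^sup>2 - real k * \<rho>\<^sup>2" "0 < \<tau>"
  proof -
    have "real k * \<rho>\<^sup>2 < s\<^sup>2" using \<rho>(2) zero_less_power[OF s, of 2] by linarith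
    then show "\<tau>\<^sup>2 = s\<^sup>2 - real k * \<rho>\<^sup>2" "0 < \<tau>" by (auto simp: \<tau>_def)
  qed
  have \<tau>s: "\<tau> \<le> s"
    unfolding \<tau>_def using s by (intro real_le_lsqrt) auto
  have norm\<beta>: "\<tau>\<^sup>2 + (\<Sum>j<p. (vec_index (\<beta> f) j)\<^sup>2) = s\<^sup>2" if "f \<in> F" for f
  proof -
    have "(\<Sum>j<p. (vec_index (\<beta> f) j)\<^sup>2) = \<rho>\<^sup>2 * real k"
      using sum_spike_mult[OF \<xi> Sv[OF that] Sv[OF that], of \<rho>] cardS[OF that]
      by (simp only: \<beta>_def power2_eq_square Int_absorb)
    then show ?thesis by (simp add: \<tau>2)
  qed
  have wc: "well_conditioned M1 p (1\<^sub>m p)" by (rule well_conditioned_one_mat[OF p M1])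
  have mv: "prob_space (mvnormal p (1\<^sub>m p))"
    by (rule prob_space_mvnormal[OF wc _ p]) (use M1 in simp)
  define K where "K = single_law p (0\<^sub>v p) (1\<^sub>m p) s"
  define P where "P = Pi\<^sub>M {..<n} (\<lambda>_. K)"
  have K: "prob_space K" unfolding K_def by (rule prob_space_single_law[OF mv s])
  have P: "prob_space P" unfolding P_def by (intro prob_space_PiM K)
  have P0: "obs_law n p (0\<^sub>v p, 1\<^sub>m p, s) = P"
    unfolding P_def K_def by (rule obs_law_eq_PiM[OF mv s])
  have setsP: "sets P = sets (obs_space n p)" unfolding P0[symmetric] by simp
  define \<ll> where "\<ll> = (\<lambda>f. likelihood_ratio p s \<tau> (vec_index (\<beta> f)))"
  have \<ll>m: "\<ll> f \<in> borel_measurable K" for f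
    unfolding \<ll>_def K_def using borel_measurable_likelihood_ratio by (simp cong: measurable_cong_sets)
  have \<ll>0: "0 \<le> \<ll> f z" for f z unfolding \<ll>_def by (rule likelihood_ratio_nonneg)
  define L where "L = (\<lambda>f z. \<Prod>i<n. \<ll> f (z i))"
  have \<ll>c: "(\<lambda>z. \<ll> f (z i)) \<in> borel_measurable P" if "i \<in> {..<n}" for f i
    unfolding P_def by (rule measurable_compose[OF measurable_component_nat \<ll>m]) (use that in simp)
  have Lm: "L f \<in> borel_measurable P" for f
    unfolding L_def by (rule borel_measurable_prod) (rule \<ll>c)
  have L0: "0 \<le> L f z" for f z unfolding L_def by (intro prod_nonneg ballI \<ll>0)
  have Pf: "obs_law n p (\<beta> f, 1\<^sub>m p, \<tau>) = density P (\<lambda>z. ennreal (L f z))" for f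
  proof -
    have dK: "single_law p (\<beta> f) (1\<^sub>m p) \<tau> = density K (\<lambda>z. ennreal (\<ll> f z))"
      unfolding K_def \<ll>_def by (rule single_law_density[OF s \<tau>2(2)])
    have "obs_law n p (\<beta> f, 1\<^sub>m p, \<tau>) = Pi\<^sub>M {..<n} (\<lambda>_. single_law p (\<beta> f) (1\<^sub>m p) \<tau>)"
      by (rule obs_law_eq_PiM[OF mv \<tau>2(2)])
    also have "\<dots> = density P (\<lambda>z. ennreal (L f z))"
      unfolding dK P_def L_def
      by (rule PiM_density[OF K _ \<ll>m \<ll>0]) (metis dK prob_space_single_law[OF mv \<tau>2(2)])
    finally show ?thesis .
  qed
  have one: "(\<integral>\<^sup>+ z. ennreal (L f z) \<partial>P) = 1" for f
  proof -
    interpret D: prob_space "obs_law n p (\<beta> f, 1\<^sub>m p, \<tau>)"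
      unfolding obs_law_eq_PiM[OF mv \<tau>2(2)] by (intro prob_space_PiM prob_space_single_law[OF mv \<tau>2(2)])
    have "emeasure (density P (\<lambda>z. ennreal (L f z))) (space P) = 1"
      using D.emeasure_space_1 unfolding Pf by simp
    then show ?thesis
      using Lm by (subst (asm) emeasure_density) (auto cong: nn_integral_cong_simp)
  qed
  have Kp: "product_sigma_finite (\<lambda>_::nat. K)"
    by (simp add: product_sigma_finite_def prob_space_imp_sigma_finite[OF K])
  have corr: "(\<integral>\<^sup>+ z. ennreal (L f z * L g z) \<partial>P) \<le> ennreal (\<Prod>i<k. if f i = g i then T else 1)"
    if f: "f \<in> F" and g: "g \<in> F" for f g
  proof -
    define c where "c = card {i. i < k \<and> f i = g i}"
    have ck: "c \<le> k" unfolding c_def using card_mono[of "{..<k}" "{i. i < k \<and> f i = g i}"] by auto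
    have ip: "(\<Sum>j<p. vec_index (\<beta> f) j * vec_index (\<beta> g) j) = \<rho>\<^sup>2 * real c"
      unfolding \<beta>_def c_def cardSS[OF f g, symmetric] by (rule sum_spike_mult[OF \<xi> Sv[OF f] Sv[OF g]])
    have x: "0 \<le> \<rho>\<^sup>2 * real c" "\<rho>\<^sup>2 * real c \<le> s\<^sup>2 / 2"
    proof -
      have "\<rho>\<^sup>2 * real c \<le> \<rho>\<^sup>2 * real k" using ck by (intro mult_left_mono) auto
      then show "\<rho>\<^sup>2 * real c \<le> s\<^sup>2 / 2" using \<rho>(2) by (simp add: mult_ac)
    qed simp
    have K1: "(\<integral>\<^sup>+ z. ennreal (\<ll> f z * \<ll> g z) \<partial>K) \<le> ennreal (exp (2 * (\<rho>\<^sup>2 * real c) / s\<^sup>2))"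
    proof -
      have "(\<integral>\<^sup>+ z. ennreal (\<ll> f z * \<ll> g z) \<partial>K) = ennreal (s\<^sup>2 / (s\<^sup>2 - \<rho>\<^sup>2 * real c))"
        unfolding \<ll>_def K_def likelihood_ratio_correlation[OF s \<tau>2(2) norm\<beta>[OF f] \<tau>2(2) norm\<beta>[OF g]] ip ..
      then show ?thesis using inverse_one_minus_le_exp[OF s x] by (simp add: ennreal_leI)
    qed
    have "(\<integral>\<^sup>+ z. ennreal (L f z * L g z) \<partial>P) = (\<integral>\<^sup>+ z. (\<Prod>i<n. ennreal (\<ll> f (z i) * \<ll> g (z i))) \<partial>P)"
    proof (rule nn_integral_cong)
      fix z
      have "L f z * L g z = (\<Prod>i<n. \<ll> f (z i) * \<ll> g (z i))"
        unfolding L_def by (rule prod.distrib[symmetric])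
      then show "ennreal (L f z * L g z) = (\<Prod>i<n. ennreal (\<ll> f (z i) * \<ll> g (z i)))"
        using \<ll>0 by (simp only: prod_ennreal mult_nonneg_nonneg)
    qed
    also have "\<dots> = (\<Prod>i<n. \<integral>\<^sup>+ z. ennreal (\<ll> f z * \<ll> g z) \<partial>K)"
      unfolding P_def
      by (rule product_sigma_finite.product_nn_integral_prod[OF Kp])
        (auto intro!: measurable_compose[OF borel_measurable_times[OF \<ll>m \<ll>m] measurable_ennreal])
    also have "\<dots> = (\<integral>\<^sup>+ z. ennreal (\<ll> f z * \<ll> g z) \<partial>K) ^ n" by simp
    also have "\<dots> \<le> ennreal (exp (2 * (\<rho>\<^sup>2 * real c) / s\<^sup>2)) ^ n"
      by (rule power_mono[OF K1]) simp
    also have "\<dots> = ennreal (T ^ c)"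
      by (simp add: ennreal_power T_def exp_of_nat_mult[symmetric] mult_ac)
    also have "T ^ c = (\<Prod>i<k. if f i = g i then T else 1)"
    proof -
      have "(\<Prod>i<k. if f i = g i then T else 1) = (\<Prod>i\<in>{i\<in>{..<k}. f i = g i}. T)"
        by (rule prod.inter_filter[symmetric]) simp
      then show ?thesis by (simp add: c_def)
    qed
    finally show ?thesis .
  qed
  have two: "(\<Sum>f\<in>F. \<Sum>g\<in>F. \<integral>\<^sup>+ z. ennreal (L f z * L g z) \<partial>P) \<le> ennreal ((real (card F))\<^sup>2 * (1 + \<eta>\<^sup>2))"
  proof -
    have T0: "0 \<le> T" by (simp add: T_def)
    have "(\<Sum>f\<in>F. \<Sum>g\<in>F. \<integral>\<^sup>+ z. ennreal (L f z * L g z) \<partial>P) \<le> (\<Sum>f\<in>F. \<Sum>g\<in>F. ennreal (\<Prod>i<k. if f i = g i then T else 1))"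
      by (intro sum_mono corr)
    also have "\<dots> = ennreal (\<Sum>f\<in>F. \<Sum>g\<in>F. \<Prod>i<k. if f i = g i then T else 1)"
      using T0 by (simp add: sum_nonneg prod_nonneg)
    also have "(\<Sum>f\<in>F. \<Sum>g\<in>F. \<Prod>i<k. if f i = g i then T else 1) = (real r * (real r - 1 + T)) ^ k"
      unfolding F_def by (rule sum_PiE_overlap[OF r])
    also have "\<dots> \<le> (real (card F))\<^sup>2 * (1 + \<eta>\<^sup>2)"
    proof -
      have "real r - 1 + T \<le> real r * exp (T / real r)"
      proof -
        have "real r - 1 + T \<le> real r * (1 + T / real r)" using r by (simp add: field_simps)
        also have "\<dots> \<le> real r * exp (T / real r)" by (intro mult_left_mono exp_ge_add_one_self) simp
        finally show ?thesis .
      qed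
      then have "(real r * (real r - 1 + T)) ^ k \<le> (real r * (real r * exp (T / real r))) ^ k"
        using r T0 by (intro power_mono mult_left_mono mult_nonneg_nonneg) auto
      also have "\<dots> = (real (card F))\<^sup>2 * exp (real k * T / real r)"
        by (simp add: F(3) power_mult_distrib exp_of_nat_mult[symmetric] power2_eq_square)
      also have "\<dots> \<le> (real (card F))\<^sup>2 * (1 + \<eta>\<^sup>2)"
        using chi unfolding T_def[symmetric] by (intro mult_left_mono) auto
      finally show ?thesis .
    qed
    finally show ?thesis by (simp add: ennreal_leI)
  qed
  have zeroTheta: "(0\<^sub>v p, 1\<^sub>m p, s) \<in> Theta M1 s p k"
  proof -
    have "vsupp (0\<^sub>v p) = {}" by (auto simp: vsupp_def)
    then show ?thesis using s wc by (simp add: Theta_iff l0_norm_def)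
  qed
  show ?thesis
    unfolding minimax_length_def
  proof (rule INF_greatest, clarify)
    fix l u assume lu: "(l, u) \<in> conf_intervals n p \<alpha> (Theta M1 s p k) (\<lambda>\<beta>. scalar_prod \<xi> \<beta>)"
    have lm: "l \<in> borel_measurable P" and um: "u \<in> borel_measurable P" and lule: "\<And>z. z \<in> space P \<Longrightarrow> l z \<le> u z"
      using lu setsP sets_eq_imp_space_eq[OF setsP] by (auto simp: conf_intervals_def cong: measurable_cong_sets)
    have spP: "space P = space (obs_space n p)" by (rule sets_eq_imp_space_eq[OF setsP])
    define A where "A = {z \<in> space P. \<Delta> \<le> u z}"
    define B where "B = {z \<in> space P. l z \<le> 0}"
    have A: "A \<in> sets P" unfolding A_def using um by measurable
    have B: "B \<in> sets P" unfolding B_def using lm by measurable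
    interpret P: prob_space P by fact
    have "ennreal (1 - \<alpha> - \<eta>) \<le> emeasure P A"
    proof (rule mixture_comparison[OF P F(1,2) Lm L0 one two \<eta>(1) A])
      fix f assume f: "f \<in> F"
      have th: "(\<beta> f, 1\<^sub>m p, \<tau>) \<in> Theta M1 s p k"
        unfolding \<beta>_def using cardS[OF f] by (intro spike_in_Theta \<xi> Sv[OF f] p M1 \<tau>2 \<tau>s) simp
      have "ennreal (1 - \<alpha>) \<le> emeasure (obs_law n p (\<beta> f, 1\<^sub>m p, \<tau>))
        {z \<in> space (obs_space n p). l z \<le> scalar_prod \<xi> (\<beta> f) \<and> scalar_prod \<xi> (\<beta> f) \<le> u z}"
        by (rule conf_intervals_coverage[OF lu th])
      also have "\<dots> \<le> emeasure (obs_law n p (\<beta> f, 1\<^sub>m p, \<tau>)) A"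
      proof (rule emeasure_mono)
        have "\<Delta> \<le> scalar_prod \<xi> (\<beta> f)"
          using scalar_prod_spike_ge[OF \<xi> Sv[OF f] \<rho>(1) \<mu>(2)] cardS[OF f] by (simp add: \<Delta>_def \<beta>_def)
        then show "{z \<in> space (obs_space n p). l z \<le> scalar_prod \<xi> (\<beta> f) \<and> scalar_prod \<xi> (\<beta> f) \<le> u z} \<subseteq> A"
          by (auto simp: A_def spP)
        show "A \<in> sets (obs_law n p (\<beta> f, 1\<^sub>m p, \<tau>))" using A setsP by simp
      qed
      finally show "ennreal (1 - \<alpha>) \<le> emeasure (density P (\<lambda>z. ennreal (L f z))) A" unfolding Pf .
    qed
    then have pA: "1 - \<alpha> - \<eta> \<le> P.prob A"
      using \<eta> \<alpha> by (simp add: P.emeasure_eq_measure measure_nonneg)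
    have "ennreal (1 - \<alpha>) \<le> emeasure (obs_law n p (0\<^sub>v p, 1\<^sub>m p, s))
        {z \<in> space (obs_space n p). l z \<le> scalar_prod \<xi> (0\<^sub>v p) \<and> scalar_prod \<xi> (0\<^sub>v p) \<le> u z}"
      by (rule conf_intervals_coverage[OF lu zeroTheta])
    also have "\<dots> \<le> emeasure P B"
      unfolding P0 using \<xi> B by (intro emeasure_mono) (auto simp: B_def spP scalar_prod_def)
    finally have pB: "1 - \<alpha> \<le> P.prob B"
      using \<eta> \<alpha> by (simp add: P.emeasure_eq_measure measure_nonneg)
    have pAB: "1 - 2 * \<alpha> - \<eta> \<le> P.prob (A \<inter> B)"
    proof -
      have "P.prob (A \<union> B) = P.prob A + P.prob B - P.prob (A \<inter> B)"
        by (rule measure_Un3) (use A B in \<open>simp_all add: P.fmeasurable_eq_sets\<close>)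
      then show ?thesis using pA pB P.prob_le_1[of "A \<union> B"] by linarith
    qed
    have "ennreal ((1 - 2 * \<alpha> - \<eta>) * (\<rho> * real k * \<mu>)) \<le> ennreal (\<Delta> * P.prob (A \<inter> B))"
      using mult_left_mono[OF pAB \<Delta>] by (intro ennreal_leI) (simp add: \<Delta>_def mult_ac)
    also have "\<dots> = ennreal \<Delta> * emeasure P (A \<inter> B)"
      using \<Delta> by (simp add: P.emeasure_eq_measure ennreal_mult')
    also have "\<dots> = (\<integral>\<^sup>+ z. ennreal \<Delta> * indicator (A \<inter> B) z \<partial>P)"
      using A B by (simp add: nn_integral_cmult_indicator)
    also have "\<dots> \<le> (\<integral>\<^sup>+ z. ennreal (u z - l z) \<partial>P)"
    proof (rule nn_integral_mono)
      fix z assume "z \<in> space P"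
      then show "ennreal \<Delta> * indicator (A \<inter> B) z \<le> ennreal (u z - l z)"
        by (auto simp: A_def B_def indicator_def intro!: ennreal_leI)
    qed
    also have "\<dots> \<le> (SUP \<theta>\<in>Theta M1 s p k. \<integral>\<^sup>+ z. ennreal (u z - l z) \<partial>obs_law n p \<theta>)"
      unfolding P0[symmetric] by (rule SUP_upper2[OF zeroTheta]) simp
    finally show "ennreal ((1 - 2 * \<alpha> - \<eta>) * (\<rho> * real k * \<mu>)) \<le> (SUP \<theta>\<in>Theta M1 s p k. \<integral>\<^sup>+ z. ennreal (u z - l z) \<partial>obs_law n p \<theta>)" .
  qed
qed

section \<open>Sparse recovery for a fixed design\<close>

text \<open>The same set as \<open>vsupp\<close>, but for a function, since the recovery arguments also apply to the
  grid of integer vectors.\<close>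

definition nsupp :: "nat \<Rightarrow> (nat \<Rightarrow> 'a::zero) \<Rightarrow> nat set" where
  "nsupp p d = {j. j < p \<and> d j \<noteq> 0}"

lemma finite_nsupp [simp]: "finite (nsupp p d)"
  by (simp add: nsupp_def)

lemma l1_le_l2_sparse:
  fixes d :: "nat \<Rightarrow> real"
  assumes "card (nsupp p d) \<le> m"
  shows "(\<Sum>j<p. \<bar>d j\<bar>)\<^sup>2 \<le> real m * (\<Sum>j<p. (d j)\<^sup>2)"
proof -
  have sub: "nsupp p d \<subseteq> {..<p}" by (auto simp: nsupp_def)
  have 1: "(\<Sum>j<p. \<bar>d j\<bar>) = (\<Sum>j\<in>nsupp p d. \<bar>d j\<bar>)"
    by (rule sum.mono_neutral_right) (use sub in \<open>auto simp: nsupp_def\<close>)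
  have 2: "(\<Sum>j<p. (d j)\<^sup>2) = (\<Sum>j\<in>nsupp p d. (d j)\<^sup>2)"
    by (rule sum.mono_neutral_right) (use sub in \<open>auto simp: nsupp_def\<close>)
  have "(\<Sum>j\<in>nsupp p d. \<bar>d j\<bar>)\<^sup>2 \<le> (\<Sum>j\<in>nsupp p d. \<bar>d j\<bar>\<^sup>2) * real (card (nsupp p d))"
    using sum_squared_le_sum_of_squares[of "\<lambda>j. \<bar>d j\<bar>" "nsupp p d"] by (simp add: mult_ac)
  also have "\<dots> \<le> (\<Sum>j\<in>nsupp p d. (d j)\<^sup>2) * real m"
    using assms by (simp add: mult_left_mono sum_nonneg)
  finally show ?thesis unfolding 1 2 by (simp add: mult_ac)
qed

text \<open>Writing \<open>d\<close> for the difference of two candidates, \<open>\<parallel>X d\<parallel>\<^sup>2 = d \<bullet> X\<^sup>T X d\<close> is at most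
  \<open>3 n lam \<parallel>d\<parallel>\<^sub>1\<close>, while the restricted eigenvalue and sparsity bound it below by
  \<open>\<kappa> n \<parallel>d\<parallel>\<^sub>1\<^sup>2 / m\<close>.\<close>

lemma dantzig_l1_bound:
  fixes X :: "nat \<Rightarrow> nat \<Rightarrow> real" and d :: "nat \<Rightarrow> real"
  assumes n: "0 < n" and \<kappa>: "0 < \<kappa>" and lam: "0 \<le> lam"
    and sparse: "card (nsupp p d) \<le> m"
    and re: "\<kappa> * real n * (\<Sum>j<p. (d j)\<^sup>2) \<le> (\<Sum>i<n. (\<Sum>j<p. X i j * d j)\<^sup>2)"
    and res: "\<And>j. j < p \<Longrightarrow> \<bar>\<Sum>i<n. X i j * (\<Sum>l<p. X i l * d l)\<bar> \<le> 3 * real n * lam"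
  shows "(\<Sum>j<p. \<bar>d j\<bar>) \<le> 3 * real m * lam / \<kappa>"
proof -
  define s where "s = (\<Sum>j<p. \<bar>d j\<bar>)"
  have s0: "0 \<le> s" unfolding s_def by (rule sum_nonneg) simp
  have "(\<Sum>i<n. (\<Sum>j<p. X i j * d j)\<^sup>2) = (\<Sum>i<n. \<Sum>j<p. d j * (X i j * (\<Sum>l<p. X i l * d l)))"
    by (intro sum.cong refl) (simp add: power2_eq_square sum_distrib_right mult_ac)
  also have "\<dots> = (\<Sum>j<p. d j * (\<Sum>i<n. X i j * (\<Sum>l<p. X i l * d l)))"
    by (subst sum.swap) (simp add: sum_distrib_left)
  also have "\<dots> \<le> (\<Sum>j<p. \<bar>d j\<bar> * (3 * real n * lam))"
  proof (rule sum_mono)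
    fix j assume "j \<in> {..<p}"
    then have r: "\<bar>\<Sum>i<n. X i j * (\<Sum>l<p. X i l * d l)\<bar> \<le> 3 * real n * lam" using res by simp
    have "d j * (\<Sum>i<n. X i j * (\<Sum>l<p. X i l * d l)) \<le> \<bar>d j * (\<Sum>i<n. X i j * (\<Sum>l<p. X i l * d l))\<bar>"
      by (rule abs_ge_self)
    also have "\<dots> \<le> \<bar>d j\<bar> * (3 * real n * lam)"
      unfolding abs_mult by (rule mult_left_mono[OF r]) simp
    finally show "d j * (\<Sum>i<n. X i j * (\<Sum>l<p. X i l * d l)) \<le> \<bar>d j\<bar> * (3 * real n * lam)" .
  qed
  also have "\<dots> = s * (3 * real n * lam)" by (simp only: s_def sum_distrib_right)
  finally have "\<kappa> * real n * (\<Sum>j<p. (d j)\<^sup>2) \<le> s * (3 * real n * lam)" using re by linarith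
  then have "real n * (\<kappa> * (\<Sum>j<p. (d j)\<^sup>2)) \<le> real n * (3 * lam * s)" by (simp only: mult_ac)
  then have l2: "\<kappa> * (\<Sum>j<p. (d j)\<^sup>2) \<le> 3 * lam * s" using n by simp
  have "\<kappa> * s\<^sup>2 \<le> \<kappa> * (real m * (\<Sum>j<p. (d j)\<^sup>2))"
    using l1_le_l2_sparse[OF sparse] \<kappa> by (simp add: s_def)
  also have "\<dots> \<le> real m * (3 * lam * s)"
    using mult_left_mono[OF l2, of "real m"] by (simp add: mult_ac)
  finally have "s * (\<kappa> * s) \<le> s * (3 * real m * lam)" by (simp add: power2_eq_square mult_ac)
  then have "\<kappa> * s \<le> 3 * real m * lam"
    using s0 lam by (cases "s = 0") auto
  then show ?thesis using \<kappa> by (simp add: s_def[symmetric] field_simps)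
qed

lemma L2_set_linear_combination_le:
  "L2_set (\<lambda>i. \<Sum>j\<in>J. x i j * c j) I \<le> (\<Sum>j\<in>J. \<bar>c j\<bar> * L2_set (\<lambda>i. x i j) I)"
proof (induction J rule: infinite_finite_induct)
  case (insert a J)
  have "L2_set (\<lambda>i. \<Sum>j\<in>insert a J. x i j * c j) I = L2_set (\<lambda>i. c a * x i a + (\<Sum>j\<in>J. x i j * c j)) I"
    using insert by (simp add: mult.commute)
  also have "\<dots> \<le> L2_set (\<lambda>i. c a * x i a) I + L2_set (\<lambda>i. \<Sum>j\<in>J. x i j * c j) I"
    by (rule L2_set_triangle_ineq)
  also have "L2_set (\<lambda>i. c a * x i a) I = \<bar>c a\<bar> * L2_set (\<lambda>i. x i a) I"
    unfolding L2_set_def by (simp add: power_mult_distrib sum_distrib_left[symmetric] real_sqrt_mult)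
  finally show ?case using insert by simp
qed (simp_all add: L2_set_def)

text \<open>Rounding \<open>N d\<close> down to an integer vector moves \<open>d\<close> by at most \<open>m / N\<close> in \<open>\<ell>\<^sub>1\<close> and
  preserves the support. Bounded columns turn this into an error of at most
  \<open>(m / N) * sqrt (D n)\<close> for \<open>X d\<close>, at most half of the lower bound on the grid. The grid is so fine that
  the triangle inequality suffices; its size then costs only a factor \<open>m\<close> in each coordinate, that
  is, a logarithm in the exponent of the union bound.\<close>

lemma restricted_eigenvalue_unit:
  fixes X :: "nat \<Rightarrow> nat \<Rightarrow> real" and d :: "nat \<Rightarrow> real"
  assumes N: "0 < N" "2 * m \<le> N" and D: "0 \<le> D" and \<kappa>: "0 < \<kappa>" and DN: "4 * D * (real m)\<^sup>2 \<le> \<kappa> * (real N)\<^sup>2"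
    and col: "\<And>j. j < p \<Longrightarrow> (\<Sum>i<n. (X i j)\<^sup>2) \<le> D * real n"
    and grid: "\<And>z :: nat \<Rightarrow> int. (\<And>j. \<bar>z j\<bar> \<le> int N) \<Longrightarrow> card (nsupp p z) \<le> m \<Longrightarrow>
        (real N)\<^sup>2 / 4 \<le> (\<Sum>j<p. (real_of_int (z j))\<^sup>2) \<Longrightarrow>
        \<kappa> * real n * (real N)\<^sup>2 \<le> (\<Sum>i<n. (\<Sum>j<p. X i j * real_of_int (z j))\<^sup>2)"
    and sparse: "card (nsupp p d) \<le> m" and unit: "(\<Sum>j<p. (d j)\<^sup>2) = 1"
  shows "\<kappa> / 4 * real n \<le> (\<Sum>i<n. (\<Sum>j<p. X i j * d j)\<^sup>2)"
proof -
  define z where "z = (\<lambda>j. if j < p then \<lfloor>real N * d j\<rfloor> else 0)"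
  define v where "v = (\<lambda>j. real_of_int (z j) / real N)"
  define e where "e = (\<lambda>j. d j - v j)"
  have Np: "0 < real N" using N by simp
  have db: "\<bar>d j\<bar> \<le> 1" if "j < p" for j
  proof -
    have "(d j)\<^sup>2 \<le> (\<Sum>j<p. (d j)\<^sup>2)" by (rule member_le_sum) (use that in auto)
    then show ?thesis unfolding unit by (simp add: abs_square_le_1)
  qed
  have zb: "\<bar>z j\<bar> \<le> int N" for j
  proof (cases "j < p")
    case True
    have "\<bar>real N * d j\<bar> \<le> real N" using db[OF True] Np by (simp add: abs_mult)
    then have "- real N \<le> real N * d j" "real N * d j \<le> real N" by (simp_all add: abs_le_iff)
    then have "- int N \<le> \<lfloor>real N * d j\<rfloor>" "\<lfloor>real N * d j\<rfloor> \<le> int N"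
      by (simp_all add: le_floor_iff floor_le_iff)
    then show ?thesis using True by (simp add: z_def)
  qed (simp add: z_def)
  have zs: "nsupp p z \<subseteq> nsupp p d" by (auto simp: nsupp_def z_def)
  then have zc: "card (nsupp p z) \<le> m"
    using sparse card_mono[OF finite_nsupp zs] by simp
  have eb: "\<bar>e j\<bar> \<le> (if j \<in> nsupp p d then 1 / real N else 0)" if "j < p" for j
  proof (cases "d j = 0")
    case True then show ?thesis using that by (simp add: e_def v_def z_def nsupp_def)
  next
    case False
    have "real N * e j = real N * d j - \<lfloor>real N * d j\<rfloor>"
      using Np that by (simp add: e_def v_def z_def right_diff_distrib)
    then have "0 \<le> real N * e j" "real N * e j \<le> 1" by linarith+
    then have "0 \<le> e j" "e j \<le> 1 / real N" using Np by (simp_all add: zero_le_mult_iff field_simps)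
    then show ?thesis using False that by (simp add: nsupp_def)
  qed
  have e1: "(\<Sum>j<p. \<bar>e j\<bar>) \<le> real m / real N"
  proof -
    have "(\<Sum>j<p. \<bar>e j\<bar>) \<le> (\<Sum>j<p. if j \<in> nsupp p d then 1 / real N else 0)"
      by (rule sum_mono) (use eb in auto)
    also have "\<dots> = (\<Sum>j\<in>nsupp p d. 1 / real N)"
    proof -
      have "{..<p} \<inter> nsupp p d = nsupp p d" by (auto simp: nsupp_def)
      then show ?thesis using sum.inter_restrict[of "{..<p}" "\<lambda>_. 1 / real N" "nsupp p d"] by simp
    qed
    also have "\<dots> \<le> real m / real N" using sparse Np by (simp add: divide_right_mono)
    finally show ?thesis .
  qed
  have half: "real m / real N \<le> 1 / 2" using N by (simp add: field_simps)
  have "1 = L2_set (\<lambda>j. e j + v j) {..<p}" using unit by (simp add: L2_set_def e_def)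
  also have "\<dots> \<le> L2_set e {..<p} + L2_set v {..<p}" by (rule L2_set_triangle_ineq)
  also have "L2_set e {..<p} \<le> (\<Sum>j<p. \<bar>e j\<bar>)" by (rule L2_set_le_sum_abs)
  finally have vn: "1 / 2 \<le> L2_set v {..<p}" using e1 half by linarith
  have "(1 / 2)\<^sup>2 \<le> (L2_set v {..<p})\<^sup>2" by (rule power_mono[OF vn]) simp
  also have "\<dots> = (\<Sum>j<p. (v j)\<^sup>2)" by (simp add: L2_set_def sum_nonneg)
  also have "\<dots> = (\<Sum>j<p. (real_of_int (z j))\<^sup>2) / (real N)\<^sup>2"
    by (simp add: v_def power_divide sum_divide_distrib)
  finally have "(real N)\<^sup>2 / 4 \<le> (\<Sum>j<p. (real_of_int (z j))\<^sup>2)" using Np by (simp add: field_simps power2_eq_square)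
  from grid[OF zb zc this]
  have g: "\<kappa> * real n * (real N)\<^sup>2 \<le> (\<Sum>i<n. (\<Sum>j<p. X i j * real_of_int (z j))\<^sup>2)" .
  have "\<kappa> * real n \<le> (\<Sum>i<n. (\<Sum>j<p. X i j * v j)\<^sup>2)"
  proof -
    have "(\<Sum>i<n. (\<Sum>j<p. X i j * v j)\<^sup>2) = (\<Sum>i<n. (\<Sum>j<p. X i j * real_of_int (z j))\<^sup>2) / (real N)\<^sup>2"
      by (simp add: v_def power_divide sum_divide_distrib[symmetric])
    then show ?thesis using g Np by (simp add: pos_le_divide_eq)
  qed
  then have Xv: "sqrt (\<kappa> * real n) \<le> L2_set (\<lambda>i. \<Sum>j<p. X i j * v j) {..<n}"
    unfolding L2_set_def by (rule real_sqrt_le_mono)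
  have "L2_set (\<lambda>i. \<Sum>j<p. X i j * (- e j)) {..<n} \<le> (\<Sum>j<p. \<bar>- e j\<bar> * L2_set (\<lambda>i. X i j) {..<n})"
    by (rule L2_set_linear_combination_le)
  also have "\<dots> \<le> (\<Sum>j<p. \<bar>e j\<bar> * sqrt (D * real n))"
    by (rule sum_mono) (auto simp: L2_set_def intro!: mult_left_mono real_sqrt_le_mono col)
  also have "\<dots> \<le> real m / real N * sqrt (D * real n)"
    unfolding sum_distrib_right[symmetric] using D by (intro mult_right_mono e1) simp
  also have "\<dots> = sqrt (D * (real m)\<^sup>2 / (real N)\<^sup>2 * real n)"
    using Np D by (simp add: real_sqrt_mult real_sqrt_divide)
  also have "\<dots> \<le> sqrt (\<kappa> / 4 * real n)"
    using DN Np by (intro real_sqrt_le_mono mult_right_mono) (auto simp: field_simps)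
  finally have Xe: "L2_set (\<lambda>i. \<Sum>j<p. X i j * (- e j)) {..<n} \<le> sqrt (\<kappa> / 4 * real n)" .
  have s4: "sqrt (\<kappa> * real n) = 2 * sqrt (\<kappa> / 4 * real n)"
  proof -
    have "sqrt (\<kappa> * real n) = sqrt (2\<^sup>2 * (\<kappa> / 4 * real n))" by simp
    also have "\<dots> = 2 * sqrt (\<kappa> / 4 * real n)" by (simp only: real_sqrt_mult real_sqrt_abs)
    finally show ?thesis .
  qed
  have "L2_set (\<lambda>i. \<Sum>j<p. X i j * v j) {..<n} = L2_set (\<lambda>i. (\<Sum>j<p. X i j * d j) + (\<Sum>j<p. X i j * (- e j))) {..<n}"
    by (simp add: e_def sum.distrib[symmetric] algebra_simps)
  also have "\<dots> \<le> L2_set (\<lambda>i. \<Sum>j<p. X i j * d j) {..<n} + L2_set (\<lambda>i. \<Sum>j<p. X i j * (- e j)) {..<n}"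
    by (rule L2_set_triangle_ineq)
  finally have "sqrt (\<kappa> / 4 * real n) \<le> L2_set (\<lambda>i. \<Sum>j<p. X i j * d j) {..<n}"
    using Xv Xe s4 by linarith
  then show ?thesis unfolding L2_set_def by simp
qed

lemma restricted_eigenvalue:
  fixes X :: "nat \<Rightarrow> nat \<Rightarrow> real" and d :: "nat \<Rightarrow> real"
  assumes N: "0 < N" "2 * m \<le> N" and D: "0 \<le> D" and \<kappa>: "0 < \<kappa>" and DN: "4 * D * (real m)\<^sup>2 \<le> \<kappa> * (real N)\<^sup>2"
    and col: "\<And>j. j < p \<Longrightarrow> (\<Sum>i<n. (X i j)\<^sup>2) \<le> D * real n"
    and grid: "\<And>z :: nat \<Rightarrow> int. (\<And>j. \<bar>z j\<bar> \<le> int N) \<Longrightarrow> card (nsupp p z) \<le> m \<Longrightarrow>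
        (real N)\<^sup>2 / 4 \<le> (\<Sum>j<p. (real_of_int (z j))\<^sup>2) \<Longrightarrow>
        \<kappa> * real n * (real N)\<^sup>2 \<le> (\<Sum>i<n. (\<Sum>j<p. X i j * real_of_int (z j))\<^sup>2)"
    and sparse: "card (nsupp p d) \<le> m"
  shows "\<kappa> / 4 * real n * (\<Sum>j<p. (d j)\<^sup>2) \<le> (\<Sum>i<n. (\<Sum>j<p. X i j * d j)\<^sup>2)"
proof (cases "(\<Sum>j<p. (d j)\<^sup>2) = 0")
  case True then show ?thesis by (simp add: sum_nonneg)
next
  case False
  define s where "s = (\<Sum>j<p. (d j)\<^sup>2)"
  have s: "0 < s" using False sum_nonneg[of "{..<p}" "\<lambda>j. (d j)\<^sup>2"] unfolding s_def by auto
  have "nsupp p (\<lambda>j. d j / sqrt s) = nsupp p d" using s by (auto simp: nsupp_def)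
  moreover have "(\<Sum>j<p. (d j / sqrt s)\<^sup>2) = 1"
    using s by (simp add: power_divide sum_divide_distrib[symmetric] s_def[symmetric])
  ultimately have "\<kappa> / 4 * real n \<le> (\<Sum>i<n. (\<Sum>j<p. X i j * (d j / sqrt s))\<^sup>2)"
    using sparse by (intro restricted_eigenvalue_unit[OF N D \<kappa> DN col grid]) simp_all
  also have "\<dots> = (\<Sum>i<n. (\<Sum>j<p. X i j * d j)\<^sup>2) / s"
    using s by (simp add: power_divide sum_divide_distrib[symmetric])
  finally show ?thesis using s by (simp add: s_def[symmetric] field_simps)
qed

text \<open>Such a vector is described by a list of \<open>m\<close> pairs of an index and a value.\<close>

lemma sparse_integer_vectors_card:
  assumes p: "0 < p"
  shows "finite {z :: nat \<Rightarrow> int. (\<forall>j. \<bar>z j\<bar> \<le> int N) \<and> (\<forall>j\<ge>p. z j = 0) \<and> card (nsupp p z) \<le> m}" (is "finite ?Z")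
    and "card {z :: nat \<Rightarrow> int. (\<forall>j. \<bar>z j\<bar> \<le> int N) \<and> (\<forall>j\<ge>p. z j = 0) \<and> card (nsupp p z) \<le> m} \<le> (p * (2 * N + 1)) ^ m"
proof -
  define A where "A = {..<p} \<times> {- int N..int N}"
  define W where "W = {xs. set xs \<subseteq> A \<and> length xs = m}"
  define G where "G = (\<lambda>xs :: (nat \<times> int) list. \<lambda>j. case map_of xs j of None \<Rightarrow> 0 | Some v \<Rightarrow> v)"
  have "nat (2 * int N + 1) = 2 * N + 1" by linarith
  then have A: "finite A" "card A = p * (2 * N + 1)" by (simp_all add: A_def card_cartesian_product)
  have W: "finite W" "card W = (p * (2 * N + 1)) ^ m"
    unfolding W_def using finite_lists_length_eq[OF A(1)] card_lists_length_eq[OF A(1)] A(2) by simp_all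
  have sub: "?Z \<subseteq> G ` W"
  proof
    fix z assume "z \<in> ?Z"
    then have zb: "\<And>j. \<bar>z j\<bar> \<le> int N" and z0: "\<And>j. j \<ge> p \<Longrightarrow> z j = 0" and zc: "card (nsupp p z) \<le> m" by auto
    \<comment> \<open>the list of indices is padded with \<open>0\<close> to length \<open>m\<close>; it is paired with the actual value at \<open>0\<close>\<close>
    define ks where "ks = sorted_list_of_set (nsupp p z) @ replicate (m - card (nsupp p z)) 0"
    have ks: "nsupp p z \<subseteq> set ks" "set ks \<subseteq> {..<p}" "length ks = m"
      using p zc by (auto simp: ks_def nsupp_def)
    define xs where "xs = map (\<lambda>j. (j, z j)) ks"
    have "G xs = z"
    proof
      fix j
      have "z j = 0" if "j \<notin> set ks"
        using that ks(1) z0[of j] by (cases "j < p") (auto simp: nsupp_def)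
      then show "G xs j = z j"
        by (auto simp: G_def xs_def map_of_map_restrict restrict_map_def)
    qed
    moreover have "z j \<in> {- int N..int N}" for j using zb[of j] by (auto simp: abs_le_iff)
    then have "xs \<in> W" using ks by (auto simp: W_def xs_def A_def)
    ultimately show "z \<in> G ` W" by blast
  qed
  show "finite ?Z" using finite_subset[OF sub] W by simp
  show "card ?Z \<le> (p * (2 * N + 1)) ^ m"
    using surj_card_le[OF W(1) sub] W(2) by simp
qed

section \<open>Exponential tail bounds for one observation at a time\<close>

lemma mvnormal_coordinate:
  assumes wc: "well_conditioned M p \<Omega>" and M: "0 < M" and p: "0 < p" and j: "j < p"
  shows "\<exists>V. 0 \<le> V \<and> V \<le> M \<and>
    (\<forall>f :: real \<Rightarrow> ennreal. f \<in> borel_measurable borel \<longrightarrow>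
      (\<integral>\<^sup>+ x. f (x j) \<partial>mvnormal p \<Omega>) = (\<integral>\<^sup>+ g. f (sqrt V * g) \<partial>gauss 1))"
proof -
  let ?v = "\<lambda>l. if l = j then 1 else 0 :: real"
  have 1: "(\<Sum>l<p. (?v l)\<^sup>2) = 1"
  proof -
    have "(\<Sum>l<p. (?v l)\<^sup>2) = (\<Sum>l<p. ?v l)" by (rule sum.cong) auto
    then show ?thesis using j by simp
  qed
  have 2: "(\<Sum>l<p. ?v l * x l) = x j" for x :: "nat \<Rightarrow> real"
  proof -
    have "(\<Sum>l<p. ?v l * x l) = (\<Sum>l<p. if l = j then x l else 0)" by (rule sum.cong) auto
    then show ?thesis using j by simp
  qed
  obtain V where V: "(\<Sum>l<p. (?v l)\<^sup>2) / M \<le> V" "V \<le> M * (\<Sum>l<p. (?v l)\<^sup>2)"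
    "\<forall>f :: real \<Rightarrow> ennreal. f \<in> borel_measurable borel \<longrightarrow>
      (\<integral>\<^sup>+ x. f (\<Sum>l<p. ?v l * x l) \<partial>mvnormal p \<Omega>) = (\<integral>\<^sup>+ g. f (sqrt V * g) \<partial>gauss 1)"
    using mvnormal_linear_form[OF wc M p, of ?v] by (elim exE conjE) (rule that)
  have "0 < 1 / M" using M by simp
  then have "0 \<le> V" using V(1) unfolding 1 by linarith
  moreover have "V \<le> M" using V(2) unfolding 1 by simp
  ultimately show ?thesis using V(3) unfolding 2 by (intro exI[of _ V] conjI)
qed

lemma inverse_sqrt_one_minus_le_exp:
  fixes x :: real
  assumes "0 \<le> x" "x \<le> 1 / 2"
  shows "1 / sqrt (1 - x) \<le> exp x"
proof -
  have "1 \<le> (1 - x) * (1 + 2 * x)"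
    using mult_nonneg_nonneg[of x "1 - 2 * x"] assms by (simp add: algebra_simps)
  also have "\<dots> \<le> (1 - x) * exp (2 * x)"
    using assms by (intro mult_left_mono exp_ge_add_one_self) auto
  also have "\<dots> = (sqrt (1 - x) * exp x)\<^sup>2"
    using assms by (simp add: power_mult_distrib exp_double)
  finally have "1\<^sup>2 \<le> (sqrt (1 - x) * exp x)\<^sup>2" by simp
  then have "1 \<le> sqrt (1 - x) * exp x"
    by (rule power2_le_imp_le) (use assms in simp)
  then show ?thesis using assms by (simp add: divide_le_eq mult.commute)
qed

text \<open>Chi-square type moment generating function, used both for column norms and, after integrating out
  the noise, for the correlation of a column with the noise.\<close>

lemma mvnormal_exp_coordinate_square:
  assumes wc: "well_conditioned M p \<Omega>" and M: "0 < M" and p: "0 < p" and j: "j < p"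
    and t: "0 \<le> t" "2 * t * M \<le> 1 / 2"
  shows "(\<integral>\<^sup>+ x. ennreal (exp (t * (x j)\<^sup>2)) \<partial>mvnormal p \<Omega>) \<le> ennreal (exp (2 * t * M))"
proof -
  obtain V where V: "0 \<le> V" "V \<le> M"
    and int0: "\<forall>f :: real \<Rightarrow> ennreal. f \<in> borel_measurable borel \<longrightarrow>
      (\<integral>\<^sup>+ x. f (x j) \<partial>mvnormal p \<Omega>) = (\<integral>\<^sup>+ g. f (sqrt V * g) \<partial>gauss 1)"
    using mvnormal_coordinate[OF wc M p j] by (elim exE conjE) (rule that)
  note int = int0[rule_format]
  have tV: "0 \<le> 2 * t * V" "2 * t * V \<le> 2 * t * M" using t V by (simp_all add: mult_left_mono)
  have "(\<integral>\<^sup>+ x. ennreal (exp (t * (x j)\<^sup>2)) \<partial>mvnormal p \<Omega>) = (\<integral>\<^sup>+ g. ennreal (exp (t * (sqrt V * g)\<^sup>2)) \<partial>gauss 1)"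
    by (rule int[of "\<lambda>u. ennreal (exp (t * u\<^sup>2))"]) measurable
  also have "\<dots> = (\<integral>\<^sup>+ g. ennreal (exp (- (- t * V) * g\<^sup>2)) \<partial>gauss 1)"
    using V by (simp add: power_mult_distrib mult.assoc)
  also have "\<dots> = ennreal (1 / sqrt (1 + 2 * (- t * V)))"
    by (rule nn_integral_gauss_exp_square) (use tV t in linarith)
  also have "\<dots> \<le> ennreal (exp (2 * t * M))"
  proof (rule ennreal_leI)
    have "1 / sqrt (1 + 2 * (- t * V)) = 1 / sqrt (1 - 2 * t * V)" by simp
    also have "\<dots> \<le> exp (2 * t * V)"
      by (rule inverse_sqrt_one_minus_le_exp) (use tV t in linarith)+
    also have "\<dots> \<le> exp (2 * t * M)" using tV(2) by (simp only: exp_le_cancel_iff)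
    finally show "1 / sqrt (1 + 2 * (- t * V)) \<le> exp (2 * t * M)" .
  qed
  finally show ?thesis .
qed

text \<open>The Laplace transform of a squared normal variable with variance \<open>V\<close> is \<open>(1 + 2 t V) powr (- 1 / 2)\<close>. As \<open>V\<close> is
  bounded below, \<open>t = 6 M\<close> makes it at most \<open>1 / 2\<close>.\<close>

lemma mvnormal_small_ball_laplace:
  assumes wc: "well_conditioned M p \<Omega>" and M: "0 < M" and p: "0 < p"
    and v: "1 / 4 \<le> (\<Sum>j<p. (v j)\<^sup>2)"
  shows "(\<integral>\<^sup>+ x. ennreal (exp (- (6 * M) * (\<Sum>j<p. x j * v j)\<^sup>2)) \<partial>mvnormal p \<Omega>) \<le> ennreal (exp (- 1 / 2))"
proof -
  obtain V where V: "(\<Sum>j<p. (v j)\<^sup>2) / M \<le> V"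
    and int0: "\<forall>f :: real \<Rightarrow> ennreal. f \<in> borel_measurable borel \<longrightarrow>
      (\<integral>\<^sup>+ x. f (\<Sum>j<p. v j * x j) \<partial>mvnormal p \<Omega>) = (\<integral>\<^sup>+ g. f (sqrt V * g) \<partial>gauss 1)"
    using mvnormal_linear_form[OF wc M p, of v] by (elim exE conjE) (rule that)
  note int = int0[rule_format]
  have "(1 / 4) / M \<le> V" using V divide_right_mono[OF v, of M] M by linarith
  then have V4: "1 / 4 \<le> M * V" using M by (simp add: field_simps)
  have V0: "0 \<le> V"
    by (rule order_trans[OF _ \<open>(1 / 4) / M \<le> V\<close>]) (use M in simp)
  have "(\<integral>\<^sup>+ x. ennreal (exp (- (6 * M) * (\<Sum>j<p. x j * v j)\<^sup>2)) \<partial>mvnormal p \<Omega>)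
      = (\<integral>\<^sup>+ x. ennreal (exp (- (6 * M) * (\<Sum>j<p. v j * x j)\<^sup>2)) \<partial>mvnormal p \<Omega>)"
    by (simp add: mult.commute)
  also have "\<dots> = (\<integral>\<^sup>+ g. ennreal (exp (- (6 * M) * (sqrt V * g)\<^sup>2)) \<partial>gauss 1)"
    by (rule int[of "\<lambda>u. ennreal (exp (- (6 * M) * u\<^sup>2))"]) measurable
  also have "\<dots> = (\<integral>\<^sup>+ g. ennreal (exp (- (6 * M * V) * g\<^sup>2)) \<partial>gauss 1)"
    using V0 by (simp add: power_mult_distrib mult.assoc)
  also have "\<dots> = ennreal (1 / sqrt (1 + 2 * (6 * M * V)))"
    by (rule nn_integral_gauss_exp_square) (use V4 in linarith)
  also have "\<dots> \<le> ennreal (exp (- 1 / 2))"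
  proof (rule ennreal_leI)
    have "sqrt (2\<^sup>2) \<le> sqrt (1 + 2 * (6 * M * V))"
      by (rule real_sqrt_le_mono) (use V4 in simp)
    then have "2 \<le> sqrt (1 + 2 * (6 * M * V))" by simp
    then have "1 / sqrt (1 + 2 * (6 * M * V)) \<le> 1 / 2"
      by (intro divide_left_mono mult_pos_pos) linarith+
    also have "\<dots> \<le> exp (- 1 / 2 :: real)" using exp_ge_add_one_self[of "- 1 / 2 :: real"] by simp
    finally show "1 / sqrt (1 + 2 * (6 * M * V)) \<le> exp (- 1 / 2)" .
  qed
  finally show ?thesis .
qed

lemma obs_law_chernoff:
  assumes mv: "prob_space (mvnormal p \<Omega>)" and s: "0 < \<sigma>"
    and g: "g \<in> borel_measurable (single_space p)"
    and mgf: "(\<integral>\<^sup>+ z. ennreal (exp (g z)) \<partial>single_law p \<beta> \<Omega> \<sigma>) \<le> ennreal (exp c)"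
  shows "emeasure (obs_law n p (\<beta>, \<Omega>, \<sigma>)) {z \<in> space (obs_space n p). a \<le> (\<Sum>i<n. g (z i))} \<le> ennreal (exp (real n * c - a))"
proof -
  let ?K = "single_law p \<beta> \<Omega> \<sigma>"
  have g': "g \<in> borel_measurable ?K" using g by (simp cong: measurable_cong_sets)
  have sp: "space (obs_space n p) = space (Pi\<^sub>M {..<n} (\<lambda>_. ?K))"
    unfolding obs_law_eq_PiM[OF mv s, symmetric] by simp
  have "emeasure (obs_law n p (\<beta>, \<Omega>, \<sigma>)) {z \<in> space (obs_space n p). a \<le> (\<Sum>i<n. g (z i))}
      \<le> ennreal (exp (- a)) * (\<integral>\<^sup>+ z. ennreal (exp (g z)) \<partial>?K) ^ n"
    unfolding sp obs_law_eq_PiM[OF mv s] by (rule PiM_chernoff[OF prob_space_single_law[OF mv s] g'])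
  also have "\<dots> \<le> ennreal (exp (- a)) * ennreal (exp c) ^ n"
    by (intro mult_left_mono power_mono mgf) simp_all
  also have "\<dots> = ennreal (exp (- a) * exp (real n * c))"
    by (simp add: ennreal_power ennreal_mult exp_of_nat_mult)
  also have "exp (- a) * exp (real n * c) = exp (real n * c - a)"
    by (simp add: exp_add[symmetric])
  finally show ?thesis .
qed

lemma measurable_single_coordinate:
  assumes "j < p"
  shows "(\<lambda>z. snd z j) \<in> borel_measurable (single_space p)"
  by (rule measurable_compose[OF measurable_snd measurable_component_nat[OF assms]])

lemma measurable_single_linear_form:
  "(\<lambda>z. \<Sum>j<p. snd z j * b j) \<in> borel_measurable (single_space p)"
  by (rule measurable_compose[OF measurable_snd measurable_linear_form])

lemma nn_integral_single_law_design:
  assumes s: "0 < \<sigma>" and f: "(\<lambda>z. f (snd z)) \<in> borel_measurable (single_space p)"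
  shows "(\<integral>\<^sup>+ z. f (snd z) \<partial>single_law p \<beta> \<Omega> \<sigma>) = (\<integral>\<^sup>+ x. f x \<partial>mvnormal p \<Omega>)"
proof -
  interpret B: prob_space "gauss \<sigma>" by (rule prob_space_normal_density[OF s])
  show ?thesis
    using B.emeasure_space_1 by (subst nn_integral_single_law[OF s f]) simp
qed

lemma column_norm_tail:
  assumes wc: "well_conditioned M p \<Omega>" and M: "0 < M" and p: "0 < p" and j: "j < p" and s: "0 < \<sigma>"
  shows "emeasure (obs_law n p (\<beta>, \<Omega>, \<sigma>)) {z \<in> space (obs_space n p). 8 * M * real n \<le> (\<Sum>i<n. (snd (z i) j)\<^sup>2)} \<le> ennreal (exp (- real n))"
proof -
  define g where "g = (\<lambda>z :: real \<times> (nat \<Rightarrow> real). 1 / (4 * M) * (snd z j)\<^sup>2)"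
  have g: "g \<in> borel_measurable (single_space p)"
    unfolding g_def by (intro borel_measurable_times borel_measurable_const borel_measurable_power measurable_single_coordinate j)
  have "(\<integral>\<^sup>+ z. ennreal (exp (g z)) \<partial>single_law p \<beta> \<Omega> \<sigma>) = (\<integral>\<^sup>+ x. ennreal (exp (1 / (4 * M) * (x j)\<^sup>2)) \<partial>mvnormal p \<Omega>)"
    unfolding g_def by (rule nn_integral_single_law_design[OF s])
      (use measurable_compose[OF g[unfolded g_def] measurable_compose[OF borel_measurable_exp measurable_ennreal]] in simp)
  also have "\<dots> \<le> ennreal (exp (2 * (1 / (4 * M)) * M))"
    by (rule mvnormal_exp_coordinate_square[OF wc M p j]) (use M in auto)
  also have "\<dots> \<le> ennreal (exp 1)" using M by (intro ennreal_leI) simp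
  finally have "emeasure (obs_law n p (\<beta>, \<Omega>, \<sigma>)) {z \<in> space (obs_space n p). 2 * real n \<le> (\<Sum>i<n. g (z i))} \<le> ennreal (exp (real n * 1 - 2 * real n))"
    by (rule obs_law_chernoff[OF prob_space_mvnormal[OF wc M p] s g])
  moreover have "2 * real n \<le> (\<Sum>i<n. g (z i)) \<longleftrightarrow> 8 * M * real n \<le> (\<Sum>i<n. (snd (z i) j)\<^sup>2)" for z
    using M unfolding g_def sum_distrib_left[symmetric] by (simp add: field_simps)
  ultimately show ?thesis by simp
qed

lemma small_ball_tail:
  assumes wc: "well_conditioned M p \<Omega>" and M: "0 < M" and p: "0 < p" and s: "0 < \<sigma>"
    and v: "1 / 4 \<le> (\<Sum>j<p. (v j)\<^sup>2)"
  shows "emeasure (obs_law n p (\<beta>, \<Omega>, \<sigma>)) {z \<in> space (obs_space n p). (\<Sum>i<n. (\<Sum>j<p. snd (z i) j * v j)\<^sup>2) \<le> 1 / (24 * M) * real n} \<le> ennreal (exp (- real n / 4))"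
proof -
  define g where "g = (\<lambda>z :: real \<times> (nat \<Rightarrow> real). - (6 * M) * (\<Sum>j<p. snd z j * v j)\<^sup>2)"
  have g: "g \<in> borel_measurable (single_space p)"
    unfolding g_def by (intro borel_measurable_times borel_measurable_const borel_measurable_power measurable_single_linear_form)
  have "(\<integral>\<^sup>+ z. ennreal (exp (g z)) \<partial>single_law p \<beta> \<Omega> \<sigma>) = (\<integral>\<^sup>+ x. ennreal (exp (- (6 * M) * (\<Sum>j<p. x j * v j)\<^sup>2)) \<partial>mvnormal p \<Omega>)"
    unfolding g_def by (rule nn_integral_single_law_design[OF s])
      (use measurable_compose[OF g[unfolded g_def] measurable_compose[OF borel_measurable_exp measurable_ennreal]] in simp)
  also have "\<dots> \<le> ennreal (exp (- 1 / 2))"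
    by (rule mvnormal_small_ball_laplace[OF wc M p v])
  finally have "emeasure (obs_law n p (\<beta>, \<Omega>, \<sigma>)) {z \<in> space (obs_space n p). - real n / 4 \<le> (\<Sum>i<n. g (z i))} \<le> ennreal (exp (real n * (- 1 / 2) - (- real n / 4)))"
    by (rule obs_law_chernoff[OF prob_space_mvnormal[OF wc M p] s g])
  moreover have "- real n / 4 \<le> (\<Sum>i<n. g (z i)) \<longleftrightarrow> (\<Sum>i<n. (\<Sum>j<p. snd (z i) j * v j)\<^sup>2) \<le> 1 / (24 * M) * real n" for z
    using M unfolding g_def sum_distrib_left[symmetric] by (simp add: field_simps)
  ultimately show ?thesis by simp
qed

text \<open>Given the design, the noise contributes \<open>exp (t\<^sup>2 \<sigma>\<^sup>2 x\<^sub>j\<^sup>2 / 2)\<close> to the moment generating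
  function of one summand. With \<open>t\<close> of either sign this controls both tails.\<close>

lemma noise_correlation_tail:
  assumes wc: "well_conditioned M p \<Omega>" and M: "0 < M" and p: "0 < p" and j: "j < p" and s: "0 < \<sigma>"
    and t: "t\<^sup>2 * \<sigma>\<^sup>2 * M \<le> 1 / 2"
  shows "emeasure (obs_law n p (\<beta>, \<Omega>, \<sigma>)) {z \<in> space (obs_space n p).
      a \<le> t * (\<Sum>i<n. snd (z i) j * (fst (z i) - (\<Sum>l<p. snd (z i) l * vec_index \<beta> l)))} \<le> ennreal (exp (real n * (t\<^sup>2 * \<sigma>\<^sup>2 * M) - a))"
proof -
  define g where "g = (\<lambda>z :: real \<times> (nat \<Rightarrow> real). t * (snd z j * (fst z - (\<Sum>l<p. snd z l * vec_index \<beta> l))))"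
  have g: "g \<in> borel_measurable (single_space p)"
    unfolding g_def by (intro borel_measurable_times borel_measurable_const borel_measurable_diff measurable_fst measurable_single_coordinate measurable_single_linear_form j)
  have eg: "(\<lambda>z. ennreal (exp (g z))) \<in> borel_measurable (single_space p)"
    by (rule measurable_compose[OF g measurable_compose[OF borel_measurable_exp measurable_ennreal]])
  have "(\<integral>\<^sup>+ z. ennreal (exp (g z)) \<partial>single_law p \<beta> \<Omega> \<sigma>) = (\<integral>\<^sup>+ x. \<integral>\<^sup>+ e. ennreal (exp ((t * x j) * e)) \<partial>gauss \<sigma> \<partial>mvnormal p \<Omega>)"
    by (subst nn_integral_single_law[OF s eg]) (simp add: g_def mult.assoc)
  also have "\<dots> = (\<integral>\<^sup>+ x. ennreal (exp ((t\<^sup>2 * \<sigma>\<^sup>2 / 2) * (x j)\<^sup>2)) \<partial>mvnormal p \<Omega>)"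
    unfolding nn_integral_gauss_exp[OF s] by (simp add: power_mult_distrib mult_ac)
  also have "\<dots> \<le> ennreal (exp (2 * (t\<^sup>2 * \<sigma>\<^sup>2 / 2) * M))"
    by (rule mvnormal_exp_coordinate_square[OF wc M p j]) (use t in simp_all)
  finally have "emeasure (obs_law n p (\<beta>, \<Omega>, \<sigma>)) {z \<in> space (obs_space n p). a \<le> (\<Sum>i<n. g (z i))} \<le> ennreal (exp (real n * (2 * (t\<^sup>2 * \<sigma>\<^sup>2 / 2) * M) - a))"
    by (rule obs_law_chernoff[OF prob_space_mvnormal[OF wc M p] s g])
  then show ?thesis unfolding g_def sum_distrib_left[symmetric] by simp
qed

section \<open>Upper bound: an interval of fixed length around a Dantzig-type estimator\<close>

definition residual_correlation :: "nat \<Rightarrow> nat \<Rightarrow> obs \<Rightarrow> (nat \<Rightarrow> real) \<Rightarrow> nat \<Rightarrow> real" where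
  "residual_correlation n p z b j = (\<Sum>i<n. snd (z i) j * (fst (z i) - (\<Sum>l<p. snd (z i) l * b l)))"

text \<open>Bounded column norms, and a lower bound for the design on sparse integer vectors of length at
  least \<open>N / 2\<close> with entries of size at most \<open>N\<close>, that is, after division by \<open>N\<close>, on the points of a grid of
  mesh \<open>1 / N\<close> outside the ball of radius \<open>1 / 2\<close>.\<close>

definition good_design :: "real \<Rightarrow> nat \<Rightarrow> nat \<Rightarrow> nat \<Rightarrow> nat \<Rightarrow> obs \<Rightarrow> bool" where
  "good_design M n p m N z \<longleftrightarrow> (\<forall>j<p. (\<Sum>i<n. (snd (z i) j)\<^sup>2) \<le> 8 * M * real n) \<and>
     (\<forall>w :: nat \<Rightarrow> int. (\<forall>j. \<bar>w j\<bar> \<le> int N) \<longrightarrow> card (nsupp p w) \<le> m \<longrightarrow> (real N)\<^sup>2 / 4 \<le> (\<Sum>j<p. (real_of_int (w j))\<^sup>2) \<longrightarrow>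
        1 / (24 * M) * real n * (real N)\<^sup>2 \<le> (\<Sum>i<n. (\<Sum>j<p. snd (z i) j * real_of_int (w j))\<^sup>2))"

lemma measurable_obs_component:
  "i < n \<Longrightarrow> (\<lambda>z. z i) \<in> measurable (obs_space n p) (single_space p)"
  unfolding obs_space_def by (rule measurable_component_nat)

lemma measurable_obs_sum:
  fixes g :: "real \<times> (nat \<Rightarrow> real) \<Rightarrow> real"
  assumes "g \<in> borel_measurable (single_space p)"
  shows "(\<lambda>z. \<Sum>i<n. g (z i)) \<in> borel_measurable (obs_space n p)"
  by (rule borel_measurable_sum, rule measurable_compose[OF measurable_obs_component assms]) simp

lemma measurable_residual_correlation:
  assumes "j < p"
  shows "(\<lambda>z. residual_correlation n p z b j) \<in> borel_measurable (obs_space n p)"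
  unfolding residual_correlation_def
  by (rule measurable_obs_sum) (intro borel_measurable_times borel_measurable_diff measurable_fst
      measurable_single_coordinate measurable_single_linear_form assms)

text \<open>Union bound over the \<open>p\<close> columns and both signs of the correlation with the noise, and over the
  grid. The threshold \<open>lam\<close> is such that each correlation event has probability at most \<open>1 / p\<^sup>2\<close>.\<close>

lemma bad_event_bound:
  fixes M \<sigma> M2 lam :: real
  assumes wc: "well_conditioned M p \<Omega>" and M: "0 < M" and p: "2 \<le> p" and n: "0 < n"
    and s: "0 < \<sigma>" "\<sigma> \<le> M2" and N: "0 < N"
    and small: "ln (real p) * M2\<^sup>2 * M \<le> real n / 2"
    and lam: "lam = (M2\<^sup>2 * M + 2) * sqrt (ln (real p) / real n)"
  shows "\<exists>B \<in> sets (obs_space n p). emeasure (obs_law n p (\<beta>, \<Omega>, \<sigma>)) B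
      \<le> ennreal (2 / real p + real p * exp (- real n) + (real p * (2 * real N + 1)) ^ m * exp (- real n / 4)) \<and>
    (\<forall>z \<in> space (obs_space n p) - B. good_design M n p m N z \<and> (\<forall>j<p. \<bar>residual_correlation n p z (vec_index \<beta>) j\<bar> \<le> real n * lam))"
proof -
  have p0: "0 < p" using p by simp
  let ?P = "obs_law n p (\<beta>, \<Omega>, \<sigma>)" and ?S = "space (obs_space n p)"
  define t where "t = sqrt (ln (real p) / real n)"
  have lp: "0 < ln (real p)" using p by (simp add: ln_gt_zero)
  have t: "0 < t" unfolding t_def using lp n by simp
  have t2: "t\<^sup>2 = ln (real p) / real n" unfolding t_def using lp n by simp
  define Z where "Z = {w :: nat \<Rightarrow> int. (\<forall>j. \<bar>w j\<bar> \<le> int N) \<and> (\<forall>j\<ge>p. w j = 0) \<and> card (nsupp p w) \<le> m}"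
  define Z' where "Z' = {w \<in> Z. (real N)\<^sup>2 / 4 \<le> (\<Sum>j<p. (real_of_int (w j))\<^sup>2)}"
  have Zf: "finite Z" and Zc: "card Z \<le> (p * (2 * N + 1)) ^ m"
    unfolding Z_def by (rule sparse_integer_vectors_card[OF p0])+
  have Z'f: "finite Z'" and Z'c: "card Z' \<le> (p * (2 * N + 1)) ^ m"
    using Zf Zc card_mono[OF Zf, of Z'] by (auto simp: Z'_def)
  define R where "R = (\<lambda>\<epsilon> j. {z \<in> ?S. real n * lam * t \<le> (\<epsilon> * t) * residual_correlation n p z (vec_index \<beta>) j})"
  define C where "C = (\<lambda>j. {z \<in> ?S. 8 * M * real n \<le> (\<Sum>i<n. (snd (z i) j)\<^sup>2)})"
  define Q where "Q = (\<lambda>w :: nat \<Rightarrow> int. {z \<in> ?S. (\<Sum>i<n. (\<Sum>j<p. snd (z i) j * (real_of_int (w j) / real N))\<^sup>2) \<le> 1 / (24 * M) * real n})"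
  have Rm: "R \<epsilon> j \<in> sets ?P" if "j < p" for \<epsilon> j
  proof -
    note [measurable] = measurable_residual_correlation[OF that, of n "vec_index \<beta>"]
    show ?thesis unfolding R_def sets_obs_law by measurable
  qed
  have Cm: "C j \<in> sets ?P" if "j < p" for j
  proof -
    have [measurable]: "(\<lambda>z. \<Sum>i<n. (snd (z i) j)\<^sup>2) \<in> borel_measurable (obs_space n p)"
      by (rule measurable_obs_sum) (intro borel_measurable_power measurable_single_coordinate that)
    show ?thesis unfolding C_def sets_obs_law by measurable
  qed
  have Qm: "Q w \<in> sets ?P" for w
  proof -
    have [measurable]: "(\<lambda>z. \<Sum>i<n. (\<Sum>j<p. snd (z i) j * (real_of_int (w j) / real N))\<^sup>2) \<in> borel_measurable (obs_space n p)"
      by (rule measurable_obs_sum) (intro borel_measurable_power measurable_single_linear_form)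
    show ?thesis unfolding Q_def sets_obs_law by measurable
  qed
  have Rb: "emeasure ?P (R \<epsilon> j) \<le> ennreal (1 / (real p)\<^sup>2)" if j: "j < p" and \<epsilon>: "\<epsilon>\<^sup>2 = 1" for \<epsilon> j
  proof -
    have s2: "\<sigma>\<^sup>2 \<le> M2\<^sup>2" using s by (intro power_mono) auto
    have et: "(\<epsilon> * t)\<^sup>2 = ln (real p) / real n" using \<epsilon> t2 by (simp add: power_mult_distrib)
    have le: "ln (real p) * \<sigma>\<^sup>2 * M \<le> ln (real p) * M2\<^sup>2 * M"
      using s2 lp M by (intro mult_right_mono mult_left_mono) auto
    have a: "(\<epsilon> * t)\<^sup>2 * \<sigma>\<^sup>2 * M = ln (real p) * \<sigma>\<^sup>2 * M / real n" unfolding et by simp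
    have "emeasure ?P (R \<epsilon> j) \<le> ennreal (exp (real n * ((\<epsilon> * t)\<^sup>2 * \<sigma>\<^sup>2 * M) - real n * lam * t))"
      unfolding R_def residual_correlation_def
    proof (rule noise_correlation_tail[OF wc M p0 j s(1)])
      have "ln (real p) * \<sigma>\<^sup>2 * M \<le> real n / 2" using le small by linarith
      then show "(\<epsilon> * t)\<^sup>2 * \<sigma>\<^sup>2 * M \<le> 1 / 2" unfolding a using n by (simp add: field_simps)
    qed
    also have "\<dots> \<le> ennreal (exp (- 2 * ln (real p)))"
    proof (rule ennreal_leI, subst exp_le_cancel_iff)
      have "real n * lam * t = (M2\<^sup>2 * M + 2) * (real n * t\<^sup>2)" unfolding lam t_def[symmetric] by (simp add: power2_eq_square)
      also have "real n * t\<^sup>2 = ln (real p)" unfolding t2 using n by simp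
      finally have "real n * lam * t = (M2\<^sup>2 * M + 2) * ln (real p)" .
      note e1 = this
      have e2: "real n * ((\<epsilon> * t)\<^sup>2 * \<sigma>\<^sup>2 * M) = ln (real p) * \<sigma>\<^sup>2 * M" unfolding a using n by simp
      show "real n * ((\<epsilon> * t)\<^sup>2 * \<sigma>\<^sup>2 * M) - real n * lam * t \<le> - 2 * ln (real p)"
        unfolding e1 e2 using le by (simp add: algebra_simps)
    qed
    also have "exp (- 2 * ln (real p)) = 1 / (real p)\<^sup>2"
    proof -
      have "exp (2 * ln (real p)) = (real p)\<^sup>2" using p0 by (simp add: exp_double)
      then show ?thesis by (simp add: exp_minus inverse_eq_divide)
    qed
    finally show ?thesis .
  qed
  have Cb: "emeasure ?P (C j) \<le> ennreal (exp (- real n))" if "j < p" for j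
    unfolding C_def by (rule column_norm_tail[OF wc M p0 that s(1)])
  have Qb: "emeasure ?P (Q w) \<le> ennreal (exp (- real n / 4))" if "w \<in> Z'" for w
    unfolding Q_def
  proof (rule small_ball_tail[OF wc M p0 s(1)])
    have eq: "(\<Sum>j<p. (real_of_int (w j) / real N)\<^sup>2) = (\<Sum>j<p. (real_of_int (w j))\<^sup>2) / (real N)\<^sup>2"
      by (simp add: power_divide sum_divide_distrib)
    show "1 / 4 \<le> (\<Sum>j<p. (real_of_int (w j) / real N)\<^sup>2)"
      unfolding eq using that N by (simp add: Z'_def pos_le_divide_eq)
  qed
  define B1 where "B1 = (\<Union>j<p. R 1 j)"
  define B2 where "B2 = (\<Union>j<p. R (- 1) j)"
  define B3 where "B3 = (\<Union>j<p. C j)"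
  define B4 where "B4 = (\<Union>w\<in>Z'. Q w)"
  have B1m: "B1 \<in> sets ?P" unfolding B1_def by (intro sets.finite_UN Rm) auto
  have B2m: "B2 \<in> sets ?P" unfolding B2_def by (intro sets.finite_UN Rm) auto
  have B3m: "B3 \<in> sets ?P" unfolding B3_def by (intro sets.finite_UN Cm) auto
  have B4m: "B4 \<in> sets ?P" unfolding B4_def by (intro sets.finite_UN Qm Z'f)
  have pp: "(\<Sum>j<p. ennreal (1 / (real p)\<^sup>2)) = ennreal (1 / real p)"
    using p0 by (simp add: ennreal_of_nat_eq_real_of_nat ennreal_mult'[symmetric] power2_eq_square)
  have B1b: "emeasure ?P B1 \<le> ennreal (1 / real p)"
  proof -
    have "emeasure ?P B1 \<le> (\<Sum>j<p. emeasure ?P (R 1 j))"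
      unfolding B1_def by (rule emeasure_subadditive_finite) (use Rm in auto)
    also have "\<dots> \<le> (\<Sum>j<p. ennreal (1 / (real p)\<^sup>2))" by (rule sum_mono) (simp add: Rb)
    finally show ?thesis unfolding pp .
  qed
  have B2b: "emeasure ?P B2 \<le> ennreal (1 / real p)"
  proof -
    have "emeasure ?P B2 \<le> (\<Sum>j<p. emeasure ?P (R (- 1) j))"
      unfolding B2_def by (rule emeasure_subadditive_finite) (use Rm in auto)
    also have "\<dots> \<le> (\<Sum>j<p. ennreal (1 / (real p)\<^sup>2))" by (rule sum_mono) (simp add: Rb)
    finally show ?thesis unfolding pp .
  qed
  have B3b: "emeasure ?P B3 \<le> ennreal (real p * exp (- real n))"
  proof -
    have "emeasure ?P B3 \<le> (\<Sum>j<p. emeasure ?P (C j))"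
      unfolding B3_def by (rule emeasure_subadditive_finite) (use Cm in auto)
    also have "\<dots> \<le> (\<Sum>j<p. ennreal (exp (- real n)))" by (rule sum_mono) (simp add: Cb)
    also have "\<dots> = ennreal (real p * exp (- real n))" by (simp add: ennreal_of_nat_eq_real_of_nat ennreal_mult')
    finally show ?thesis .
  qed
  have B4b: "emeasure ?P B4 \<le> ennreal ((real p * (2 * real N + 1)) ^ m * exp (- real n / 4))"
  proof -
    have "emeasure ?P B4 \<le> (\<Sum>w\<in>Z'. emeasure ?P (Q w))"
      unfolding B4_def by (rule emeasure_subadditive_finite) (use Qm Z'f in auto)
    also have "\<dots> \<le> (\<Sum>w\<in>Z'. ennreal (exp (- real n / 4)))" by (rule sum_mono) (rule Qb)
    also have "\<dots> = ennreal (real (card Z') * exp (- real n / 4))" by (simp add: ennreal_of_nat_eq_real_of_nat ennreal_mult')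
    also have "\<dots> \<le> ennreal (real ((p * (2 * N + 1)) ^ m) * exp (- real n / 4))"
      using Z'c by (intro ennreal_leI mult_right_mono) (simp_all only: of_nat_le_iff exp_ge_zero)
    also have "real ((p * (2 * N + 1)) ^ m) = (real p * (2 * real N + 1)) ^ m"
      by (simp only: of_nat_power of_nat_mult of_nat_add of_nat_numeral of_nat_1)
    finally show ?thesis .
  qed
  show ?thesis
  proof (intro bexI[of _ "B1 \<union> B2 \<union> (B3 \<union> B4)"] conjI ballI)
    show "B1 \<union> B2 \<union> (B3 \<union> B4) \<in> sets (obs_space n p)"
      using B1m B2m B3m B4m by simp
    have "emeasure ?P (B1 \<union> B2 \<union> (B3 \<union> B4)) \<le> emeasure ?P (B1 \<union> B2) + emeasure ?P (B3 \<union> B4)"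
      by (intro emeasure_subadditive sets.Un B1m B2m B3m B4m)
    also have "\<dots> \<le> (emeasure ?P B1 + emeasure ?P B2) + (emeasure ?P B3 + emeasure ?P B4)"
      by (intro add_mono emeasure_subadditive B1m B2m B3m B4m)
    also have "\<dots> \<le> (ennreal (1 / real p) + ennreal (1 / real p)) + (ennreal (real p * exp (- real n)) + ennreal ((real p * (2 * real N + 1)) ^ m * exp (- real n / 4)))"
      by (intro add_mono B1b B2b B3b B4b)
    also have "\<dots> = ennreal ((1 / real p + 1 / real p) + (real p * exp (- real n) + (real p * (2 * real N + 1)) ^ m * exp (- real n / 4)))"
      by (simp only: ennreal_plus[symmetric] add_nonneg_nonneg mult_nonneg_nonneg zero_le_power divide_nonneg_nonneg of_nat_0_le_iff exp_ge_zero zero_le_one zero_le_numeral)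
    also have "(1 / real p + 1 / real p) + (real p * exp (- real n) + (real p * (2 * real N + 1)) ^ m * exp (- real n / 4))
        = 2 / real p + real p * exp (- real n) + (real p * (2 * real N + 1)) ^ m * exp (- real n / 4)" by simp
    finally show "emeasure ?P (B1 \<union> B2 \<union> (B3 \<union> B4)) \<le> ennreal (2 / real p + real p * exp (- real n) + (real p * (2 * real N + 1)) ^ m * exp (- real n / 4))" .
  next
    fix z assume z: "z \<in> ?S - (B1 \<union> B2 \<union> (B3 \<union> B4))"
    have notin: "z \<notin> R 1 j" "z \<notin> R (- 1) j" "z \<notin> C j" if "j < p" for j
      using z that by (auto simp: B1_def B2_def B3_def)
    show "good_design M n p m N z"
      unfolding good_design_def
    proof (intro conjI allI impI)
      fix j assume "j < p"
      then show "(\<Sum>i<n. (snd (z i) j)\<^sup>2) \<le> 8 * M * real n" using notin(3)[of j] z by (simp add: C_def)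
    next
      fix w :: "nat \<Rightarrow> int"
      assume w: "\<forall>j. \<bar>w j\<bar> \<le> int N" "card (nsupp p w) \<le> m" "(real N)\<^sup>2 / 4 \<le> (\<Sum>j<p. (real_of_int (w j))\<^sup>2)"
      define w' where "w' = (\<lambda>j. if j < p then w j else 0)"
      have "nsupp p w' = nsupp p w" by (auto simp: nsupp_def w'_def)
      moreover have "(\<Sum>j<p. (real_of_int (w' j))\<^sup>2) = (\<Sum>j<p. (real_of_int (w j))\<^sup>2)"
        by (rule sum.cong) (auto simp: w'_def)
      ultimately have "w' \<in> Z'" using w by (simp add: Z'_def Z_def) (simp add: w'_def)
      then have "z \<notin> Q w'" using z by (auto simp: B4_def)
      then have "1 / (24 * M) * real n < (\<Sum>i<n. (\<Sum>j<p. snd (z i) j * (real_of_int (w' j) / real N))\<^sup>2)"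
        using z by (simp add: Q_def)
      also have "\<dots> = (\<Sum>i<n. (\<Sum>j<p. snd (z i) j * real_of_int (w j))\<^sup>2) / (real N)\<^sup>2"
      proof -
        have eq: "(\<Sum>j<p. snd (z i) j * (real_of_int (w' j) / real N)) = (\<Sum>j<p. snd (z i) j * real_of_int (w j)) / real N" for i
          unfolding sum_divide_distrib by (rule sum.cong) (auto simp: w'_def)
        show ?thesis
          unfolding eq power_divide by (rule sum_divide_distrib[symmetric])
      qed
      finally show "1 / (24 * M) * real n * (real N)\<^sup>2 \<le> (\<Sum>i<n. (\<Sum>j<p. snd (z i) j * real_of_int (w j))\<^sup>2)"
        using N by (simp add: pos_less_divide_eq)
    qed
  next
    fix z assume z: "z \<in> ?S - (B1 \<union> B2 \<union> (B3 \<union> B4))"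
    show "\<forall>j<p. \<bar>residual_correlation n p z (vec_index \<beta>) j\<bar> \<le> real n * lam"
    proof (intro allI impI)
      fix j assume j: "j < p"
      have "z \<notin> R 1 j" "z \<notin> R (- 1) j" using z j by (auto simp: B1_def B2_def)
      then have "t * residual_correlation n p z (vec_index \<beta>) j < t * (real n * lam)"
        "t * (- residual_correlation n p z (vec_index \<beta>) j) < t * (real n * lam)"
        using z by (simp_all add: R_def mult_ac)
      then have "residual_correlation n p z (vec_index \<beta>) j < real n * lam" "- residual_correlation n p z (vec_index \<beta>) j < real n * lam"
        using t by (simp_all only: mult_less_cancel_left_pos)
      then show "\<bar>residual_correlation n p z (vec_index \<beta>) j\<bar> \<le> real n * lam" by linarith
    qed
  qed
qed

text \<open>The constraint of the Dantzig selector, with sparsity as a hard constraint. The threshold is twice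
  the one that the true coefficients satisfy, which leaves room to approximate them by rational vectors.\<close>

definition feasible :: "nat \<Rightarrow> nat \<Rightarrow> nat \<Rightarrow> real \<Rightarrow> obs \<Rightarrow> (nat \<Rightarrow> real) \<Rightarrow> bool" where
  "feasible n p k lam z b \<longleftrightarrow> card (nsupp p b) \<le> k \<and> (\<forall>j<p. \<bar>residual_correlation n p z b j\<bar> \<le> 2 * real n * lam)"

lemma feasible_l1_close:
  assumes M: "0 < M" and n: "0 < n" and lam: "0 \<le> lam" and R: "2 \<le> R" "768 * M\<^sup>2 \<le> (real R)\<^sup>2"
    and k: "0 < k" and good: "good_design M n p (2 * k) (2 * k * R) z"
    and b: "feasible n p k lam z b" and b': "card (nsupp p b') \<le> k" "\<And>j. j < p \<Longrightarrow> \<bar>residual_correlation n p z b' j\<bar> \<le> real n * lam"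
  shows "(\<Sum>j<p. \<bar>b j - b' j\<bar>) \<le> 576 * M * real k * lam"
proof -
  define d where "d = (\<lambda>j. b j - b' j)"
  have "nsupp p d \<subseteq> nsupp p b \<union> nsupp p b'" by (auto simp: nsupp_def d_def)
  then have "card (nsupp p d) \<le> card (nsupp p b \<union> nsupp p b')" by (intro card_mono) auto
  also have "\<dots> \<le> card (nsupp p b) + card (nsupp p b')" by (rule card_Un_le)
  finally have sparse: "card (nsupp p d) \<le> 2 * k" using b b' by (simp add: feasible_def)
  have "(\<Sum>j<p. \<bar>d j\<bar>) \<le> 3 * real (2 * k) * lam / (1 / (24 * M) / 4)"
  proof (rule dantzig_l1_bound[OF n _ lam sparse])
    show "0 < 1 / (24 * M) / 4" using M by simp
    show "1 / (24 * M) / 4 * real n * (\<Sum>j<p. (d j)\<^sup>2) \<le> (\<Sum>i<n. (\<Sum>j<p. snd (z i) j * d j)\<^sup>2)"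
    proof (rule restricted_eigenvalue[where N = "2 * k * R" and m = "2 * k" and D = "8 * M"])
      show "0 < 2 * k * R" "2 * (2 * k) \<le> 2 * k * R" using k R by auto
      show "0 \<le> 8 * M" "0 < 1 / (24 * M)" using M by auto
      have "4 * (8 * M) * (real (2 * k))\<^sup>2 = (1 / (24 * M)) * ((real (2 * k))\<^sup>2 * (768 * M\<^sup>2))"
        using M by (simp add: power2_eq_square)
      also have "\<dots> \<le> (1 / (24 * M)) * ((real (2 * k))\<^sup>2 * (real R)\<^sup>2)"
        using R M by (intro mult_left_mono) auto
      finally show "4 * (8 * M) * (real (2 * k))\<^sup>2 \<le> 1 / (24 * M) * (real (2 * k * R))\<^sup>2"
        by (simp add: power_mult_distrib)
      show "card (nsupp p d) \<le> 2 * k" by (rule sparse)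
    qed (use good in \<open>auto simp: good_design_def\<close>)
    fix j assume j: "j < p"
    have "(\<Sum>i<n. snd (z i) j * (\<Sum>l<p. snd (z i) l * d l)) = residual_correlation n p z b' j - residual_correlation n p z b j"
      unfolding residual_correlation_def d_def sum_subtractf[symmetric]
      by (intro sum.cong refl) (simp add: sum_subtractf right_diff_distrib)
    then show "\<bar>\<Sum>i<n. snd (z i) j * (\<Sum>l<p. snd (z i) l * d l)\<bar> \<le> 3 * real n * lam"
      using b j b'(2)[OF j] by (auto simp: feasible_def abs_le_iff)
  qed
  then show ?thesis using M by (simp add: d_def mult_ac)
qed

text \<open>The correlations depend continuously on the coefficients, so a rational vector with the same
  support and close enough to \<open>b'\<close> satisfies the weaker constraint.\<close>

lemma rational_feasible:
  assumes n: "0 < n" and lam: "0 < lam"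
    and b': "card (nsupp p b') \<le> k" "\<And>j. j < p \<Longrightarrow> \<bar>residual_correlation n p z b' j\<bar> \<le> real n * lam"
  shows "\<exists>xs :: rat list. feasible n p k lam z (\<lambda>j. real_of_rat (xs ! j))"
proof -
  define G where "G = (\<Sum>j<p. \<Sum>i<n. \<Sum>l<p. \<bar>snd (z i) j * snd (z i) l\<bar>)"
  have G: "0 \<le> G" unfolding G_def by (intro sum_nonneg) auto
  define e where "e = real n * lam / (G + 1)"
  have e: "0 < e" using n lam G by (simp add: e_def)
  have "\<exists>q :: rat. \<bar>real_of_rat q - b' j\<bar> \<le> e \<and> (b' j = 0 \<longrightarrow> q = 0)" for j
  proof (cases "b' j = 0")
    case True then show ?thesis using e by (intro exI[of _ 0]) auto
  next
    case False
    obtain q where "b' j < real_of_rat q" "real_of_rat q < b' j + e"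
      using of_rat_dense[of "b' j" "b' j + e"] e by auto
    then show ?thesis using False by (intro exI[of _ q]) auto
  qed
  then obtain q :: "nat \<Rightarrow> rat" where q: "\<And>j. \<bar>real_of_rat (q j) - b' j\<bar> \<le> e" "\<And>j. b' j = 0 \<Longrightarrow> q j = 0"
    by metis
  define b where "b = (\<lambda>j. real_of_rat (q j))"
  have nth: "real_of_rat (map q [0..<p] ! j) = b j" if "j < p" for j using that by (simp add: b_def)
  have ns: "nsupp p (\<lambda>j. real_of_rat (map q [0..<p] ! j)) \<subseteq> nsupp p b'"
    using q(2) by (auto simp: nsupp_def)
  have rc: "residual_correlation n p z (\<lambda>j. real_of_rat (map q [0..<p] ! j)) j = residual_correlation n p z b j" for j
    unfolding residual_correlation_def using nth by simp
  have "feasible n p k lam z (\<lambda>j. real_of_rat (map q [0..<p] ! j))"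
    unfolding feasible_def rc
  proof (intro conjI allI impI)
    show "card (nsupp p (\<lambda>j. real_of_rat (map q [0..<p] ! j))) \<le> k"
      using card_mono[OF finite_nsupp ns] b'(1) by linarith
    fix j assume j: "j < p"
    have "residual_correlation n p z b j = residual_correlation n p z b' j - (\<Sum>i<n. \<Sum>l<p. snd (z i) j * snd (z i) l * (b l - b' l))"
      unfolding residual_correlation_def sum_subtractf[symmetric]
      by (intro sum.cong refl) (simp add: sum_subtractf right_diff_distrib sum_distrib_left mult.assoc)
    moreover have "\<bar>\<Sum>i<n. \<Sum>l<p. snd (z i) j * snd (z i) l * (b l - b' l)\<bar> \<le> real n * lam"
    proof -
      have "\<bar>\<Sum>i<n. \<Sum>l<p. snd (z i) j * snd (z i) l * (b l - b' l)\<bar> \<le> (\<Sum>i<n. \<Sum>l<p. \<bar>snd (z i) j * snd (z i) l\<bar> * e)"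
        by (rule order_trans[OF sum_abs], rule sum_mono, rule order_trans[OF sum_abs], rule sum_mono)
          (simp add: abs_mult b_def q(1) mult_left_mono)
      also have "\<dots> = (\<Sum>i<n. \<Sum>l<p. \<bar>snd (z i) j * snd (z i) l\<bar>) * e"
        by (simp only: sum_distrib_right)
      also have "\<dots> \<le> G * e"
        unfolding G_def using j e
        by (intro mult_right_mono member_le_sum[where f = "\<lambda>j. \<Sum>i<n. \<Sum>l<p. \<bar>snd (z i) j * snd (z i) l\<bar>"]) (auto intro: sum_nonneg)
      also have "\<dots> \<le> (G + 1) * e" using e by simp
      also have "\<dots> = real n * lam" using G by (simp add: e_def)
      finally show ?thesis .
    qed
    ultimately show "\<bar>residual_correlation n p z b j\<bar> \<le> 2 * real n * lam"
      using b'(2)[OF j] by linarith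
  qed
  then show ?thesis by blast
qed

text \<open>Choosing the first feasible vector in an enumeration of the rational vectors makes the selection
  measurable. If no vector is feasible, the value is arbitrary but still measurable.\<close>

definition selected_index :: "nat \<Rightarrow> nat \<Rightarrow> nat \<Rightarrow> real \<Rightarrow> obs \<Rightarrow> nat" where
  "selected_index n p k lam z = (LEAST i. feasible n p k lam z (\<lambda>j. real_of_rat ((from_nat i :: rat list) ! j)))"

definition estimator :: "nat \<Rightarrow> nat \<Rightarrow> nat \<Rightarrow> real \<Rightarrow> obs \<Rightarrow> nat \<Rightarrow> real" where
  "estimator n p k lam z j = real_of_rat ((from_nat (selected_index n p k lam z) :: rat list) ! j)"

lemma measurable_selected_index:
  "selected_index n p k lam \<in> measurable (obs_space n p) (count_space UNIV)"
proof -
  have "Measurable.pred (obs_space n p) (\<lambda>z. feasible n p k lam z b)" for b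
  proof -
    have [measurable]: "Measurable.pred (obs_space n p) (\<lambda>z. \<bar>residual_correlation n p z b j\<bar> \<le> 2 * real n * lam)" if "j \<in> {..<p}" for j
    proof -
      note [measurable] = measurable_residual_correlation[OF that[unfolded lessThan_iff], of n b]
      show ?thesis by measurable
    qed
    have "Measurable.pred (obs_space n p) (\<lambda>z. \<forall>j\<in>{..<p}. \<bar>residual_correlation n p z b j\<bar> \<le> 2 * real n * lam)"
      by (rule pred_intros_finite(3)) simp_all
    then show ?thesis unfolding feasible_def by (simp add: Ball_def)
  qed
  then show ?thesis
    unfolding selected_index_def[abs_def] by (intro measurable_Least) simp
qed

lemma measurable_estimator_form:
  "(\<lambda>z. \<Sum>j<p. x j * estimator n p k lam z j) \<in> borel_measurable (obs_space n p)"
  unfolding estimator_def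
  by (rule measurable_compose[OF measurable_selected_index, of "\<lambda>i. \<Sum>j<p. x j * real_of_rat ((from_nat i :: rat list) ! j)"]) simp

lemma feasible_estimator:
  assumes "\<exists>xs :: rat list. feasible n p k lam z (\<lambda>j. real_of_rat (xs ! j))"
  shows "feasible n p k lam z (estimator n p k lam z)"
proof -
  obtain xs :: "rat list" where "feasible n p k lam z (\<lambda>j. real_of_rat (xs ! j))" using assms by blast
  then have "feasible n p k lam z (\<lambda>j. real_of_rat ((from_nat (to_nat xs) :: rat list) ! j))" by simp
  then show ?thesis unfolding estimator_def[abs_def] selected_index_def by (rule LeastI)
qed

text \<open>The interval is \<open>\<xi> \<bullet> b\<close> plus or minus \<open>A\<close> times the \<open>\<ell>\<^sub>1\<close> error of the estimator \<open>b\<close>; its length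
  does not depend on the data, and it covers unless the event of \<open>bad_event_bound\<close> occurs.\<close>

lemma minimax_length_le:
  fixes M M2 lam A \<alpha> :: real
  assumes M: "1 \<le> M" and p: "2 \<le> p" and n: "0 < n" and k: "0 < k" and M2: "0 < M2"
    and small: "ln (real p) * M2\<^sup>2 * M \<le> real n / 2"
    and lam: "lam = (M2\<^sup>2 * M + 2) * sqrt (ln (real p) / real n)"
    and R: "2 \<le> R" "768 * M\<^sup>2 \<le> (real R)\<^sup>2"
    and \<alpha>: "2 / real p + real p * exp (- real n) + (real p * (2 * real (2 * k * R) + 1)) ^ (2 * k) * exp (- real n / 4) \<le> \<alpha>"
    and \<xi>: "dim_vec \<xi> = p" and A: "\<And>j. j < p \<Longrightarrow> \<bar>vec_index \<xi> j\<bar> \<le> A"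
  shows "minimax_length n p \<alpha> (Theta M M2 p k) (\<lambda>\<beta>. scalar_prod \<xi> \<beta>) \<le> ennreal (2 * (A * (576 * M * real k * lam)))"
proof -
  have p0: "0 < p" and M0: "0 < M" using p M by auto
  have lam0: "0 < lam" unfolding lam using n p M0 M2 by (intro mult_pos_pos add_pos_pos) auto
  define h where "h = A * (576 * M * real k * lam)"
  have A0: "0 \<le> A" using A[OF p0] by linarith
  have h0: "0 \<le> h" unfolding h_def using A0 M0 lam0 by simp
  define c where "c = (\<lambda>z. \<Sum>j<p. vec_index \<xi> j * estimator n p k lam z j)"
  have cm: "c \<in> borel_measurable (obs_space n p)" unfolding c_def by (rule measurable_estimator_form)
  define l where "l = (\<lambda>z. c z - h)"
  define u where "u = (\<lambda>z. c z + h)"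
  have sp: "prob_space (obs_law n p (\<beta>, \<Omega>, \<sigma>))" if "(\<beta>, \<Omega>, \<sigma>) \<in> Theta M M2 p k" for \<beta> \<Omega> \<sigma>
  proof -
    have wc: "well_conditioned M p \<Omega>" and s: "0 < \<sigma>" using that by (auto simp: Theta_iff)
    have mv: "prob_space (mvnormal p \<Omega>)" by (rule prob_space_mvnormal[OF wc M0 p0])
    show ?thesis unfolding obs_law_eq_PiM[OF mv s] by (intro prob_space_PiM prob_space_single_law[OF mv s])
  qed
  have cov: "ennreal (1 - \<alpha>) \<le> emeasure (obs_law n p (\<beta>, \<Omega>, \<sigma>)) {z \<in> space (obs_space n p). l z \<le> scalar_prod \<xi> \<beta> \<and> scalar_prod \<xi> \<beta> \<le> u z}"
    if th: "(\<beta>, \<Omega>, \<sigma>) \<in> Theta M M2 p k" for \<beta> \<Omega> \<sigma>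
  proof -
    let ?P = "obs_law n p (\<beta>, \<Omega>, \<sigma>)"
    interpret P: prob_space ?P by (rule sp[OF th])
    have wc: "well_conditioned M p \<Omega>" and s: "0 < \<sigma>" "\<sigma> \<le> M2" and \<beta>: "\<beta> \<in> carrier_vec p" "l0_norm \<beta> \<le> k"
      using th by (auto simp: Theta_iff)
    have ns: "card (nsupp p (vec_index \<beta>)) \<le> k"
      using \<beta> by (auto simp: l0_norm_def vsupp_def nsupp_def)
    have N: "0 < 2 * k * R" using k R by simp
    obtain B where B: "B \<in> sets (obs_space n p)"
      and Bp: "emeasure ?P B \<le> ennreal (2 / real p + real p * exp (- real n) + (real p * (2 * real (2 * k * R) + 1)) ^ (2 * k) * exp (- real n / 4))"
      and good: "\<forall>z \<in> space (obs_space n p) - B. good_design M n p (2 * k) (2 * k * R) z \<and> (\<forall>j<p. \<bar>residual_correlation n p z (vec_index \<beta>) j\<bar> \<le> real n * lam)"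
      using bad_event_bound[OF wc M0 p n s N small lam, of \<beta> "2 * k"] by (elim bexE conjE) (rule that)
    have in_ci: "l z \<le> scalar_prod \<xi> \<beta> \<and> scalar_prod \<xi> \<beta> \<le> u z" if z: "z \<in> space (obs_space n p) - B" for z
    proof -
      have g: "good_design M n p (2 * k) (2 * k * R) z"
        and rc: "\<And>j. j < p \<Longrightarrow> \<bar>residual_correlation n p z (vec_index \<beta>) j\<bar> \<le> real n * lam"
        using good z by auto
      have f: "feasible n p k lam z (estimator n p k lam z)"
        by (intro feasible_estimator rational_feasible[OF n lam0 ns rc])
      have "c z - scalar_prod \<xi> \<beta> = (\<Sum>j<p. vec_index \<xi> j * (estimator n p k lam z j - vec_index \<beta> j))"
        using \<beta>(1) by (simp add: c_def scalar_prod_def lessThan_atLeast0 sum_subtractf right_diff_distrib)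
      also have "\<bar>\<dots>\<bar> \<le> (\<Sum>j<p. A * \<bar>estimator n p k lam z j - vec_index \<beta> j\<bar>)"
        by (rule order_trans[OF sum_abs], rule sum_mono) (simp add: abs_mult A mult_right_mono)
      also have "\<dots> = A * (\<Sum>j<p. \<bar>estimator n p k lam z j - vec_index \<beta> j\<bar>)"
        by (simp only: sum_distrib_left)
      also have "\<dots> \<le> h"
        unfolding h_def by (intro mult_left_mono A0 feasible_l1_close[OF M0 n less_imp_le[OF lam0] R k g f ns rc])
      finally have "\<bar>c z - scalar_prod \<xi> \<beta>\<bar> \<le> h" .
      then show ?thesis by (auto simp: l_def u_def)
    qed
    have "P.prob B \<le> \<alpha>"
    proof -
      have "ennreal (P.prob B) \<le> ennreal \<alpha>"
        using Bp ennreal_leI[OF \<alpha>] by (simp add: P.emeasure_eq_measure) 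
      moreover have "0 \<le> \<alpha>" by (rule order_trans[OF _ \<alpha>]) (intro add_nonneg_nonneg mult_nonneg_nonneg zero_le_power divide_nonneg_nonneg; simp)
      ultimately show ?thesis by (simp add: ennreal_le_iff)
    qed
    then have "1 - \<alpha> \<le> P.prob (space ?P - B)"
      using B by (subst P.prob_compl) auto
    then have "ennreal (1 - \<alpha>) \<le> emeasure ?P (space (obs_space n p) - B)"
      by (simp add: P.emeasure_eq_measure ennreal_leI)
    also have "\<dots> \<le> emeasure ?P {z \<in> space (obs_space n p). l z \<le> scalar_prod \<xi> \<beta> \<and> scalar_prod \<xi> \<beta> \<le> u z}"
    proof (rule emeasure_mono)
      show "space (obs_space n p) - B \<subseteq> {z \<in> space (obs_space n p). l z \<le> scalar_prod \<xi> \<beta> \<and> scalar_prod \<xi> \<beta> \<le> u z}"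
        using in_ci by blast
      note [measurable] = cm
      show "{z \<in> space (obs_space n p). l z \<le> scalar_prod \<xi> \<beta> \<and> scalar_prod \<xi> \<beta> \<le> u z} \<in> sets ?P"
        unfolding l_def u_def sets_obs_law by measurable
    qed
    finally show ?thesis .
  qed
  have ci: "(l, u) \<in> conf_intervals n p \<alpha> (Theta M M2 p k) (\<lambda>\<beta>. scalar_prod \<xi> \<beta>)"
  proof -
    have "l \<in> borel_measurable (obs_space n p)" "u \<in> borel_measurable (obs_space n p)"
      unfolding l_def u_def using cm by measurable
    moreover have "ennreal (1 - \<alpha>) \<le> (INF (\<beta>, \<Omega>, \<sigma>)\<in>Theta M M2 p k.
        emeasure (obs_law n p (\<beta>, \<Omega>, \<sigma>)) {z \<in> space (obs_space n p). l z \<le> scalar_prod \<xi> \<beta> \<and> scalar_prod \<xi> \<beta> \<le> u z})"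
      by (rule INF_greatest) (clarify, rule cov)
    ultimately show ?thesis using h0 by (simp add: conf_intervals_def l_def u_def)
  qed
  have "minimax_length n p \<alpha> (Theta M M2 p k) (\<lambda>\<beta>. scalar_prod \<xi> \<beta>) \<le> (SUP \<theta>\<in>Theta M M2 p k. \<integral>\<^sup>+ z. ennreal (u z - l z) \<partial>obs_law n p \<theta>)"
    unfolding minimax_length_def by (rule INF_lower2[OF ci]) simp
  also have "\<dots> \<le> ennreal (2 * h)"
  proof (rule SUP_least)
    fix \<theta> assume th: "\<theta> \<in> Theta M M2 p k"
    interpret P: prob_space "obs_law n p \<theta>" using th sp by (cases \<theta>) auto
    have "(\<integral>\<^sup>+ z. ennreal (u z - l z) \<partial>obs_law n p \<theta>) = (\<integral>\<^sup>+ z. ennreal (2 * h) \<partial>obs_law n p \<theta>)"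
      by (simp add: u_def l_def)
    also have "\<dots> = ennreal (2 * h)" using P.emeasure_space_1 by simp
    finally show "(\<integral>\<^sup>+ z. ennreal (u z - l z) \<partial>obs_law n p \<theta>) \<le> ennreal (2 * h)" by simp
  qed
  finally show ?thesis unfolding h_def .
qed

section \<open>The minimax rate\<close>

lemma abs_le_linf_norm: "j < dim_vec \<xi> \<Longrightarrow> \<bar>vec_index \<xi> j\<bar> \<le> linf_norm \<xi>"
  unfolding linf_norm_def by (rule Max_ge) auto

lemma Xi_entries:
  assumes \<xi>: "\<xi> \<in> Xi p q cbar" and c: "1 \<le> cbar"
  shows "dim_vec \<xi> = p" "card (vsupp \<xi>) = q" "0 < p" "0 \<le> linf_norm \<xi>"
    and "\<And>j. j \<in> vsupp \<xi> \<Longrightarrow> linf_norm \<xi> / cbar \<le> \<bar>vec_index \<xi> j\<bar>"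
proof -
  have carrier: "\<xi> \<in> carrier_vec p" and nz: "\<xi> \<noteq> 0\<^sub>v p" and q: "l0_norm \<xi> = q"
    and ratio: "Max ((\<lambda>j. \<bar>vec_index \<xi> j\<bar>) ` vsupp \<xi>) \<le> cbar * Min ((\<lambda>j. \<bar>vec_index \<xi> j\<bar>) ` vsupp \<xi>)"
    using \<xi> by (auto simp: Xi_def)
  show d: "dim_vec \<xi> = p" using carrier by simp
  show "card (vsupp \<xi>) = q" using q by (simp add: l0_norm_def)
  have "\<exists>j<p. vec_index \<xi> j \<noteq> 0"
  proof (rule ccontr)
    assume "\<not> (\<exists>j<p. vec_index \<xi> j \<noteq> 0)"
    then have "\<xi> = 0\<^sub>v p" using d by (intro eq_vecI) auto
    then show False using nz by simp
  qed
  then obtain j0 where j0: "j0 < p" "j0 \<in> vsupp \<xi>" using d by (auto simp: vsupp_def)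
  then show "0 < p" by simp
  show nn: "0 \<le> linf_norm \<xi>"
    using abs_le_linf_norm[of j0 \<xi>] j0 d by (meson abs_ge_zero order_trans)
  have fin: "finite (vsupp \<xi>)" by (simp add: vsupp_def)
  fix j assume j: "j \<in> vsupp \<xi>"
  have "linf_norm \<xi> \<le> Max ((\<lambda>j. \<bar>vec_index \<xi> j\<bar>) ` vsupp \<xi>)"
  proof -
    have "linf_norm \<xi> \<in> (\<lambda>j. \<bar>vec_index \<xi> j\<bar>) ` {..<dim_vec \<xi>}"
      unfolding linf_norm_def by (rule Max_in) (use j0 d in auto)
    then obtain i where i: "i < dim_vec \<xi>" "linf_norm \<xi> = \<bar>vec_index \<xi> i\<bar>" by auto
    show ?thesis
    proof (cases "vec_index \<xi> i = 0")
      case True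
      have "\<bar>vec_index \<xi> j\<bar> \<le> Max ((\<lambda>j. \<bar>vec_index \<xi> j\<bar>) ` vsupp \<xi>)" using j fin by (intro Max_ge) auto
      then show ?thesis using i True by simp
    next
      case False
      then have "i \<in> vsupp \<xi>" using i by (simp add: vsupp_def)
      then show ?thesis unfolding i(2) using fin by (intro Max_ge) auto
    qed
  qed
  also note ratio
  also have "cbar * Min ((\<lambda>j. \<bar>vec_index \<xi> j\<bar>) ` vsupp \<xi>) \<le> cbar * \<bar>vec_index \<xi> j\<bar>"
    using c j fin by (intro mult_left_mono Min_le) auto
  finally show "linf_norm \<xi> / cbar \<le> \<bar>vec_index \<xi> j\<bar>" using c by (simp add: divide_le_eq mult.commute)
qed

text \<open>The choice of the parameters of \<open>minimax_length_ge\<close>: \<open>\<rho>\<^sup>2 = M2\<^sup>2 (\<tau> / 2) ln p / n\<close> makes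
  \<open>exp (2 n \<rho>\<^sup>2 / M2\<^sup>2)\<close> equal to \<open>p powr \<tau>\<close>, and \<open>r = q div k\<close> is at least \<open>q / (2 k)\<close>.\<close>

lemma minimax_rate_lower:
  fixes \<alpha> \<gamma> \<gamma>q cq M1 M2 cbar c \<eta> \<tau> :: real
  assumes \<alpha>: "0 < \<alpha>" "\<alpha> < 1 / 2" and \<gamma>: "0 \<le> \<gamma>" "2 * \<gamma> < \<gamma>q" "\<gamma>q \<le> 1"
    and cq: "0 < cq" and M: "1 < M1" "0 < M2" and cbar: "1 \<le> cbar"
    and \<eta>: "\<eta> = (1 - 2 * \<alpha>) / 2" and \<tau>: "\<tau> = \<gamma>q - 2 * \<gamma>"
    and c: "0 < c" "c \<le> 1" "c \<le> cq / 2" "4 * c / cq \<le> ln (1 + \<eta>\<^sup>2)"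
    and n: "0 < n" and p: "2 \<le> p" and k: "1 \<le> k" "real k \<le> c * real p powr \<gamma>" "real k * ln (real p) \<le> c * real n"
    and \<xi>: "\<xi> \<in> Xi p (nat \<lfloor>cq * real p powr \<gamma>q\<rfloor>) cbar"
  shows "ennreal ((\<eta> * (M2 * sqrt (\<tau> / 2)) / cbar) * linf_norm \<xi> * real k * sqrt (ln (real p) / real n))
      \<le> minimax_length n p \<alpha> (Theta M1 M2 p k) (\<lambda>\<beta>. scalar_prod \<xi> \<beta>)"
proof -
  define q where "q = nat \<lfloor>cq * real p powr \<gamma>q\<rfloor>"
  define \<rho> where "\<rho> = M2 * sqrt (\<tau> / 2) * sqrt (ln (real p) / real n)"
  define r where "r = q div k"
  have \<xi>q: "\<xi> \<in> Xi p q cbar" using \<xi> by (simp add: q_def)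
  note xi = Xi_entries[OF \<xi>q cbar]
  have \<tau>01: "0 < \<tau>" "\<tau> \<le> 1" using \<gamma> by (auto simp: \<tau>)
  have \<eta>0: "0 < \<eta>" using \<alpha> by (simp add: \<eta>)
  have lp: "0 < ln (real p)" using p by (simp add: ln_gt_zero)
  have pg: "1 \<le> real p" using p by simp
  have x: "2 * real k \<le> cq * real p powr \<gamma>q"
  proof -
    have "real p powr \<gamma> \<le> real p powr \<gamma>q" using pg \<gamma> by (intro powr_mono) auto
    then have "c * real p powr \<gamma> \<le> (cq / 2) * real p powr \<gamma>q"
      using c by (intro mult_mono) auto
    then show ?thesis using k(2) by simp
  qed
  have q_ge: "cq * real p powr \<gamma>q / 2 \<le> real q"
  proof -
    have "cq * real p powr \<gamma>q - 1 \<le> real_of_int \<lfloor>cq * real p powr \<gamma>q\<rfloor>" by linarith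
    also have "\<dots> \<le> real q" unfolding q_def by linarith
    finally show ?thesis using x k(1) by linarith
  qed
  then have kq: "k \<le> q" using x by linarith
  have r0: "0 < r" unfolding r_def using kq k(1) by (simp add: div_greater_zero_iff)
  have q_le: "real q \<le> 2 * real r * real k"
  proof -
    have "q = r * k + q mod k" unfolding r_def by simp
    also have "\<dots> \<le> r * k + r * k"
    proof (rule add_left_mono)
      have "q mod k \<le> 1 * k" using mod_less_divisor[of k q] k(1) by simp
      also have "\<dots> \<le> r * k" using r0 by (intro mult_le_mono1) simp
      finally show "q mod k \<le> r * k" .
    qed
    finally have "q \<le> 2 * r * k" by simp
    then have "real q \<le> real (2 * r * k)" by (rule of_nat_mono)
    then show ?thesis by simp
  qed
  have \<rho>2: "\<rho>\<^sup>2 = M2\<^sup>2 * (\<tau> / 2) * (ln (real p) / real n)"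
    unfolding \<rho>_def using \<tau>01 lp by (simp add: power_mult_distrib)
  have \<rho>0: "0 \<le> \<rho>" unfolding \<rho>_def using M \<tau>01 lp by simp
  have k\<rho>: "real k * \<rho>\<^sup>2 \<le> M2\<^sup>2 / 2"
  proof -
    have "real k * \<rho>\<^sup>2 = (M2\<^sup>2 / 2) * (\<tau> * (real k * ln (real p) / real n))"
      unfolding \<rho>2 by simp
    also have "\<dots> \<le> (M2\<^sup>2 / 2) * 1"
    proof (rule mult_left_mono)
      have "real k * ln (real p) / real n \<le> c" using k(3) n by (simp add: divide_le_eq)
      then have "real k * ln (real p) / real n \<le> 1" using c by simp
      then show "\<tau> * (real k * ln (real p) / real n) \<le> 1"
        using \<tau>01 lp by (intro mult_le_one) auto
    qed simp
    finally show ?thesis by simp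
  qed
  have T: "exp (2 * real n * \<rho>\<^sup>2 / M2\<^sup>2) = real p powr \<tau>"
  proof -
    have "2 * real n * \<rho>\<^sup>2 / M2\<^sup>2 = \<tau> * ln (real p)" unfolding \<rho>2 using n M by simp
    then show ?thesis using p by (simp add: powr_def)
  qed
  have chi: "exp (real k * exp (2 * real n * \<rho>\<^sup>2 / M2\<^sup>2) / real r) \<le> 1 + \<eta>\<^sup>2"
  proof -
    have q0: "0 < real q" using kq k(1) by linarith
    have "real k * real p powr \<tau> / real r \<le> 2 * (real k)\<^sup>2 * real p powr \<tau> / real q"
    proof -
      have "real k * real p powr \<tau> * real q \<le> real k * real p powr \<tau> * (2 * real r * real k)"
        by (intro mult_left_mono q_le) auto
      then show ?thesis using r0 q0 by (simp add: field_simps power2_eq_square)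
    qed
    also have "\<dots> \<le> 2 * (c * real p powr \<gamma>)\<^sup>2 * real p powr \<tau> / (cq * real p powr \<gamma>q / 2)"
      using k(2) q_ge cq pg p q0 by (intro frac_le mult_right_mono mult_left_mono power_mono) auto
    also have "\<dots> = 4 * c\<^sup>2 / cq * (real p powr \<gamma> * real p powr \<gamma> * real p powr \<tau> / real p powr \<gamma>q)"
      by (simp add: power2_eq_square)
    also have "real p powr \<gamma> * real p powr \<gamma> * real p powr \<tau> / real p powr \<gamma>q = 1"
    proof -
      have "real p powr \<gamma> * real p powr \<gamma> * real p powr \<tau> = real p powr \<gamma>q"
        unfolding powr_add[symmetric] by (simp add: \<tau>)
      then show ?thesis using p by simp
    qed
    also have "4 * c\<^sup>2 / cq * 1 \<le> 4 * c / cq"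
      using c cq by (simp add: power2_eq_square divide_right_mono mult_left_le)
    also note c(4)
    finally have "real k * real p powr \<tau> / real r \<le> ln (1 + \<eta>\<^sup>2)" .
    then have "exp (real k * real p powr \<tau> / real r) \<le> exp (ln (1 + \<eta>\<^sup>2))" by simp
    also have "\<dots> = 1 + \<eta>\<^sup>2" by (rule exp_ln) (simp add: add_pos_nonneg)
    finally show ?thesis unfolding T .
  qed
  have "ennreal ((1 - 2 * \<alpha> - \<eta>) * (\<rho> * real k * (linf_norm \<xi> / cbar))) \<le> minimax_length n p \<alpha> (Theta M1 M2 p k) (\<lambda>\<beta>. scalar_prod \<xi> \<beta>)"
  proof (rule minimax_length_ge[where r = r])
    show "k * r \<le> card (vsupp \<xi>)" unfolding xi(2) r_def by (simp add: mult.commute)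
    show "2 * \<alpha> + \<eta> < 1" using \<alpha> by (simp add: \<eta> field_simps)
    show "0 \<le> linf_norm \<xi> / cbar" using xi(4) cbar by simp
  qed (use M r0 xi \<rho>0 k\<rho> \<eta>0 \<alpha> chi in auto)
  moreover have "(1 - 2 * \<alpha> - \<eta>) * (\<rho> * real k * (linf_norm \<xi> / cbar))
      = (\<eta> * (M2 * sqrt (\<tau> / 2)) / cbar) * linf_norm \<xi> * real k * sqrt (ln (real p) / real n)"
  proof -
    have e: "1 - 2 * \<alpha> - \<eta> = \<eta>" by (simp add: \<eta> field_simps)
    show ?thesis unfolding e \<rho>_def by (simp add: mult_ac)
  qed
  ultimately show ?thesis by (simp only:)
qed

text \<open>The number of grid points is at most \<open>p ^ (6 k)\<close>, because \<open>2 * (2 * k * R) + 1 \<le> p\<^sup>2\<close>;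
  as \<open>k ln p \<le> n / 48\<close> this is at most \<open>exp (n / 8)\<close>.\<close>

lemma failure_probability_le:
  fixes \<alpha> c :: real
  assumes \<alpha>: "0 < \<alpha>" and c: "c \<le> 1 / 48" and R: "2 \<le> R"
    and n: "24 / \<alpha> \<le> real n" and p: "24 / \<alpha> \<le> real p" "5 * R \<le> p"
    and k: "1 \<le> k" "k \<le> p" "real k * ln (real p) \<le> c * real n"
  shows "2 / real p + real p * exp (- real n) + (real p * (2 * real (2 * k * R) + 1)) ^ (2 * k) * exp (- real n / 4) \<le> \<alpha>"
proof -
  have n0: "0 < real n" and p0: "0 < real p" using n p \<alpha> divide_pos_pos[of 24 \<alpha>] by linarith+
  have p1: "1 \<le> real p" using p0 by (simp add: Suc_leI)
  have lp: "0 \<le> ln (real p)" using p1 by simp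
  have exp_small: "exp (- real n / 8) \<le> \<alpha> / 3"
  proof -
    have "3 / \<alpha> \<le> real n / 8" using n by simp
    also have "\<dots> \<le> exp (real n / 8)" using exp_ge_add_one_self[of "real n / 8"] by linarith
    finally have "1 / exp (real n / 8) \<le> 1 / (3 / \<alpha>)" using \<alpha> by (intro divide_left_mono) auto
    then show ?thesis by (simp add: exp_minus inverse_eq_divide)
  qed
  have "2 / real p \<le> \<alpha> / 3"
  proof -
    have "24 \<le> \<alpha> * real p" using p(1) \<alpha> by (simp add: divide_le_eq mult.commute)
    then show ?thesis using p0 by (simp add: divide_le_eq)
  qed
  moreover have "real p * exp (- real n) \<le> \<alpha> / 3"
  proof -
    have "ln (real p) \<le> real k * ln (real p)" using k(1) lp by (simp add: mult_le_cancel_right1)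
    also have "\<dots> \<le> real n / 48" using k(3) mult_right_mono[OF c, of "real n"] by simp
    finally have "real p * exp (- real n) \<le> exp (real n / 48) * exp (- real n)"
      using p0 by (intro mult_right_mono) (auto simp: ln_le_cancel_iff[symmetric] simp del: ln_le_cancel_iff)
    also have "\<dots> \<le> exp (- real n / 8)" using n0 by (simp add: exp_add[symmetric])
    finally show ?thesis using exp_small by linarith
  qed
  moreover have "(real p * (2 * real (2 * k * R) + 1)) ^ (2 * k) * exp (- real n / 4) \<le> \<alpha> / 3"
  proof -
    have "2 * (2 * k * R) + 1 \<le> 5 * R * k" using k(1) R mult_le_mono[of 1 R 1 k] by simp
    also have "\<dots> \<le> p * p" using p(2) k(2) by (rule mult_le_mono)
    finally have "real (2 * (2 * k * R) + 1) \<le> real (p * p)" by (rule of_nat_mono)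
    then have "real p * (2 * real (2 * k * R) + 1) \<le> real p * (real p * real p)"
      by (intro mult_left_mono) auto
    also have "\<dots> = exp (3 * ln (real p))"
    proof -
      have "exp (3 * ln (real p)) = exp (ln (real p)) ^ 3" using exp_of_nat_mult[of 3 "ln (real p)"] by simp
      then show ?thesis using p0 by (simp add: power3_eq_cube)
    qed
    finally have "(real p * (2 * real (2 * k * R) + 1)) ^ (2 * k) \<le> exp (3 * ln (real p)) ^ (2 * k)"
      by (rule power_mono) simp
    also have "\<dots> = exp (6 * (real k * ln (real p)))" by (simp add: exp_of_nat_mult[symmetric] mult_ac)
    also have "\<dots> \<le> exp (real n / 8)"
      using k(3) mult_right_mono[OF c, of "real n"] by simp
    finally have "(real p * (2 * real (2 * k * R) + 1)) ^ (2 * k) * exp (- real n / 4) \<le> exp (real n / 8) * exp (- real n / 4)"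
      by (rule mult_right_mono) simp
    also have "\<dots> = exp (- real n / 8)" by (simp add: exp_add[symmetric])
    finally show ?thesis using exp_small by linarith
  qed
  ultimately show ?thesis by linarith
qed

theorem theorem4:
  fixes \<alpha> \<gamma> \<gamma>\<^sub>q c\<^sub>q M\<^sub>1 M\<^sub>2 cbar :: real
  assumes "0 < \<alpha>" "\<alpha> < 1 / 2"
    and "0 \<le> \<gamma>" "\<gamma> < 1 / 2"
    and "2 * \<gamma> < \<gamma>\<^sub>q" "\<gamma>\<^sub>q \<le> 1"
    and "c\<^sub>q > 0" "M\<^sub>1 > 1" "M\<^sub>2 > 0" "cbar \<ge> 1"
  shows "\<exists>c > 0. \<exists>c\<^sub>1 > 0. \<exists>C\<^sub>1 > 0. \<exists>N :: nat. \<forall>n \<ge> N. \<forall>p \<ge> N. \<forall>k :: nat.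
    1 \<le> k \<longrightarrow> real k \<le> c * min (real p powr \<gamma>) (real n / ln (real p)) \<longrightarrow>
    (\<forall>\<xi> \<in> Xi p (nat \<lfloor>c\<^sub>q * real p powr \<gamma>\<^sub>q\<rfloor>) cbar.
      ennreal (c\<^sub>1 * linf_norm \<xi> * real k * sqrt (ln (real p) / real n))
        \<le> minimax_length n p \<alpha> (Theta M\<^sub>1 M\<^sub>2 p k) (\<lambda>\<beta>. scalar_prod \<xi> \<beta>) \<and>
      minimax_length n p \<alpha> (Theta M\<^sub>1 M\<^sub>2 p k) (\<lambda>\<beta>. scalar_prod \<xi> \<beta>)
        \<le> ennreal (C\<^sub>1 * linf_norm \<xi> * real k * sqrt (ln (real p) / real n)))"
proof -
  define \<eta> where "\<eta> = (1 - 2 * \<alpha>) / 2"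
  define \<tau> where "\<tau> = \<gamma>\<^sub>q - 2 * \<gamma>"
  define c where "c = min (1 / 48) (min (c\<^sub>q / 2) (min (c\<^sub>q * ln (1 + \<eta>\<^sup>2) / 4) (1 / (2 * M\<^sub>2\<^sup>2 * M\<^sub>1))))"
  define c1 where "c1 = \<eta> * (M\<^sub>2 * sqrt (\<tau> / 2)) / cbar"
  define C1 where "C1 = 1152 * M\<^sub>1 * (M\<^sub>2\<^sup>2 * M\<^sub>1 + 2)"
  \<comment> \<open>\<open>28\<^sup>2 = 784\<close> exceeds the constant \<open>768\<close> that the rounding argument requires\<close>
  define R where "R = nat \<lceil>28 * M\<^sub>1\<rceil>"
  define N where "N = nat \<lceil>24 / \<alpha>\<rceil> + 5 * R + 2"
  have \<eta>: "0 < \<eta>" using assms by (simp add: \<eta>_def)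
  have \<tau>: "0 < \<tau>" using assms by (simp add: \<tau>_def)
  have "0 < ln (1 + \<eta>\<^sup>2)" using \<eta> by (simp add: ln_gt_zero)
  then have c0: "0 < c" using assms by (simp add: c_def)
  have c_le: "c \<le> 1 / 48" "c \<le> c\<^sub>q / 2" "c \<le> c\<^sub>q * ln (1 + \<eta>\<^sup>2) / 4" "c \<le> 1 / (2 * M\<^sub>2\<^sup>2 * M\<^sub>1)"
    by (simp_all add: c_def)
  have c4: "4 * c / c\<^sub>q \<le> ln (1 + \<eta>\<^sup>2)" using c_le(3) assms(7) by (simp add: divide_le_eq mult_ac)
  have R28: "28 * M\<^sub>1 \<le> real R" unfolding R_def by linarith
  have R2: "2 \<le> R"
  proof -
    have "2 \<le> real R" using R28 assms by linarith
    then show ?thesis by simp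
  qed
  have R768: "768 * M\<^sub>1\<^sup>2 \<le> (real R)\<^sup>2"
  proof -
    have "(28 * M\<^sub>1)\<^sup>2 \<le> (real R)\<^sup>2" using R28 assms by (intro power_mono) auto
    moreover have "768 * M\<^sub>1\<^sup>2 \<le> (28 * M\<^sub>1)\<^sup>2" by (simp add: power_mult_distrib)
    ultimately show ?thesis by linarith
  qed
  have c1_pos: "0 < c1" using \<eta> \<tau> assms by (simp add: c1_def)
  have C1_pos: "0 < C1" unfolding C1_def using assms by (intro mult_pos_pos add_pos_pos zero_less_power) auto
  show ?thesis
  proof (rule exI[of _ c], rule conjI[OF c0], rule exI[of _ c1], rule conjI[OF c1_pos],
      rule exI[of _ C1], rule conjI[OF C1_pos], rule exI[of _ N], intro allI impI ballI)
    fix n p k :: nat and \<xi> :: "real Matrix.vec"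
    assume n: "N \<le> n" and p: "N \<le> p" and k: "1 \<le> k" and kc: "real k \<le> c * min (real p powr \<gamma>) (real n / ln (real p))"
      and \<xi>: "\<xi> \<in> Xi p (nat \<lfloor>c\<^sub>q * real p powr \<gamma>\<^sub>q\<rfloor>) cbar"
    have N24: "24 / \<alpha> \<le> real N" unfolding N_def by linarith
    have p2: "2 \<le> p" and n0: "0 < n" and p5: "5 * R \<le> p" using n p by (auto simp: N_def)
    have lp: "0 < ln (real p)" using p2 by (simp add: ln_gt_zero)
    have kp: "real k \<le> c * real p powr \<gamma>"
      using kc c0 by (meson less_imp_le min.cobounded1 mult_left_mono order_trans)
    have kn: "real k * ln (real p) \<le> c * real n"
    proof -
      have "real k \<le> c * (real n / ln (real p))"
        using kc c0 by (meson less_imp_le min.cobounded2 mult_left_mono order_trans)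
      then show ?thesis using lp by (simp add: pos_le_divide_eq)
    qed
    have k_le_p: "k \<le> p"
    proof -
      have "c * real p powr \<gamma> \<le> 1 * real p powr 1"
        using c_le(1) c0 p2 assms by (intro mult_mono powr_mono) auto
      then have "real k \<le> real p" using kp p2 by simp
      then show ?thesis by simp
    qed
    have xi: "dim_vec \<xi> = p" using Xi_entries(1)[OF \<xi> assms(10)] .
    show "ennreal (c1 * linf_norm \<xi> * real k * sqrt (ln (real p) / real n))
        \<le> minimax_length n p \<alpha> (Theta M\<^sub>1 M\<^sub>2 p k) (\<lambda>\<beta>. scalar_prod \<xi> \<beta>) \<and>
      minimax_length n p \<alpha> (Theta M\<^sub>1 M\<^sub>2 p k) (\<lambda>\<beta>. scalar_prod \<xi> \<beta>)
        \<le> ennreal (C1 * linf_norm \<xi> * real k * sqrt (ln (real p) / real n))"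
    proof
      show "ennreal (c1 * linf_norm \<xi> * real k * sqrt (ln (real p) / real n))
        \<le> minimax_length n p \<alpha> (Theta M\<^sub>1 M\<^sub>2 p k) (\<lambda>\<beta>. scalar_prod \<xi> \<beta>)"
        unfolding c1_def
        by (rule minimax_rate_lower[OF assms(1,2,3,5,6,7,8,9,10) \<eta>_def \<tau>_def c0 _ c_le(2) c4 n0 p2 k kp kn \<xi>])
          (use c_le(1) in simp)
      define lam where "lam = (M\<^sub>2\<^sup>2 * M\<^sub>1 + 2) * sqrt (ln (real p) / real n)"
      have "minimax_length n p \<alpha> (Theta M\<^sub>1 M\<^sub>2 p k) (\<lambda>\<beta>. scalar_prod \<xi> \<beta>) \<le> ennreal (2 * (linf_norm \<xi> * (576 * M\<^sub>1 * real k * lam)))"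
      proof (rule minimax_length_le[OF _ p2 n0 _ assms(9) _ lam_def R2 R768 _ xi])
        show "ln (real p) * M\<^sub>2\<^sup>2 * M\<^sub>1 \<le> real n / 2"
        proof -
          have m: "0 < M\<^sub>2\<^sup>2 * M\<^sub>1" using assms by simp
          have "ln (real p) \<le> real k * ln (real p)" using k lp by (simp add: mult_le_cancel_right1)
          also note kn
          also have "c * real n \<le> 1 / (2 * M\<^sub>2\<^sup>2 * M\<^sub>1) * real n" by (intro mult_right_mono c_le(4)) simp
          finally have "ln (real p) * (M\<^sub>2\<^sup>2 * M\<^sub>1) \<le> 1 / (2 * M\<^sub>2\<^sup>2 * M\<^sub>1) * real n * (M\<^sub>2\<^sup>2 * M\<^sub>1)"
            using m by (intro mult_right_mono) auto
          also have "\<dots> = real n / 2" using assms by simp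
          finally show ?thesis by (simp add: mult.assoc)
        qed
        show "2 / real p + real p * exp (- real n) + (real p * (2 * real (2 * k * R) + 1)) ^ (2 * k) * exp (- real n / 4) \<le> \<alpha>"
          by (rule failure_probability_le[OF assms(1) c_le(1) R2 _ _ p5 k k_le_p kn]) (use N24 n p in linarith)+
      qed (use assms k xi abs_le_linf_norm[of _ \<xi>] in auto)
      also have "2 * (linf_norm \<xi> * (576 * M\<^sub>1 * real k * lam)) = C1 * linf_norm \<xi> * real k * sqrt (ln (real p) / real n)"
        by (simp add: C1_def lam_def)
      finally show "minimax_length n p \<alpha> (Theta M\<^sub>1 M\<^sub>2 p k) (\<lambda>\<beta>. scalar_prod \<xi> \<beta>)
        \<le> ennreal (C1 * linf_norm \<xi> * real k * sqrt (ln (real p) / real n))" .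
    qed
  qed
qed

end
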